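(* Let $(X,\mathcal{A})$ be a compact $p$-adic analytic manifold with finite equalising atlas $\mathcal{A}$ with connected nerve graph and compact chart domains, $\omega$ a nowhere vanishing analytic differential $n$-form on $X$ and $\mu_X=|\omega|$. Let $s>1$ and $$\Delta^s h(x)=\int_X d_g(x,y)^{-s}\,(h(x)-h(y))\,|\omega(y)|.$$ The Green function $$G(x,y)=\int_0^\infty h(t,x,y)\,dt,\qquad h(t,x,y)=\sum_\psi e^{-t\lambda_\psi}\psi(x)\overline{\psi(y)},$$ for $-\Delta^s$ exists, and has the form $$G(x,y)=\sum_\psi\lambda_\psi^{-1}\psi(x)\overline{\psi(y)}$$ for $x,y\in X$, where $\psi$ runs over the wavelets on $X$ and $\lambda_\psi$ is the eigenvalue of $\Delta^s$ belonging to $\psi$.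
   Context: $K$ is a non-archimedean local field of residue characteristic $p$, with ring of integers $O_K$ and uniformiser $\pi$; $K^n$ carries the maximum norm and Haar measure $|dx|$. A $p$-adic analytic manifold $(X,\mathcal{A})$ of dimension $n$ is a Hausdorff space $X$ with an atlas $\mathcal{A}$ of charts $(U_\alpha,\phi_\alpha)$, $\phi_\alpha\colon U_\alpha\to K^n$ homeomorphisms onto open subsets, with bi-analytic transition maps $\tau_{\alpha\beta}\colon\phi_\alpha(U_\alpha\cap U_\beta)\to\phi_\beta(U_\alpha\cap U_\beta)$. For a locally bi-analytic map $F$ between open subsets of $K^n$, $e(F)$ is the smallest $N\in\mathbb{Z}$ such that $F$ takes balls of radius $p^{-N}$ to balls of the same radius, and $e(F)=-\infty$ if there is none. $\mathcal{A}$ is equalising if $\sup_{\alpha,\beta} e(\tau_{\alpha\beta})\ne-\infty$. Distinct charts are assumed to have distinct domains. Measure: in a chart write $\omega=f_\alpha\,dx_1\wedge\dots\wedge dx_n$ with $f_\alpha$ analytic; then $\mu_X(A)=\int_{\phi_\alpha(A)}|f_\alpha|\,|dx|$ for measurable $A\subseteq U_\alpha$. Nerve complex $N(\mathcal{A})$: its $k$-simplices are the non-empty intersections $U_J=\bigcap_{j\in J}U_j$ of chart domains with $|J|=k+1$; $U_J$ is a facet of $U_{J'}$ if $J\subset J'$. Simplices are identified with the corresponding subsets of $X$. The nerve graph is its $1$-skeleton. Ball: a set $B\subseteq X$ contained in a chart domain is a ball if for each chart $(U_\alpha,\phi_\alpha)$ with $B\subseteq U_\alpha$ the set $\phi_\alpha(B)$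 is a ball in $K^n$, and for any two charts with $B\subseteq U_\alpha\cap U_\beta$, $\tau_{\alpha\beta}$ takes $\phi_\alpha(B)$ to the ball $\phi_\beta(B)$ of equal radius. Join: $x\wedge y=\bigcap B$ over all balls $B\subseteq X$ containing $x$ and $y$, if such balls exist; otherwise undefined. Geodetic distance $d_g$: $d_g(x,y)=\mu_X(x\wedge y)$ if $x,y$ lie in a common ball in $X$, and otherwise $d_g(x,y)=\min_{\gamma\colon\sigma(x)\leadsto\sigma(y)}\mu_X(U_\gamma(x,y))$. Here $\sigma(x)$ is the highest-dimensional simplex of $N(\mathcal{A})$ containing $x$, $\gamma$ is a path in $N(\mathcal{A})$ from $\sigma(x)$ to $\sigma(y)$ through a sequence of adjacent faces of higher or lower dimension (of two consecutive simplices one is a facet of the other), and $U_\gamma(x,y)=\bigcup_{\sigma\in\gamma}\sigma\subseteq X$. Wavelet: a function $\psi\colon X\to\mathbb{C}$ supported on a ball $B(a)\subseteq X$ with $a\in X$ such that for any chart $(U_\alpha,\phi_\alpha)$ containing $B(a)$, the function $\psi_\alpha=\psi\circ\phi_\alpha^{-1}$ is a Kozyrev wavelet supported in a ball centred in $\phi_\alpha(a)\in K^n$. A Kozyrev wavelet supported on $b+\pi^mO_K^n$ is a constant multiple of $z\mapsto\chi(\pi^{-m-1}\,\eta\cdot z)\,1_{b+\pi^mO_K^n}(z)$, where $\chi$ is a fixed additive character of $K$ trivial on $O_K$ and non-trivial on $\pi^{-1}O_K$, and $\eta\in O_K^n$ represents a non-zero class in $(O_K/\pi O_K)^n$. Wavelets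 on $X$ are normalised to norm $1$ in $L^2(X,\mu_X)$, and the sums are over an orthonormal basis of $L^2(X,\mu_X)_w$ consisting of wavelets, where $L^2(X,\mu_X)_w$ is the closure of the span of the wavelets on $X$ with supports so small that they do not overlap (i.e. two supports are disjoint or nested). Each such $\psi$, with support $B$, is an eigenfunction of $\Delta^s$ with eigenvalue $\lambda_\psi=\int_{X\setminus B}d_g(x,y)^{-s}|\omega(y)|+\mu_X(B)^{1-s}$, for any $x\in B$.
   Formalization: On the diagonal x = y with 1 < s ≤ 2 the Green function is in general infinite (e.g. X = Z_p, ω = dx), so there the formula is stated as an identity in [0,∞]; for x ≠ y, and for all x, y if s > 2, existence and the formula are stated with finite complex values. *)

theory Defs
  imports "HOL-Analysis.Analysis"
begin

section \<open>Non-archimedean local fields\<close>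

text \<open>
  The absolute value is \<open>\<bar>x\<bar> = dist x 0\<close>, so that the topology of the field is the metric one.
  The last axiom says that the maximal ideal is principal, generated by some \<open>u \<noteq> 0\<close>, and that
  \<open>\<bar>u\<bar>\<close> is the inverse of the cardinality of the residue field (the residue classes are the sets
  \<open>{y. dist y x < 1}\<close>; as \<open>card\<close> of an infinite set is 0, the residue field is finite).
  This normalisation is the one for which \<open>\<bar>a\<bar>\<close> is the Haar modulus of multiplication by \<open>a\<close>.
\<close>

class nonarch_local_field = field + metric_space +
  assumes dist_add_right: "dist (x + z) (y + z) = dist x y"
    and dist_mult_0: "dist (x * y) 0 = dist x 0 * dist y 0"
    and dist_ultrametric: "dist (x + y) 0 \<le> max (dist x 0) (dist y 0)"
    and compact_integers: "compact {x. dist x 0 \<le> 1}"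
    and normalised_uniformiser:
      "\<exists>u. 0 < dist u 0 \<and> {x. dist x 0 < 1} = (\<lambda>x. u * x) ` {x. dist x 0 \<le> 1} \<and>
           real (card ((\<lambda>x. {y. dist y x < 1}) ` {x. dist x 0 \<le> 1})) * dist u 0 = 1"

definition kabs :: "'k::nonarch_local_field \<Rightarrow> real" where
  "kabs x = dist x 0"

definition OK :: "'k::nonarch_local_field set" where
  "OK = {x. kabs x \<le> 1}"

definition uniformiser :: "'k::nonarch_local_field \<Rightarrow> bool" where
  "uniformiser \<pi> \<longleftrightarrow> \<pi> \<noteq> 0 \<and> {x. kabs x < 1} = (\<lambda>x. \<pi> * x) ` OK"

definition residue_characteristic :: "'k::nonarch_local_field itself \<Rightarrow> nat \<Rightarrow> bool" where
  "residue_characteristic _ p \<longleftrightarrow> prime p \<and> kabs (of_nat p :: 'k) < 1"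

definition maxnorm :: "'k::nonarch_local_field ^ 'n::finite \<Rightarrow> real" where
  "maxnorm x = Max (range (\<lambda>i. kabs (x $ i)))"

definition kball :: "'k::nonarch_local_field ^ 'n::finite \<Rightarrow> real \<Rightarrow> ('k ^ 'n) set" where
  "kball a r = {x. maxnorm (x - a) \<le> r}"

definition OKn :: "('k::nonarch_local_field ^ 'n::finite) set" where
  "OKn = {x. \<forall>i. x $ i \<in> OK}"

definition haar_measure :: "('k::nonarch_local_field ^ 'n::finite) measure \<Rightarrow> bool" where
  "haar_measure H \<longleftrightarrow> sets H = sets borel \<and>
     (\<forall>a. \<forall>E\<in>sets borel. emeasure H ((\<lambda>x. a + x) ` E) = emeasure H E) \<and>
     0 < emeasure H OKn \<and> emeasure H OKn < \<infinity>"


section \<open>Analytic functions and maps\<close>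

definition monomial_at :: "('n::finite \<Rightarrow> nat) \<Rightarrow> 'k::nonarch_local_field ^ 'n \<Rightarrow> 'k" where
  "monomial_at \<nu> x = (\<Prod>i\<in>UNIV. (x $ i) ^ \<nu> i)"

definition kanalytic_on ::
    "('k::nonarch_local_field ^ 'n::finite \<Rightarrow> 'k) \<Rightarrow> ('k ^ 'n) set \<Rightarrow> bool" where
  "kanalytic_on f S \<longleftrightarrow>
     (\<forall>a\<in>S. \<exists>r>0. \<exists>c. \<forall>x\<in>S. maxnorm (x - a) < r \<longrightarrow>
        ((\<lambda>\<nu>. c \<nu> * monomial_at \<nu> (x - a)) has_sum f x) UNIV)"

definition kanalytic_map_on ::
    "('k::nonarch_local_field ^ 'n::finite \<Rightarrow> 'k ^ 'n) \<Rightarrow> ('k ^ 'n) set \<Rightarrow> bool" where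
  "kanalytic_map_on F S \<longleftrightarrow> (\<forall>i. kanalytic_on (\<lambda>x. F x $ i) S)"

definition bianalytic ::
    "('k::nonarch_local_field ^ 'n::finite \<Rightarrow> 'k ^ 'n) \<Rightarrow> ('k ^ 'n) set \<Rightarrow> ('k ^ 'n) set \<Rightarrow> bool" where
  "bianalytic F S T \<longleftrightarrow> bij_betw F S T \<and> kanalytic_map_on F S \<and> kanalytic_map_on (inv_into S F) T"

definition jacobian ::
    "('k::nonarch_local_field ^ 'n::finite \<Rightarrow> 'k ^ 'n) \<Rightarrow> 'k ^ 'n \<Rightarrow> 'k ^ 'n ^ 'n" where
  "jacobian F a = (\<chi> i j. Lim (at 0) (\<lambda>h. (F (a + h *s axis j 1) $ i - F a $ i) / h))"

text \<open>
  \<open>takes_balls r S F\<close>: \<open>F\<close>, defined on \<open>S\<close>, takes balls of radius \<open>r\<close> to balls of radius \<open>r\<close>.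
  At least one ball of radius \<open>r\<close> must lie in \<open>S\<close>: for bounded \<open>S\<close> the condition would otherwise
  hold vacuously for all large \<open>r\<close>, and there would never be a smallest exponent.
\<close>

definition takes_balls ::
    "real \<Rightarrow> ('k::nonarch_local_field ^ 'n::finite) set \<Rightarrow> ('k ^ 'n \<Rightarrow> 'k ^ 'n) \<Rightarrow> bool" where
  "takes_balls r S F \<longleftrightarrow> (\<exists>a. kball a r \<subseteq> S) \<and>
     (\<forall>a. kball a r \<subseteq> S \<longrightarrow> (\<exists>b. F ` kball a r = kball b r))"

definition equal_exp ::
    "nat \<Rightarrow> ('k::nonarch_local_field ^ 'n::finite) set \<Rightarrow> ('k ^ 'n \<Rightarrow> 'k ^ 'n) \<Rightarrow> ereal" where
  "equal_exp p S F =
     (let smallest = (\<lambda>N::int. takes_balls (real p powi (- N)) S F \<and>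
                        (\<forall>M. takes_balls (real p powi (- M)) S F \<longrightarrow> N \<le> M))
      in if \<exists>N. smallest N then ereal (real_of_int (THE N. smallest N)) else - \<infinity>)"


section \<open>Analytic manifolds\<close>

text \<open>
  The manifold is the whole Hausdorff type \<open>'x\<close>. A chart \<open>(U, \<phi>)\<close> uses a total function \<open>\<phi>\<close> whose
  values outside \<open>U\<close> are irrelevant.
\<close>

type_synonym ('x, 'k, 'n) chart = "'x set \<times> ('x \<Rightarrow> 'k ^ 'n)"

abbreviation chart_inv :: "('x, 'k, 'n) chart \<Rightarrow> 'k ^ 'n \<Rightarrow> 'x" where
  "chart_inv c \<equiv> inv_into (fst c) (snd c)"

definition is_chart :: "('x::t2_space, 'k::nonarch_local_field, 'n::finite) chart \<Rightarrow> bool" where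
  "is_chart c \<longleftrightarrow> open (fst c) \<and> open (snd c ` fst c) \<and>
     homeomorphism (fst c) (snd c ` fst c) (snd c) (chart_inv c)"

definition overlap ::
    "('x, 'k, 'n) chart \<Rightarrow> ('x, 'k, 'n) chart \<Rightarrow> ('k ^ 'n) set" where
  "overlap c d = snd c ` (fst c \<inter> fst d)"

definition transition ::
    "('x, 'k, 'n) chart \<Rightarrow> ('x, 'k, 'n) chart \<Rightarrow> 'k ^ 'n \<Rightarrow> 'k ^ 'n" where
  "transition c d = snd d \<circ> chart_inv c"

definition analytic_atlas ::
    "('x::t2_space, 'k::nonarch_local_field, 'n::finite) chart set \<Rightarrow> bool" where
  "analytic_atlas A \<longleftrightarrow>
     (\<forall>c\<in>A. is_chart c) \<and> \<Union> (fst ` A) = UNIV \<and> inj_on fst A \<and>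
     (\<forall>c\<in>A. \<forall>d\<in>A. bianalytic (transition c d) (overlap c d) (overlap d c))"

definition equalising ::
    "nat \<Rightarrow> ('x::t2_space, 'k::nonarch_local_field, 'n::finite) chart set \<Rightarrow> bool" where
  "equalising p A \<longleftrightarrow>
     (SUP (c, d)\<in>A \<times> A. equal_exp p (overlap c d) (transition c d)) \<noteq> - \<infinity>"

text \<open>
  A differential form of top degree is given by its coefficients \<open>f\<^sub>c\<close> with respect to
  \<open>dx\<^sub>1 \<and> \<dots> \<and> dx\<^sub>n\<close> in the charts \<open>c\<close>.
\<close>

definition analytic_top_form ::
    "('x::t2_space, 'k::nonarch_local_field, 'n::finite) chart set \<Rightarrow>
     (('x, 'k, 'n) chart \<Rightarrow> 'k ^ 'n \<Rightarrow> 'k) \<Rightarrow> bool" where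
  "analytic_top_form A \<omega> \<longleftrightarrow>
     (\<forall>c\<in>A. kanalytic_on (\<omega> c) (snd c ` fst c)) \<and>
     (\<forall>c\<in>A. \<forall>d\<in>A. \<forall>z\<in>overlap c d.
        \<omega> c z = \<omega> d (transition c d z) * det (jacobian (transition c d) z))"

definition nowhere_vanishing ::
    "('x::t2_space, 'k::nonarch_local_field, 'n::finite) chart set \<Rightarrow>
     (('x, 'k, 'n) chart \<Rightarrow> 'k ^ 'n \<Rightarrow> 'k) \<Rightarrow> bool" where
  "nowhere_vanishing A \<omega> \<longleftrightarrow> (\<forall>c\<in>A. \<forall>z\<in>snd c ` fst c. \<omega> c z \<noteq> 0)"

definition form_measure ::
    "('x::t2_space, 'k::nonarch_local_field, 'n::finite) chart set \<Rightarrow>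
     (('x, 'k, 'n) chart \<Rightarrow> 'k ^ 'n \<Rightarrow> 'k) \<Rightarrow> ('k ^ 'n) measure \<Rightarrow> 'x measure \<Rightarrow> bool" where
  "form_measure A \<omega> H \<mu> \<longleftrightarrow> sets \<mu> = sets borel \<and>
     (\<forall>c\<in>A. \<forall>E\<in>sets borel. E \<subseteq> fst c \<longrightarrow>
        emeasure \<mu> E = (\<integral>\<^sup>+ z\<in>snd c ` E. ennreal (kabs (\<omega> c z)) \<partial>H))"


section \<open>Nerve complex\<close>

text \<open>
  A simplex is recorded by its index set \<open>J\<close>; the subset of the manifold it is identified with
  is \<open>simplex_set J\<close>.
\<close>

definition simplex_set :: "('x, 'k, 'n) chart set \<Rightarrow> 'x set" where
  "simplex_set J = \<Inter> (fst ` J)"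

definition nerve :: "('x, 'k, 'n) chart set \<Rightarrow> ('x, 'k, 'n) chart set set" where
  "nerve A = {J. J \<subseteq> A \<and> finite J \<and> J \<noteq> {} \<and> simplex_set J \<noteq> {}}"

definition nerve_graph_connected :: "('x, 'k, 'n) chart set \<Rightarrow> bool" where
  "nerve_graph_connected A \<longleftrightarrow>
     (\<forall>c d. {c} \<in> nerve A \<longrightarrow> {d} \<in> nerve A \<longrightarrow>
        (c, d) \<in> {(c', d'). c' \<noteq> d' \<and> {c', d'} \<in> nerve A}\<^sup>*)"

definition top_simplex :: "('x, 'k, 'n) chart set \<Rightarrow> 'x \<Rightarrow> ('x, 'k, 'n) chart set" where
  "top_simplex A x = (ARG_MAX card J. J \<in> nerve A \<and> x \<in> simplex_set J)"

definition nerve_path ::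
    "('x, 'k, 'n) chart set \<Rightarrow> ('x, 'k, 'n) chart set \<Rightarrow> ('x, 'k, 'n) chart set \<Rightarrow>
     ('x, 'k, 'n) chart set list \<Rightarrow> bool" where
  "nerve_path A S T \<gamma> \<longleftrightarrow> \<gamma> \<noteq> [] \<and> hd \<gamma> = S \<and> last \<gamma> = T \<and> set \<gamma> \<subseteq> nerve A \<and>
     (\<forall>i. Suc i < length \<gamma> \<longrightarrow> \<gamma> ! i \<subset> \<gamma> ! Suc i \<or> \<gamma> ! Suc i \<subset> \<gamma> ! i)"

definition path_set :: "('x, 'k, 'n) chart set list \<Rightarrow> 'x set" where
  "path_set \<gamma> = (\<Union>J\<in>set \<gamma>. simplex_set J)"


section \<open>Balls, joins and the geodetic distance\<close>

definition mball ::
    "('x::t2_space, 'k::nonarch_local_field, 'n::finite) chart set \<Rightarrow> 'x set \<Rightarrow> bool" where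
  "mball A B \<longleftrightarrow> (\<exists>c\<in>A. B \<subseteq> fst c) \<and>
     (\<forall>c\<in>A. B \<subseteq> fst c \<longrightarrow> (\<exists>a r. r > 0 \<and> snd c ` B = kball a r)) \<and>
     (\<forall>c\<in>A. \<forall>d\<in>A. B \<subseteq> fst c \<inter> fst d \<longrightarrow>
        (\<exists>a b r. r > 0 \<and> snd c ` B = kball a r \<and> snd d ` B = kball b r \<and>
                 transition c d ` kball a r = kball b r))"

definition has_join ::
    "('x::t2_space, 'k::nonarch_local_field, 'n::finite) chart set \<Rightarrow> 'x \<Rightarrow> 'x \<Rightarrow> bool" where
  "has_join A x y \<longleftrightarrow> (\<exists>B. mball A B \<and> x \<in> B \<and> y \<in> B)"

definition mjoin ::
    "('x::t2_space, 'k::nonarch_local_field, 'n::finite) chart set \<Rightarrow> 'x \<Rightarrow> 'x \<Rightarrow> 'x set" where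
  "mjoin A x y = \<Inter> {B. mball A B \<and> x \<in> B \<and> y \<in> B}"

definition geo_dist ::
    "('x::t2_space, 'k::nonarch_local_field, 'n::finite) chart set \<Rightarrow> 'x measure \<Rightarrow> 'x \<Rightarrow> 'x \<Rightarrow> real" where
  "geo_dist A \<mu> x y =
     (if has_join A x y then measure \<mu> (mjoin A x y)
      else Min {measure \<mu> (path_set \<gamma>) |\<gamma>. nerve_path A (top_simplex A x) (top_simplex A y) \<gamma>})"

definition laplacian ::
    "('x::t2_space, 'k::nonarch_local_field, 'n::finite) chart set \<Rightarrow> 'x measure \<Rightarrow> real \<Rightarrow>
     ('x \<Rightarrow> complex) \<Rightarrow> 'x \<Rightarrow> complex" where
  "laplacian A \<mu> s h x =
     (LINT y|\<mu>. complex_of_real (geo_dist A \<mu> x y powr (- s)) * (h x - h y))"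


section \<open>Wavelets\<close>

definition additive_character :: "'k::nonarch_local_field \<Rightarrow> ('k \<Rightarrow> complex) \<Rightarrow> bool" where
  "additive_character \<pi> \<xi> \<longleftrightarrow>
     (\<forall>x y. \<xi> (x + y) = \<xi> x * \<xi> y) \<and> (\<forall>x. cmod (\<xi> x) = 1) \<and>
     (\<forall>x\<in>OK. \<xi> x = 1) \<and> (\<exists>x\<in>OK. \<xi> (inverse \<pi> * x) \<noteq> 1)"

definition kozyrev_wavelet ::
    "'k::nonarch_local_field \<Rightarrow> ('k \<Rightarrow> complex) \<Rightarrow> ('k ^ 'n::finite) set \<Rightarrow> ('k ^ 'n \<Rightarrow> complex) \<Rightarrow> bool" where
  "kozyrev_wavelet \<pi> \<xi> S g \<longleftrightarrow>
     (\<exists>b (m::int) \<eta> C. S = (\<lambda>w. b + (\<pi> powi m) *s w) ` OKn \<and>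
        \<eta> \<in> OKn \<and> \<not> (\<forall>i. \<eta> $ i \<in> (\<lambda>a. \<pi> * a) ` OK) \<and>
        g = (\<lambda>z. C * \<xi> (\<pi> powi (- m - 1) * (\<Sum>i\<in>UNIV. \<eta> $ i * z $ i)) * indicator S z))"

text \<open>
  In each chart containing \<open>B\<close> the Kozyrev wavelet is supported on \<open>\<phi>(B)\<close>, a ball centred at \<open>\<phi>(a)\<close>
  for every \<open>a \<in> B\<close>.
\<close>

definition wavelet_on ::
    "('x::t2_space, 'k::nonarch_local_field, 'n::finite) chart set \<Rightarrow> 'k \<Rightarrow> ('k \<Rightarrow> complex) \<Rightarrow>
     'x set \<Rightarrow> ('x \<Rightarrow> complex) \<Rightarrow> bool" where
  "wavelet_on A \<pi> \<xi> B \<psi> \<longleftrightarrow> mball A B \<and> (\<forall>x. x \<notin> B \<longrightarrow> \<psi> x = 0) \<and>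
     (\<forall>c\<in>A. B \<subseteq> fst c \<longrightarrow>
        kozyrev_wavelet \<pi> \<xi> (snd c ` B)
          (\<lambda>z. if z \<in> snd c ` fst c then \<psi> (chart_inv c z) else 0))"

definition l2_inner :: "'x measure \<Rightarrow> ('x \<Rightarrow> complex) \<Rightarrow> ('x \<Rightarrow> complex) \<Rightarrow> complex" where
  "l2_inner \<mu> f g = (LINT x|\<mu>. f x * cnj (g x))"

definition wavelets ::
    "('x::t2_space, 'k::nonarch_local_field, 'n::finite) chart set \<Rightarrow> 'x measure \<Rightarrow> 'k \<Rightarrow>
     ('k \<Rightarrow> complex) \<Rightarrow> ('x \<Rightarrow> complex) set" where
  "wavelets A \<mu> \<pi> \<xi> = {\<psi>. (\<exists>B. wavelet_on A \<pi> \<xi> B \<psi>) \<and> l2_inner \<mu> \<psi> \<psi> = 1}"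

text \<open>A non-zero wavelet on \<open>B\<close> vanishes nowhere on \<open>B\<close>, so \<open>B\<close> is recovered as its support.\<close>

definition supp :: "('x \<Rightarrow> complex) \<Rightarrow> 'x set" where
  "supp \<psi> = {x. \<psi> x \<noteq> 0}"

definition small_wavelets ::
    "('x::t2_space, 'k::nonarch_local_field, 'n::finite) chart set \<Rightarrow> 'x measure \<Rightarrow> 'k \<Rightarrow>
     ('k \<Rightarrow> complex) \<Rightarrow> real \<Rightarrow> ('x \<Rightarrow> complex) set" where
  "small_wavelets A \<mu> \<pi> \<xi> \<epsilon> = {\<psi> \<in> wavelets A \<mu> \<pi> \<xi>. measure \<mu> (supp \<psi>) \<le> \<epsilon>}"

definition non_overlapping :: "('x \<Rightarrow> complex) set \<Rightarrow> bool" where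
  "non_overlapping W \<longleftrightarrow>
     (\<forall>\<psi>\<in>W. \<forall>\<psi>'\<in>W. supp \<psi> \<inter> supp \<psi>' = {} \<or> supp \<psi> \<subseteq> supp \<psi>' \<or> supp \<psi>' \<subseteq> supp \<psi>)"


section \<open>The Hilbert space spanned by the small wavelets\<close>

definition l2_functions :: "'x measure \<Rightarrow> ('x \<Rightarrow> complex) set" where
  "l2_functions \<mu> = {f \<in> borel_measurable \<mu>. integrable \<mu> (\<lambda>x. (cmod (f x))\<^sup>2)}"

definition complex_span :: "('x \<Rightarrow> complex) set \<Rightarrow> ('x \<Rightarrow> complex) set" where
  "complex_span W = {f. \<exists>F c. finite F \<and> F \<subseteq> W \<and> f = (\<lambda>x. \<Sum>g\<in>F. c g * g x)}"

definition l2_closure :: "'x measure \<Rightarrow> ('x \<Rightarrow> complex) set \<Rightarrow> ('x \<Rightarrow> complex) set" where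
  "l2_closure \<mu> V =
     {f \<in> l2_functions \<mu>. \<forall>e>0. \<exists>g\<in>V. sqrt (LINT x|\<mu>. (cmod (f x - g x))\<^sup>2) < e}"

definition orthonormal_basis ::
    "'x measure \<Rightarrow> ('x \<Rightarrow> complex) set \<Rightarrow> ('x \<Rightarrow> complex) set \<Rightarrow> bool" where
  "orthonormal_basis \<mu> \<Psi> V \<longleftrightarrow> \<Psi> \<subseteq> V \<and>
     (\<forall>f\<in>\<Psi>. \<forall>g\<in>\<Psi>. l2_inner \<mu> f g = (if f = g then 1 else 0)) \<and>
     V \<subseteq> l2_closure \<mu> (complex_span \<Psi>)"

definition L2w ::
    "('x::t2_space, 'k::nonarch_local_field, 'n::finite) chart set \<Rightarrow> 'x measure \<Rightarrow> 'k \<Rightarrow>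
     ('k \<Rightarrow> complex) \<Rightarrow> real \<Rightarrow> ('x \<Rightarrow> complex) set" where
  "L2w A \<mu> \<pi> \<xi> \<epsilon> = l2_closure \<mu> (complex_span (small_wavelets A \<mu> \<pi> \<xi> \<epsilon>))"

definition wavelet_basis ::
    "('x::t2_space, 'k::nonarch_local_field, 'n::finite) chart set \<Rightarrow> 'x measure \<Rightarrow> 'k \<Rightarrow>
     ('k \<Rightarrow> complex) \<Rightarrow> real \<Rightarrow> ('x \<Rightarrow> complex) set \<Rightarrow> bool" where
  "wavelet_basis A \<mu> \<pi> \<xi> \<epsilon> \<Psi> \<longleftrightarrow>
     \<Psi> \<subseteq> wavelets A \<mu> \<pi> \<xi> \<and> orthonormal_basis \<mu> \<Psi> (L2w A \<mu> \<pi> \<xi> \<epsilon>)"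


section \<open>Eigenvalues, heat kernel and Green function\<close>

definition eigenvalue_at ::
    "('x::t2_space, 'k::nonarch_local_field, 'n::finite) chart set \<Rightarrow> 'x measure \<Rightarrow> real \<Rightarrow>
     ('x \<Rightarrow> complex) \<Rightarrow> 'x \<Rightarrow> real" where
  "eigenvalue_at A \<mu> s \<psi> x =
     (LINT y:(- supp \<psi>)|\<mu>. geo_dist A \<mu> x y powr (- s)) + measure \<mu> (supp \<psi>) powr (1 - s)"

definition eigenvalue ::
    "('x::t2_space, 'k::nonarch_local_field, 'n::finite) chart set \<Rightarrow> 'x measure \<Rightarrow> real \<Rightarrow>
     ('x \<Rightarrow> complex) \<Rightarrow> real" where
  "eigenvalue A \<mu> s \<psi> = eigenvalue_at A \<mu> s \<psi> (SOME x. x \<in> supp \<psi>)"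

definition heat_term ::
    "('x::t2_space, 'k::nonarch_local_field, 'n::finite) chart set \<Rightarrow> 'x measure \<Rightarrow> real \<Rightarrow>
     real \<Rightarrow> 'x \<Rightarrow> 'x \<Rightarrow> ('x \<Rightarrow> complex) \<Rightarrow> complex" where
  "heat_term A \<mu> s t x y \<psi> =
     complex_of_real (exp (- t * eigenvalue A \<mu> s \<psi>)) * \<psi> x * cnj (\<psi> y)"

definition heat_kernel ::
    "('x::t2_space, 'k::nonarch_local_field, 'n::finite) chart set \<Rightarrow> 'x measure \<Rightarrow> real \<Rightarrow>
     ('x \<Rightarrow> complex) set \<Rightarrow> real \<Rightarrow> 'x \<Rightarrow> 'x \<Rightarrow> complex" where
  "heat_kernel A \<mu> s \<Psi> t x y = (\<Sum>\<^sub>\<infinity>\<psi>\<in>\<Psi>. heat_term A \<mu> s t x y \<psi>)"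

definition green ::
    "('x::t2_space, 'k::nonarch_local_field, 'n::finite) chart set \<Rightarrow> 'x measure \<Rightarrow> real \<Rightarrow>
     ('x \<Rightarrow> complex) set \<Rightarrow> 'x \<Rightarrow> 'x \<Rightarrow> complex" where
  "green A \<mu> s \<Psi> x y = (LINT t:{0<..}|lborel. heat_kernel A \<mu> s \<Psi> t x y)"

definition green_term ::
    "('x::t2_space, 'k::nonarch_local_field, 'n::finite) chart set \<Rightarrow> 'x measure \<Rightarrow> real \<Rightarrow>
     'x \<Rightarrow> 'x \<Rightarrow> ('x \<Rightarrow> complex) \<Rightarrow> complex" where
  "green_term A \<mu> s x y \<psi> =
     complex_of_real (inverse (eigenvalue A \<mu> s \<psi>)) * \<psi> x * cnj (\<psi> y)"

text \<open>
  If \<open>s \<le> 2\<close>, then on the diagonal both the integral and the series may be infinite: \<open>\<lambda>\<^sub>\<psi>\<close> grows like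
  \<open>\<mu>(B)\<^bsup>1-s\<^esup>\<close> and \<open>\<bar>\<psi>(x)\<bar>\<^sup>2 = 1 / \<mu>(B)\<close>, so the series behaves like the sum of \<open>\<mu>(B)\<^bsup>s-2\<^esup>\<close> over the
  balls \<open>B\<close> around \<open>x\<close>. On the diagonal all terms are non-negative, and the Green
  function is read with values in \<open>[0,\<infinity>]\<close>; elsewhere, and everywhere if \<open>s > 2\<close>, it is finite.
\<close>

definition green_function_formula ::
    "('x::t2_space, 'k::nonarch_local_field, 'n::finite) chart set \<Rightarrow> 'x measure \<Rightarrow> real \<Rightarrow>
     ('x \<Rightarrow> complex) set \<Rightarrow> bool" where
  "green_function_formula A \<mu> s \<Psi> \<longleftrightarrow>
     (\<forall>x y. \<forall>t>0. heat_term A \<mu> s t x y summable_on \<Psi>) \<and>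
     (\<forall>x y. x \<noteq> y \<or> s > 2 \<longrightarrow>
        set_integrable lborel {0<..} (\<lambda>t. heat_kernel A \<mu> s \<Psi> t x y) \<and>
        (green_term A \<mu> s x y has_sum green A \<mu> s \<Psi> x y) \<Psi>) \<and>
     (\<forall>x. (\<integral>\<^sup>+ t\<in>{0<..}. ennreal (Re (heat_kernel A \<mu> s \<Psi> t x x)) \<partial>lborel)
          = (\<Sum>\<^sub>\<infinity>\<psi>\<in>\<Psi>. ennreal (Re (green_term A \<mu> s x x \<psi>))))"

end

theory Submission
  imports Defs
begin

text \<open>
  Both claims come from the fact that a compact manifold with a finite atlas looks homogeneous at a
  small scale. The density \<open>\<bar>f\<^sub>\<alpha>\<bar>\<close> is locally constant: near a point the constant term of the power
  series dominates (\<open>analytic_kabs_locally_constant\<close>). Chart domains are open and compact, so the set of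
  charts containing a point is locally constant too. By compactness there is one scale at which both
  data are constant, and since the measure of a ball is comparable to the Haar measure of its image
  in a chart, every ball of small measure lies below that scale (\<open>fine_if_small\<close>). Such a fine ball \<open>B\<close> is
  contained in every chart domain that it meets, so it can be compared inside one chart with any
  other ball, and the two are disjoint or nested (\<open>fine_nested\<close>). In particular small wavelets do not
  overlap.

  Let \<open>\<psi>\<close> be a wavelet on a fine ball \<open>B\<close>. It has mean zero, because a suitable translation of \<open>B\<close>
  preserves \<open>\<mu>\<close> and multiplies \<open>\<psi>\<close> by a constant other than 1 (\<open>wavelet_mean_zero\<close>). A ball that contains a
  point of \<open>B\<close> and a point outside contains \<open>B\<close>; hence \<open>d\<^sub>g(x,y)\<close> does not depend on \<open>x \<in> B\<close> for \<open>y \<notin> B\<close>. For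
  two points of \<open>B\<close> with different values of \<open>\<psi>\<close> the join is all of \<open>B\<close>. These two facts and the vanishing
  mean give the eigenvalue equation (\<open>laplacian_wavelet\<close>). A wavelet on a large ball is constant on the
  support of every small wavelet inside it, so it is orthogonal to all small wavelets; therefore a
  basis of the space spanned by the small wavelets consists of small wavelets
  (\<open>L2w_wavelet_small\<close>).

  For the Green function only three estimates matter, and they hold for any orthonormal family of
  wavelets: \<open>\<lambda>\<^sub>\<psi> \<ge> \<mu>(B) powr (1 - s)\<close>, \<open>\<bar>\<psi>\<bar>\<^sup>2 = 1 / \<mu>(B)\<close> on \<open>B\<close>, and the convergence of the sum of
  \<open>\<mu>(B) powr \<theta>\<close> over the wavelets around a given point for every \<open>\<theta> > 0\<close> (\<open>summable_volume_powr\<close>). The last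
  one holds because a wavelet around \<open>x\<close> is determined by a chart, a radius and a frequency modulo
  \<open>\<pi>\<close>, of which the first and the third range over finite sets, while volumes decay geometrically with
  the radius. The heat kernel converges since \<open>exp (- t * \<lambda>\<^sub>\<psi>)\<close> is smaller than any power of \<open>\<mu>(B)\<close>. Off
  the diagonal only finitely many wavelets contain both points, and integration in \<open>t\<close> is term by
  term; on the diagonal all terms are non-negative and monotone convergence applies, the sum being
  finite if \<open>s > 2\<close>.
\<close>


section \<open>The absolute value\<close>

lemma dist_eq_kabs: "dist x y = kabs (x - y)"
  using dist_add_right[of x "- y" y] by (simp add: kabs_def)

lemma kabs_nonneg [simp]: "0 \<le> kabs x"
  by (simp add: kabs_def)

lemma kabs_0 [simp]: "kabs 0 = 0"
  by (simp add: kabs_def)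

lemma kabs_eq_0_iff [simp]: "kabs x = 0 \<longleftrightarrow> x = 0"
  by (simp add: kabs_def)

lemma kabs_pos_iff [simp]: "0 < kabs x \<longleftrightarrow> x \<noteq> 0"
  by (simp add: kabs_def)

lemma kabs_mult: "kabs (x * y) = kabs x * kabs y"
  by (simp add: kabs_def dist_mult_0)

lemma kabs_1 [simp]: "kabs 1 = 1"
  using kabs_mult[of 1 1] by simp

lemma kabs_minus [simp]: "kabs (- x) = kabs x"
  using dist_eq_kabs[of x 0] dist_eq_kabs[of 0 x] by (simp add: dist_commute)

lemma kabs_minus_commute: "kabs (x - y) = kabs (y - x)"
  by (metis kabs_minus minus_diff_eq)

lemma kabs_add_le: "kabs (x + y) \<le> max (kabs x) (kabs y)"
  by (simp add: kabs_def dist_ultrametric)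

lemma kabs_add_leI: "kabs x \<le> r \<Longrightarrow> kabs y \<le> r \<Longrightarrow> kabs (x + y) \<le> r"
  using kabs_add_le[of x y] by linarith

lemma kabs_diff_leI: "kabs x \<le> r \<Longrightarrow> kabs y \<le> r \<Longrightarrow> kabs (x - y) \<le> r"
  using kabs_add_leI[of x r "- y"] by simp

lemma kabs_diff_trans: "kabs (x - y) \<le> r \<Longrightarrow> kabs (y - z) \<le> r \<Longrightarrow> kabs (x - z) \<le> r"
  using kabs_add_leI[of "x - y" r "y - z"] by simp

lemma kabs_sum_leI: "(\<And>i. i \<in> F \<Longrightarrow> kabs (f i) \<le> r) \<Longrightarrow> 0 \<le> r \<Longrightarrow> kabs (sum f F) \<le> r"
  by (induction F rule: infinite_finite_induct) (auto intro: kabs_add_leI)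

lemma kabs_power: "kabs (x ^ n) = kabs x ^ n"
  by (induction n) (auto simp: kabs_mult)

lemma kabs_prod: "kabs (prod f F) = (\<Prod>i\<in>F. kabs (f i))"
  by (induction F rule: infinite_finite_induct) (auto simp: kabs_mult)

lemma kabs_inverse: "kabs (inverse x) = inverse (kabs x)"
proof (cases "x = 0")
  case False
  then have "kabs x * kabs (inverse x) = 1"
    by (metis kabs_1 kabs_mult right_inverse)
  then show ?thesis
    by (metis inverse_unique)
qed auto

lemma kabs_divide: "kabs (x / y) = kabs x / kabs y"
  by (simp add: divide_inverse kabs_mult kabs_inverse)

lemma kabs_power_int: "kabs (x powi m) = kabs x powi m"
  by (simp add: power_int_def kabs_power kabs_inverse)

lemma kabs_eq_if_close:
  assumes "kabs (x - y) < kabs y"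
  shows "kabs x = kabs y"
proof (rule antisym)
  show "kabs x \<le> kabs y"
    using kabs_add_leI[of "x - y" "kabs y" y] assms by simp
  show "kabs y \<le> kabs x"
  proof (rule ccontr)
    assume "\<not> kabs y \<le> kabs x"
    then have "kabs y \<le> max (kabs x) (kabs (x - y))" "max (kabs x) (kabs (x - y)) < kabs y"
      using kabs_add_le[of x "- (x - y)"] assms kabs_minus[of "x - y"] by auto
    then show False by linarith
  qed
qed

definition residue_class :: "'k::nonarch_local_field \<Rightarrow> 'k set" where
  "residue_class x = {y. dist y x < 1}"

lemma residue_class_eq_iff: "residue_class x = residue_class y \<longleftrightarrow> kabs (x - y) < 1"
proof
  assume "residue_class x = residue_class y"
  moreover have "x \<in> residue_class x"
    by (simp add: residue_class_def)
  ultimately have "x \<in> residue_class y"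
    by simp
  then show "kabs (x - y) < 1"
    by (simp add: residue_class_def dist_eq_kabs)
next
  assume *: "kabs (x - y) < 1"
  have "kabs (z - x) < 1 \<longleftrightarrow> kabs (z - y) < 1" for z
    using kabs_add_le[of "z - x" "x - y"] kabs_add_le[of "z - y" "y - x"] *
    by (auto simp: kabs_minus_commute[of y x])
  then show "residue_class x = residue_class y"
    by (simp add: residue_class_def dist_eq_kabs)
qed

text \<open>
  Finiteness is hidden in the normalisation axiom: an infinite set would have cardinality 0,
  whereas the product with the absolute value of the generator has to be 1.
\<close>

lemma finite_residue_classes: "finite (residue_class ` (OK :: 'k::nonarch_local_field set))"
proof -
  have "residue_class = (\<lambda>x :: 'k. {y. dist y x < 1})" "OK = {x :: 'k. dist x 0 \<le> 1}"
    by (simp_all add: fun_eq_iff residue_class_def OK_def kabs_def)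
  then have "\<exists>u :: 'k. real (card (residue_class ` (OK :: 'k set))) * dist u 0 = 1"
    using normalised_uniformiser[where 'a = 'k] by (simp only:) fast
  then obtain u :: 'k where "real (card (residue_class ` (OK :: 'k set))) * dist u 0 = 1"
    by (rule exE)
  then have "card (residue_class ` (OK :: 'k set)) \<noteq> 0"
    by (metis mult_zero_left of_nat_0 zero_neq_one)
  then show ?thesis
    by (metis card.infinite)
qed


section \<open>Balls in the affine space\<close>

locale uniformised =
  fixes \<pi> :: "'k::nonarch_local_field"
  assumes uniformiser: "uniformiser \<pi>"
begin

text \<open>
  The values of the norm are the powers of \<open>\<bar>\<pi>\<bar>\<close> and 0, so these are all balls of positive radius,
  indexed by the exponent of the radius.
\<close>

definition pball :: "int \<Rightarrow> 'k ^ 'n::finite \<Rightarrow> ('k ^ 'n) set" where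
  "pball m a = {z. \<forall>i. kabs (z $ i - a $ i) \<le> kabs \<pi> powi m}"

lemma pi_nonzero [simp]: "\<pi> \<noteq> 0"
  using uniformiser by (simp add: uniformiser_def)

lemma pi_less_1 [simp]: "kabs \<pi> < 1"
proof -
  have "\<pi> \<in> (\<lambda>x. \<pi> * x) ` OK"
    by (rule image_eqI[of _ _ 1]) (auto simp: OK_def)
  then show ?thesis
    using uniformiser unfolding uniformiser_def by blast
qed

lemma kabs_less_1_iff: "kabs (x :: 'k) < 1 \<longleftrightarrow> kabs x \<le> kabs \<pi>"
proof
  assume "kabs x < 1"
  then obtain y where "x = \<pi> * y" "y \<in> OK"
    using uniformiser unfolding uniformiser_def by blast
  then show "kabs x \<le> kabs \<pi>"
    by (simp add: kabs_mult OK_def mult_left_le)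
next
  show "kabs x \<le> kabs \<pi> \<Longrightarrow> kabs x < 1"
    using pi_less_1 by linarith
qed

lemma in_pi_OK_iff: "(x :: 'k) \<in> (\<lambda>a. \<pi> * a) ` OK \<longleftrightarrow> kabs x \<le> kabs \<pi>"
  using uniformiser kabs_less_1_iff[of x] unfolding uniformiser_def by blast

lemma pi_powi_pos [simp]: "0 < kabs \<pi> powi m"
  by (simp add: zero_less_power_int)

lemma pi_powi_le_iff: "kabs \<pi> powi m \<le> kabs \<pi> powi l \<longleftrightarrow> l \<le> m"
proof -
  have strict: "kabs \<pi> powi b < kabs \<pi> powi a" if "a < b" for a b :: int
    using that by (intro power_int_strict_decreasing) auto
  show ?thesis
    using strict[of m l] strict[of l m] by (cases l m rule: linorder_cases) auto
qed

lemma powi_small: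
  assumes "0 < e"
  obtains k :: nat where "kabs \<pi> powi int k < e"
  using real_arch_pow_inv[OF assms pi_less_1] by (auto simp: that)

lemma powi_bracket:
  assumes "0 < r"
  obtains m where "kabs \<pi> powi m \<le> r" "r < kabs \<pi> powi (m - 1)"
proof -
  obtain k where k: "kabs \<pi> powi int k < r"
    using powi_small[OF assms] by blast
  obtain l where l: "kabs \<pi> powi int l < inverse r"
    using powi_small[of "inverse r"] assms by auto
  define S where "S = {j::nat. kabs \<pi> powi (int j - int l) \<le> r}"
  have "k + l \<in> S"
    using k by (simp add: S_def)
  define j where "j = (LEAST j. j \<in> S)"
  have j: "j \<in> S" "\<And>i. i < j \<Longrightarrow> i \<notin> S"
    unfolding j_def using \<open>k + l \<in> S\<close> by (auto intro: LeastI dest: not_less_Least)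
  have r: "r < kabs \<pi> powi (- int l)"
  proof -
    have "r * kabs \<pi> powi int l < 1"
      using l assms by (simp add: field_simps)
    then show ?thesis
      by (simp add: power_int_minus field_simps)
  qed
  have "j \<noteq> 0"
  proof
    assume "j = 0"
    then show False
      using j(1) r by (simp add: S_def)
  qed
  then have "r < kabs \<pi> powi (int (j - 1) - int l)"
    using j(2)[of "j - 1"] by (simp add: S_def)
  also have "int (j - 1) - int l = (int j - int l) - 1"
    using \<open>j \<noteq> 0\<close> by simp
  finally show thesis
    using that[of "int j - int l"] j(1) by (simp add: S_def)
qed

text \<open>An element of absolute value less than 1 lies in the maximal ideal, which \<open>\<pi>\<close> generates; scaling
  by powers of \<open>\<pi>\<close> gives the same gap above every power of \<open>\<bar>\<pi>\<bar>\<close>.\<close>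

lemma kabs_gap:
  fixes x :: 'k
  assumes "kabs x < kabs \<pi> powi (m - 1)"
  shows "kabs x \<le> kabs \<pi> powi m"
proof -
  have "kabs (x / \<pi> powi (m - 1)) < 1"
    using assms by (simp add: kabs_divide kabs_power_int)
  then have "kabs (x / \<pi> powi (m - 1)) \<le> kabs \<pi>"
    by (simp add: kabs_less_1_iff)
  then have "kabs x \<le> kabs \<pi> * kabs \<pi> powi (m - 1)"
    by (simp add: kabs_divide kabs_power_int divide_simps mult.commute)
  also have "\<dots> = kabs \<pi> powi m"
    using power_int_add[of "kabs \<pi>" 1 "m - 1"] by simp
  finally show ?thesis .
qed

lemma maxnorm_le_iff: "maxnorm x \<le> r \<longleftrightarrow> (\<forall>i. kabs (x $ i) \<le> r)"
  unfolding maxnorm_def by (subst Max_le_iff) auto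

lemma kball_eq_pball:
  fixes a :: "'k ^ 'n::finite"
  assumes "0 < r"
  obtains m where "kball a r = pball m a"
proof -
  obtain m where m: "kabs \<pi> powi m \<le> r" "r < kabs \<pi> powi (m - 1)"
    using powi_bracket[OF assms] by blast
  have "kabs x \<le> r \<longleftrightarrow> kabs x \<le> kabs \<pi> powi m" for x :: 'k
    using m kabs_gap[of x m] by linarith
  then show thesis
    by (intro that[of m]) (simp add: kball_def pball_def maxnorm_le_iff)
qed

lemma center_in_pball [simp]: "a \<in> pball m a"
  by (simp add: pball_def less_imp_le)

lemma pball_recentre: "b \<in> pball m a \<Longrightarrow> pball m b = pball m a"
  unfolding pball_def by (simp add: set_eq_iff) (metis kabs_diff_trans kabs_minus_commute)

lemma pball_mono: "m \<le> l \<Longrightarrow> pball l a \<subseteq> pball m a"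
  unfolding pball_def using pi_powi_le_iff[of l m] by (auto intro: order_trans)

lemma pball_nested:
  "b \<in> pball m a \<Longrightarrow> m \<le> l \<Longrightarrow> pball l b \<subseteq> pball m a"
  using pball_mono[of m l b] pball_recentre[of b m a] by simp

lemma pball_disjoint_or_nested:
  "pball m a \<inter> pball l b = {} \<or> pball m a \<subseteq> pball l b \<or> pball l b \<subseteq> pball m a"
proof (cases "pball m a \<inter> pball l b = {}")
  case False
  then obtain z where "z \<in> pball m a" "z \<in> pball l b"
    by blast
  then show ?thesis
    using pball_recentre[of z m a] pball_recentre[of z l b] pball_mono[of m l z] pball_mono[of l m z]
    by (cases "m \<le> l") auto
qed simp

lemma kozyrev_set_eq_pball: "(\<lambda>w. b + (\<pi> powi m) *s w) ` OKn = pball m b"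
proof (rule set_eqI)
  fix z
  have "z = b + (\<pi> powi m) *s w \<longleftrightarrow> w = inverse (\<pi> powi m) *s (z - b)" for w
    by (auto simp: vec_eq_iff field_simps)
  then have "z \<in> (\<lambda>w. b + (\<pi> powi m) *s w) ` OKn \<longleftrightarrow> inverse (\<pi> powi m) *s (z - b) \<in> OKn"
    by (auto simp: image_iff)
  also have "\<dots> \<longleftrightarrow> z \<in> pball m b"
    by (simp add: OKn_def OK_def pball_def kabs_mult kabs_inverse kabs_divide kabs_power_int
        divide_simps mult.commute)
  finally show "z \<in> (\<lambda>w. b + (\<pi> powi m) *s w) ` OKn \<longleftrightarrow> z \<in> pball m b" .
qed

lemma OKn_eq_pball: "OKn = pball 0 0"
  by (simp add: OKn_def OK_def pball_def)

lemma translate_pball: "(\<lambda>z. t + z) ` pball m a = pball m (t + a)"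
proof -
  have "z \<in> (\<lambda>z. t + z) ` pball m a" if "z \<in> pball m (t + a)" for z
    by (rule image_eqI[of _ _ "z - t"]) (use that in \<open>auto simp: pball_def algebra_simps\<close>)
  then show ?thesis
    by (auto simp: pball_def)
qed

lemma open_pball [simp]: "open (pball m a)"
proof (rule openI)
  fix z assume z: "z \<in> pball m a"
  have "ball z (kabs \<pi> powi m) \<subseteq> pball m z"
  proof
    fix w assume "w \<in> ball z (kabs \<pi> powi m)"
    then have "dist (w $ i) (z $ i) < kabs \<pi> powi m" for i
      using dist_vec_nth_le[of w i z] by (simp add: dist_commute)
    then show "w \<in> pball m z"
      by (auto simp: pball_def dist_eq_kabs less_imp_le)
  qed
  then show "\<exists>e>0. ball z e \<subseteq> pball m a"
    using z pball_recentre pi_powi_pos by blast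
qed

lemma pball_basis:
  fixes a :: "'k ^ 'n::finite"
  assumes "open S" "a \<in> S"
  obtains m where "pball m a \<subseteq> S"
proof -
  obtain e where e: "e > 0" "ball a e \<subseteq> S"
    using assms openE by blast
  have "0 < e / (real CARD('n) + 1)"
    using e by simp
  then obtain k where k: "kabs \<pi> powi int k < e / (real CARD('n) + 1)"
    using powi_small by blast
  have "pball (int k) a \<subseteq> ball a e"
  proof
    fix z assume z: "z \<in> pball (int k) a"
    have "dist z a \<le> (\<Sum>i\<in>UNIV. dist (z $ i) (a $ i))"
      unfolding dist_vec_def by (rule L2_set_le_sum) simp
    also have "\<dots> \<le> (\<Sum>i\<in>(UNIV::'n set). e / (real CARD('n) + 1))"
    proof (rule sum_mono)
      fix i
      have "dist (z $ i) (a $ i) \<le> kabs \<pi> powi int k"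
        using z by (simp add: pball_def dist_eq_kabs)
      then show "dist (z $ i) (a $ i) \<le> e / (real CARD('n) + 1)"
        using k by linarith
    qed
    also have "\<dots> < e"
      using e by (simp add: field_simps)
    finally show "z \<in> ball a e"
      by (simp add: dist_commute)
  qed
  then show thesis
    using e that by blast
qed

text \<open>
  A finite subcover by balls of constancy has a smallest radius, which serves as a Lebesgue number
  because intersecting balls are nested; the centres of the subcover account for all values.
\<close>

lemma locally_constant_on_compact:
  fixes g :: "'k ^ 'n::finite \<Rightarrow> 'b"
  assumes "compact S" and loc: "\<And>z. z \<in> S \<Longrightarrow> \<exists>m. \<forall>w\<in>pball m z. g w = g z"
  obtains M where "\<And>l z w. M \<le> l \<Longrightarrow> z \<in> S \<Longrightarrow> w \<in> pball l z \<Longrightarrow> g w = g z" "finite (g ` S)"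
proof -
  obtain m where m: "\<And>z w. z \<in> S \<Longrightarrow> w \<in> pball (m z) z \<Longrightarrow> g w = g z"
    using loc by metis
  obtain F where F: "F \<subseteq> S" "finite F" "S \<subseteq> (\<Union>z\<in>F. pball (m z) z)"
    by (rule compactE_image[OF assms(1), of S "\<lambda>z. pball (m z) z"]) auto
  have "\<exists>M. \<forall>z\<in>F. m z \<le> M"
    using F(2) by (intro exI[of _ "Max (m ` F)"]) auto
  then obtain M where M: "\<And>z. z \<in> F \<Longrightarrow> m z \<le> M"
    by blast
  show thesis
  proof
    show "g w = g z" if l: "M \<le> l" and z: "z \<in> S" and w: "w \<in> pball l z" for l z w
    proof -
      obtain z0 where z0: "z0 \<in> F" "z \<in> pball (m z0) z0"
        using F z by blast
      then have "w \<in> pball (m z0) z0"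
        using pball_nested[of z "m z0" z0 l] M[of z0] l w by auto
      moreover have "z0 \<in> S"
        using z0(1) F(1) by blast
      ultimately show ?thesis
        using m[of z0 z] m[of z0 w] z0(2) by simp
    qed
    have "g ` S \<subseteq> g ` F"
    proof
      fix y assume "y \<in> g ` S"
      then obtain z z0 where "y = g z" "z \<in> pball (m z0) z0" "z0 \<in> F"
        using F(3) by blast
      then show "y \<in> g ` F"
        using m[of z0 z] F(1) by (metis imageI subsetD)
    qed
    then show "finite (g ` S)"
      using F(2) finite_surj by blast
  qed
qed

end


context uniformised
begin

section \<open>Absolute values of analytic functions\<close>

lemma kabs_monomial_le:
  assumes "\<And>i. kabs (h $ i) \<le> r"
  shows "kabs (monomial_at \<nu> h) \<le> r ^ (\<Sum>i\<in>UNIV. \<nu> i)"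
proof -
  have "kabs (monomial_at \<nu> h) = (\<Prod>i\<in>UNIV. kabs (h $ i) ^ \<nu> i)"
    by (simp add: monomial_at_def kabs_prod kabs_power)
  also have "\<dots> \<le> (\<Prod>i\<in>UNIV. r ^ \<nu> i)"
    using assms by (intro prod_mono) (auto intro: power_mono)
  also have "\<dots> = r ^ (\<Sum>i\<in>UNIV. \<nu> i)"
    by (simp add: power_sum)
  finally show ?thesis .
qed

lemma monomial_at_0:
  "monomial_at (\<lambda>_. 0) h = 1" "\<nu> \<noteq> (\<lambda>_. 0) \<Longrightarrow> monomial_at \<nu> 0 = 0"
  by (auto simp: monomial_at_def fun_eq_iff)

lemma has_sum_approx:
  fixes f :: "'a \<Rightarrow> 'k"
  assumes "(f has_sum s) UNIV" "0 < e"
  obtains F where "finite F" "\<And>G. finite G \<Longrightarrow> F \<subseteq> G \<Longrightarrow> kabs (sum f G - s) < e"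
proof -
  have "eventually (\<lambda>G. dist (sum f G) s < e) (finite_subsets_at_top UNIV)"
    using assms unfolding has_sum_def by (auto dest: tendstoD)
  then show thesis
    unfolding eventually_finite_subsets_at_top using that by (auto simp: dist_eq_kabs)
qed

text \<open>Two finite partial sums close to the limit that differ by one term bound that term.\<close>

lemma has_sum_terms_bounded:
  fixes f :: "'a \<Rightarrow> 'k"
  assumes "(f has_sum s) UNIV"
  obtains C where "\<And>x. kabs (f x) \<le> C"
proof -
  obtain F where F: "finite F" "\<And>G. finite G \<Longrightarrow> F \<subseteq> G \<Longrightarrow> kabs (sum f G - s) < 1"
    using has_sum_approx[OF assms, of 1] by auto
  have "kabs (f x) \<le> 1" if "x \<notin> F" for x
  proof -
    have "kabs (sum f F - s) < 1" "kabs (sum f (insert x F) - s) < 1"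
      using F(2)[of F] F(2)[of "insert x F"] F(1) by blast+
    then have "kabs ((sum f (insert x F) - s) - (sum f F - s)) \<le> 1"
      using kabs_diff_leI[OF less_imp_le less_imp_le] by blast
    moreover have "f x = (sum f (insert x F) - s) - (sum f F - s)"
      using that F(1) by simp
    ultimately show ?thesis
      by simp
  qed
  moreover have "kabs (f x) \<le> (\<Sum>y\<in>F. kabs (f y))" if "x \<in> F" for x
    using that F(1) by (intro member_le_sum) auto
  ultimately have "kabs (f x) \<le> max 1 (\<Sum>y\<in>F. kabs (f y))" for x
    by (cases "x \<in> F") (auto simp: le_max_iff_disj)
  then show thesis
    using that by blast
qed

text \<open>
  Near a point where it does not vanish, the constant term of the power series dominates: the
  coefficients are bounded at one polyradius, so on a smaller polydisc all other terms together
  are smaller than the constant term, and the ultrametric inequality gives equality of absolute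
  values.
\<close>

lemma analytic_kabs_locally_constant:
  fixes f :: "'k ^ 'n::finite \<Rightarrow> 'k"
  assumes "kanalytic_on f S" "open S" "a \<in> S" "f a \<noteq> 0"
  obtains m where "\<And>x. x \<in> pball m a \<Longrightarrow> kabs (f x) = kabs (f a)"
proof -
  obtain r c where r: "r > 0" and c: "\<And>x. x \<in> S \<Longrightarrow> maxnorm (x - a) < r \<Longrightarrow>
      ((\<lambda>\<nu>. c \<nu> * monomial_at \<nu> (x - a)) has_sum f x) UNIV"
    using assms(1,3) unfolding kanalytic_on_def by blast
  obtain m0 where m0: "pball m0 a \<subseteq> S"
    using pball_basis[OF assms(2,3)] by blast
  obtain k where k: "kabs \<pi> powi int k < r"
    using powi_small[OF r] by blast
  define m1 where "m1 = max m0 (int k)"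
  have m1: "pball m1 a \<subseteq> S" "kabs \<pi> powi m1 < r"
    using m0 pball_mono[of m0 m1 a] k pi_powi_le_iff[of m1 "int k"] unfolding m1_def by auto
  have sums: "((\<lambda>\<nu>. c \<nu> * monomial_at \<nu> (x - a)) has_sum f x) UNIV" if "x \<in> pball m1 a" for x
  proof (rule c)
    show "x \<in> S"
      using that m1 by blast
    have "maxnorm (x - a) \<le> kabs \<pi> powi m1"
      using that by (simp add: maxnorm_le_iff pball_def)
    then show "maxnorm (x - a) < r"
      using m1 by linarith
  qed
  \<comment> \<open>the corner of the polydisc, where every monomial has the largest possible absolute value\<close>
  define x0 where "x0 = a + (\<chi> i. \<pi> powi m1)"
  have "x0 \<in> pball m1 a"
    by (simp add: x0_def pball_def kabs_power_int)
  then obtain C where C: "\<And>\<nu>. kabs (c \<nu> * monomial_at \<nu> (x0 - a)) \<le> C"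
    using has_sum_terms_bounded[OF sums] by blast
  have C': "kabs (c \<nu>) * (kabs \<pi> powi m1) ^ (\<Sum>i\<in>UNIV. \<nu> i) \<le> C" for \<nu>
  proof -
    have "kabs (monomial_at \<nu> (x0 - a)) = (kabs \<pi> powi m1) ^ (\<Sum>i\<in>UNIV. \<nu> i)"
      by (simp add: x0_def monomial_at_def kabs_prod kabs_power kabs_power_int power_sum)
    then show ?thesis
      using C[of \<nu>] by (simp add: kabs_mult)
  qed
  have "C \<ge> 0"
    using C' kabs_nonneg order_trans by (metis C)
  have fa: "f a = c (\<lambda>_. 0)"
  proof (rule ccontr)
    assume "f a \<noteq> c (\<lambda>_. 0)"
    then have "0 < kabs (c (\<lambda>_. 0) - f a)"
      by simp
    then obtain F where F: "finite F" "\<And>G. finite G \<Longrightarrow> F \<subseteq> G \<Longrightarrow>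
        kabs ((\<Sum>\<nu>\<in>G. c \<nu> * monomial_at \<nu> (a - a)) - f a) < kabs (c (\<lambda>_. 0) - f a)"
      using has_sum_approx[OF sums[OF center_in_pball]] by blast
    have "(\<Sum>\<nu>\<in>insert (\<lambda>_. 0) F. c \<nu> * monomial_at \<nu> (a - a)) = (\<Sum>\<nu>\<in>{\<lambda>_. 0}. c \<nu>)"
      using F(1) by (intro sum.mono_neutral_cong_right) (auto simp: monomial_at_0)
    then show False
      using F(2)[of "insert (\<lambda>_. 0) F"] F(1) by auto
  qed
  have "0 < kabs (f a) / (C + 1)"
    using assms(4) \<open>C \<ge> 0\<close> by simp
  then obtain j where j: "kabs \<pi> powi int j < kabs (f a) / (C + 1)"
    using powi_small by blast
  have small: "C * kabs \<pi> ^ j < kabs (f a)"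
  proof -
    have "C * kabs \<pi> ^ j \<le> (C + 1) * kabs \<pi> ^ j"
      by (simp add: mult_right_mono)
    also have "\<dots> < kabs (f a)"
      using j \<open>C \<ge> 0\<close> by (simp add: field_simps)
    finally show ?thesis .
  qed
  have "kabs (f x) = kabs (f a)" if x: "x \<in> pball (m1 + int j) a" for x
  proof (rule kabs_eq_if_close)
    have x': "x \<in> pball m1 a"
      using x pball_mono[of m1 "m1 + int j" a] by auto
    have small_term: "kabs (c \<nu> * monomial_at \<nu> (x - a)) \<le> C * kabs \<pi> ^ j" if \<nu>: "\<nu> \<noteq> (\<lambda>_. 0)" for \<nu>
    proof -
      let ?d = "\<Sum>i\<in>UNIV. \<nu> i"
      have "?d \<noteq> 0"
        using \<nu> by (auto simp: fun_eq_iff)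
      then have "1 \<le> ?d"
        by linarith
      have "kabs (monomial_at \<nu> (x - a)) \<le> (kabs \<pi> powi (m1 + int j)) ^ ?d"
        using x by (intro kabs_monomial_le) (simp add: pball_def)
      also have "\<dots> = (kabs \<pi> powi m1) ^ ?d * (kabs \<pi> ^ j) ^ ?d"
        by (simp add: power_int_add power_mult_distrib)
      also have "\<dots> \<le> (kabs \<pi> powi m1) ^ ?d * kabs \<pi> ^ j"
      proof (intro mult_left_mono)
        show "(kabs \<pi> ^ j) ^ ?d \<le> kabs \<pi> ^ j"
          using power_decreasing[OF \<open>1 \<le> ?d\<close>, of "kabs \<pi> ^ j"] power_le_one[of "kabs \<pi>" j]
          by (simp add: less_imp_le)
      qed simp
      finally have "kabs (c \<nu> * monomial_at \<nu> (x - a)) \<le>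
          kabs (c \<nu>) * ((kabs \<pi> powi m1) ^ ?d * kabs \<pi> ^ j)"
        by (simp add: kabs_mult mult_left_mono)
      also have "\<dots> \<le> C * kabs \<pi> ^ j"
        using mult_right_mono[OF C'[of \<nu>], of "kabs \<pi> ^ j"] by (simp add: mult.assoc)
      finally show ?thesis .
    qed
    obtain F where F: "finite F" "\<And>G. finite G \<Longrightarrow> F \<subseteq> G \<Longrightarrow>
        kabs ((\<Sum>\<nu>\<in>G. c \<nu> * monomial_at \<nu> (x - a)) - f x) < kabs (f a)"
      using has_sum_approx[OF sums[OF x'], of "kabs (f a)"] assms(4) by auto
    define T where "T = (\<Sum>\<nu>\<in>F - {\<lambda>_. 0}. c \<nu> * monomial_at \<nu> (x - a))"
    have "(\<Sum>\<nu>\<in>insert (\<lambda>_. 0) F. c \<nu> * monomial_at \<nu> (x - a)) = f a + T"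
      using F(1) by (simp add: sum.insert_remove fa monomial_at_0 T_def)
    then have 1: "kabs (f a + T - f x) < kabs (f a)"
      using F(2)[of "insert (\<lambda>_. 0) F"] F(1) by auto
    have "kabs T \<le> C * kabs \<pi> ^ j"
      unfolding T_def using small_term \<open>C \<ge> 0\<close> by (intro kabs_sum_leI) auto
    then have 2: "kabs T < kabs (f a)"
      using small by linarith
    have "kabs (T - (f a + T - f x)) \<le> max (kabs T) (kabs (f a + T - f x))"
      by (rule kabs_diff_leI) auto
    then show "kabs (f x - f a) < kabs (f a)"
      using 1 2 by (simp add: algebra_simps)
  qed
  then show thesis
    using that by blast
qed

end


section \<open>Haar measure of balls\<close>

locale haar_uniformised = uniformised \<pi>
  for \<pi> :: "'k::nonarch_local_field" +
  fixes H :: "('k ^ 'n::finite) measure"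
  assumes haar: "haar_measure H"
begin

lemma sets_H [measurable_cong, simp]: "sets H = sets borel"
  using haar by (simp add: haar_measure_def)

lemma emeasure_translate: "E \<in> sets borel \<Longrightarrow> emeasure H ((\<lambda>z. t + z) ` E) = emeasure H E"
  using haar by (simp add: haar_measure_def)

lemma pball_sets [simp]: "pball m a \<in> sets borel"
  by (simp add: borel_open)

lemma emeasure_pball: "emeasure H (pball m a) = emeasure H (pball m 0)"
  using emeasure_translate[of "pball m 0" a] by (simp add: translate_pball)

lemma pball_finite_cover:
  obtains F :: "('k ^ 'n) set" where "finite F" "pball m 0 \<subseteq> (\<Union>t\<in>F. pball (m + 1) t)"
proof -
  obtain R :: "'k set" where R: "finite R" "residue_class ` OK = residue_class ` R"
    using finite_subset_image[OF finite_residue_classes order_refl] by meson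
  have "finite (PiE (UNIV :: 'n set) (\<lambda>_. R))"
    using R(1) by (intro finite_PiE) auto
  then have "finite ((\<lambda>f. \<chi> i. \<pi> powi m * f i) ` PiE (UNIV :: 'n set) (\<lambda>_. R))"
    by (rule finite_imageI)
  moreover have "z \<in> (\<Union>t\<in>(\<lambda>f. \<chi> i. \<pi> powi m * f i) ` PiE (UNIV :: 'n set) (\<lambda>_. R). pball (m + 1) t)"
    if "z \<in> pball m 0" for z
  proof -
    have "z $ i / \<pi> powi m \<in> OK" for i
      using that by (simp add: pball_def OK_def kabs_divide kabs_power_int)
    then have "\<exists>r\<in>R. residue_class (z $ i / \<pi> powi m) = residue_class r" for i
      using R(2) by blast
    then obtain f where f: "\<And>i. f i \<in> R" "\<And>i. residue_class (z $ i / \<pi> powi m) = residue_class (f i)"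
      by metis
    have "kabs (z $ i - \<pi> powi m * f i) \<le> kabs \<pi> powi (m + 1)" for i
    proof -
      have "kabs (z $ i / \<pi> powi m - f i) \<le> kabs \<pi>"
        using f(2)[of i] by (simp add: residue_class_eq_iff kabs_less_1_iff)
      moreover have "z $ i - \<pi> powi m * f i = \<pi> powi m * (z $ i / \<pi> powi m - f i)"
        by (simp add: field_simps)
      ultimately show ?thesis
        by (simp add: kabs_mult kabs_power_int power_int_add mult_left_mono)
    qed
    then have "z \<in> pball (m + 1) (\<chi> i. \<pi> powi m * f i)"
      by (simp add: pball_def)
    then show ?thesis
      using f(1) by (intro UN_I[of "\<chi> i. \<pi> powi m * f i"]) auto
  qed
  ultimately show thesis
    using that by blast
qed

lemma emeasure_pball_step: "\<exists>N::nat. emeasure H (pball m 0) \<le> of_nat N * emeasure H (pball (m + 1) 0)"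
proof -
  obtain F :: "('k ^ 'n) set" where F: "finite F" "pball m 0 \<subseteq> (\<Union>t\<in>F. pball (m + 1) t)"
    using pball_finite_cover by blast
  have "emeasure H (pball m 0) \<le> emeasure H (\<Union>t\<in>F. pball (m + 1) t)"
    using F by (intro emeasure_mono) auto
  also have "\<dots> \<le> (\<Sum>t\<in>F. emeasure H (pball (m + 1) t))"
    using F by (intro emeasure_subadditive_finite) auto
  also have "\<dots> = (\<Sum>t\<in>F. emeasure H (pball (m + 1) 0))"
    by (intro sum.cong refl emeasure_pball)
  also have "\<dots> = of_nat (card F) * emeasure H (pball (m + 1) 0)"
    by simp
  finally show ?thesis by blast
qed

lemma emeasure_pball_pos_finite:
  "0 < emeasure H (pball m 0) \<and> emeasure H (pball m 0) < \<infinity>"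
proof (induction m rule: int_induct[where k = 0])
  case base
  then show ?case
    using haar by (simp add: haar_measure_def OKn_eq_pball)
next
  case (step1 i)
  obtain N where "emeasure H (pball i 0) \<le> of_nat N * emeasure H (pball (i + 1) 0)"
    using emeasure_pball_step by blast
  moreover have "emeasure H (pball (i + 1) 0) \<le> emeasure H (pball i 0)"
    by (intro emeasure_mono pball_mono) auto
  ultimately show ?case
    using step1.IH by (auto simp: zero_less_iff_neq_zero)
next
  case (step2 i)
  obtain N where "emeasure H (pball (i - 1) 0) \<le> of_nat N * emeasure H (pball i 0)"
    using emeasure_pball_step[of "i - 1"] by auto
  moreover have "of_nat N * emeasure H (pball i 0) < \<infinity>"
    using step2.IH by (simp add: ennreal_mult_less_top of_nat_less_top)
  moreover have "emeasure H (pball i 0) \<le> emeasure H (pball (i - 1) 0)"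
    by (intro emeasure_mono pball_mono) auto
  ultimately show ?case
    using step2.IH by (auto simp: zero_less_iff_neq_zero)
qed

definition vol :: "int \<Rightarrow> real" where
  "vol m = measure H (pball m 0)"

lemma emeasure_pball_vol: "emeasure H (pball m a) = ennreal (vol m)"
  unfolding vol_def emeasure_pball[of m a]
  using emeasure_pball_pos_finite[of m] by (intro emeasure_eq_ennreal_measure) auto

lemma vol_pos [simp]: "0 < vol m"
  using emeasure_pball_pos_finite[of m] by (simp add: emeasure_pball_vol)

text \<open>A ball contains two disjoint balls of the next smaller radius.\<close>

lemma vol_half: "2 * vol (m + 1) \<le> vol m"
proof -
  let ?t = "\<chi> i. \<pi> powi m :: 'k ^ 'n"
  have "?t \<notin> pball (m + 1) 0"
    using pi_powi_le_iff[of m "m + 1"] by (simp add: pball_def kabs_power_int)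
  then have disj: "pball (m + 1) 0 \<inter> pball (m + 1) ?t = {}"
    using pball_recentre by (metis center_in_pball disjoint_iff)
  have "?t \<in> pball m 0"
    by (simp add: pball_def kabs_power_int)
  then have sub: "pball (m + 1) 0 \<union> pball (m + 1) ?t \<subseteq> pball m 0"
    using pball_nested[of ?t m 0 "m + 1"] pball_mono[of m "m + 1" 0] by auto
  have "ennreal (vol (m + 1)) + ennreal (vol (m + 1)) = emeasure H (pball (m + 1) 0 \<union> pball (m + 1) ?t)"
    using disj by (subst plus_emeasure[symmetric]) (auto simp: emeasure_pball_vol)
  also have "\<dots> \<le> ennreal (vol m)"
    unfolding emeasure_pball_vol[of m 0, symmetric] using sub by (intro emeasure_mono) auto
  finally show ?thesis
    using vol_pos[of m] vol_pos[of "m + 1"]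
    by (simp add: ennreal_plus[symmetric] less_imp_le del: ennreal_plus)
qed

lemma vol_geometric: "vol (m + int k) \<le> vol m * (1 / 2) ^ k"
proof (induction k)
  case (Suc k)
  have "2 * vol (m + int (Suc k)) \<le> vol (m + int k)"
    using vol_half[of "m + int k"] by (simp add: algebra_simps)
  then show ?case
    using Suc by simp
qed simp

lemma vol_antimono: "m \<le> l \<Longrightarrow> vol l \<le> vol m"
proof -
  assume "m \<le> l"
  then have "vol l \<le> vol m * (1 / 2) ^ nat (l - m)"
    using vol_geometric[of m "nat (l - m)"] by simp
  also have "\<dots> \<le> vol m"
    by (simp add: mult_left_le power_le_one less_imp_le)
  finally show ?thesis .
qed

lemma vol_bounded_above: "\<exists>m0. \<forall>m. vol m \<le> b \<longrightarrow> m0 \<le> m"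
proof -
  obtain k where k: "b / vol 0 < 2 ^ k"
    using real_arch_pow[of 2 "b / vol 0"] by auto
  have "- int k \<le> m" if "vol m \<le> b" for m
  proof (rule ccontr)
    assume "\<not> - int k \<le> m"
    then have "vol (- int k) \<le> b"
      using vol_antimono[of m "- int k"] that by linarith
    moreover have "vol 0 * 2 ^ k \<le> vol (- int k)"
      using vol_geometric[of "- int k" k] by (simp add: field_simps)
    ultimately show False
      using k by (simp add: field_simps)
  qed
  then show ?thesis by blast
qed

lemma vol_bounded_below:
  assumes "0 < a"
  shows "\<exists>m1. \<forall>m. a \<le> vol m \<longrightarrow> m \<le> m1"
proof -
  obtain k where k: "(1 / 2) ^ k < a / vol 0"
    using real_arch_pow_inv[of "a / vol 0" "1 / 2"] assms by auto
  have "m \<le> int k" if "a \<le> vol m" for m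
  proof (rule ccontr)
    assume "\<not> m \<le> int k"
    then have "a \<le> vol (int k)"
      using vol_antimono[of "int k" m] that by linarith
    moreover have "vol (int k) \<le> vol 0 * (1 / 2) ^ k"
      using vol_geometric[of 0 k] by simp
    ultimately have "a \<le> vol 0 * (1 / 2) ^ k"
      by linarith
    also have "\<dots> < vol 0 * (a / vol 0)"
      using k by (intro mult_strict_left_mono) auto
    also have "\<dots> = a"
      using vol_pos[of 0] by (simp add: less_imp_neq[symmetric])
    finally show False
      by simp
  qed
  then show ?thesis by blast
qed

lemma finite_vol_levels:
  assumes "0 < a"
  shows "finite {m. a \<le> vol m \<and> vol m \<le> b}"
proof -
  obtain m0 m1 where "\<And>m. vol m \<le> b \<Longrightarrow> m0 \<le> m" "\<And>m. a \<le> vol m \<Longrightarrow> m \<le> m1"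
    using vol_bounded_above vol_bounded_below[OF assms] by blast
  then have "{m. a \<le> vol m \<and> vol m \<le> b} \<subseteq> {m0..m1}"
    by auto
  then show ?thesis
    using finite_subset by blast
qed

lemma summable_vol_powr:
  assumes "0 < \<theta>"
  shows "(\<lambda>m. vol m powr \<theta>) summable_on {m0..}"
proof -
  let ?h = "\<lambda>k. m0 + int k"
  have geometric: "summable (\<lambda>k. vol m0 powr \<theta> * ((1 / 2) powr \<theta>) ^ k)"
    using assms by (intro summable_mult summable_geometric) (use powr_less_mono2[of \<theta> "1 / 2" 1] in auto)
  have bound: "vol (?h k) powr \<theta> \<le> vol m0 powr \<theta> * ((1 / 2) powr \<theta>) ^ k" for k
  proof -
    have "vol (?h k) powr \<theta> \<le> (vol m0 * (1 / 2) ^ k) powr \<theta>"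
      using vol_geometric[of m0 k] assms by (intro powr_mono2) (auto simp: less_imp_le)
    also have "\<dots> = vol m0 powr \<theta> * ((1 / 2) powr \<theta>) ^ k"
      by (simp add: powr_mult less_imp_le powr_realpow[symmetric] powr_powr mult.commute)
    finally show ?thesis .
  qed
  have "summable (\<lambda>k. vol (?h k) powr \<theta>)"
    using geometric by (rule summable_comparison_test'[where N = 0]) (use bound in simp)
  then have "(\<lambda>k. vol (?h k) powr \<theta>) summable_on UNIV"
    by (intro summable_nonneg_imp_summable_on) auto
  moreover have "?h ` UNIV = {m0..}"
    by (auto simp: image_iff intro!: exI[of _ "nat (_ - m0)"])
  moreover have "inj ?h"
    by (auto intro: injI)
  ultimately show ?thesis
    using summable_on_reindex[of ?h UNIV "\<lambda>m. vol m powr \<theta>"] by (simp add: o_def)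
qed

lemma emeasure_compact_finite:
  assumes "compact S"
  shows "emeasure H S < \<infinity>"
proof -
  obtain F where F: "F \<subseteq> S" "finite F" "S \<subseteq> (\<Union>z\<in>F. pball 0 z)"
    by (rule compactE_image[OF assms, of S "\<lambda>z. pball 0 z"]) auto
  have "emeasure H S \<le> emeasure H (\<Union>z\<in>F. pball 0 z)"
    using F by (intro emeasure_mono) auto
  also have "\<dots> \<le> (\<Sum>z\<in>F. emeasure H (pball 0 z))"
    using F by (intro emeasure_subadditive_finite) auto
  also have "\<dots> < \<infinity>"
    by (simp add: emeasure_pball_vol ennreal_mult_less_top of_nat_less_top)
  finally show ?thesis .
qed

end


section \<open>Functions on a finite partition\<close>

text \<open>
  The sets of points with the same membership in each \<open>F \<in> \<F>\<close> form a finite measurable partition.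
\<close>

lemma simple_function_of_membership:
  assumes "finite \<F>" "\<F> \<subseteq> sets M"
    and same: "\<And>x y. x \<in> space M \<Longrightarrow> y \<in> space M \<Longrightarrow> (\<And>F. F \<in> \<F> \<Longrightarrow> x \<in> F \<longleftrightarrow> y \<in> F) \<Longrightarrow> h x = h y"
  shows "simple_function M h"
proof -
  define key where "key x = {F \<in> \<F>. x \<in> F}" for x
  define cell where "cell K = space M \<inter> (\<Inter>F\<in>\<F>. if F \<in> K then F else space M - F)" for K
  have cell_sets: "cell K \<in> sets M" for K
  proof (cases "\<F> = {}")
    case False
    have "(\<Inter>F\<in>\<F>. if F \<in> K then F else space M - F) \<in> sets M"
      using assms False by (intro sets.finite_INT) auto
    then show ?thesis
      unfolding cell_def by (intro sets.Int) auto
  qed (simp add: cell_def)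
  have in_cell: "x \<in> cell (key x)" if "x \<in> space M" for x
    using that by (auto simp: cell_def key_def)
  have eq: "h x = h y" if "x \<in> space M" "y \<in> cell (key x)" for x y
    using that by (intro same) (auto simp: cell_def key_def split: if_splits)
  show ?thesis
    unfolding simple_function_def
  proof (intro conjI ballI)
    have fin: "finite (key ` space M)"
      by (rule finite_subset[of _ "Pow \<F>"]) (use assms(1) in \<open>auto simp: key_def\<close>)
    have "h ` space M \<subseteq> (\<lambda>K. h (SOME y. y \<in> cell K)) ` key ` space M"
    proof
      fix z assume "z \<in> h ` space M"
      then obtain x where x: "x \<in> space M" "z = h x" by blast
      have "(SOME y. y \<in> cell (key x)) \<in> cell (key x)"
        using in_cell[OF x(1)] by (rule someI)
      then have "z = h (SOME y. y \<in> cell (key x))"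
        unfolding x(2) by (rule eq[OF x(1)])
      then show "z \<in> (\<lambda>K. h (SOME y. y \<in> cell K)) ` key ` space M"
        using x(1) by (intro image_eqI[of z _ "key x"] imageI)
    qed
    then show "finite (h ` space M)"
      using fin finite_subset by blast
    fix z assume "z \<in> h ` space M"
    have "h -` {z} \<inter> space M = (\<Union>K\<in>key ` {x \<in> space M. h x = z}. cell K)"
    proof (intro equalityI subsetI)
      fix y assume "y \<in> h -` {z} \<inter> space M"
      then show "y \<in> (\<Union>K\<in>key ` {x \<in> space M. h x = z}. cell K)"
        using in_cell[of y] by blast
    next
      fix y assume "y \<in> (\<Union>K\<in>key ` {x \<in> space M. h x = z}. cell K)"
      then obtain x where "x \<in> space M" "h x = z" "y \<in> cell (key x)"
        by blast
      then show "y \<in> h -` {z} \<inter> space M"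
        using eq[of x y] by (simp add: cell_def)
    qed
    moreover have "(\<Union>K\<in>key ` {x \<in> space M. h x = z}. cell K) \<in> sets M"
      using rev_finite_subset[OF fin, of "key ` {x \<in> space M. h x = z}"] cell_sets
      by (intro sets.finite_UN) auto
    ultimately show "h -` {z} \<inter> space M \<in> sets M"
      by simp
  qed
qed


locale wavelet_manifold = haar_uniformised \<pi> H
  for \<pi> :: "'k::nonarch_local_field" and H :: "('k ^ 'n::finite) measure" +
  fixes A :: "('x::t2_space, 'k, 'n) chart set"
    and \<omega> :: "('x, 'k, 'n) chart \<Rightarrow> 'k ^ 'n \<Rightarrow> 'k"
    and \<mu> :: "'x measure"
    and \<xi> :: "'k \<Rightarrow> complex"
    and s :: real
  assumes character: "additive_character \<pi> \<xi>"
    and atlas: "analytic_atlas A"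
    and finite_atlas: "finite A"
    and compact_charts: "\<forall>c\<in>A. compact (fst c)"
    and form: "analytic_top_form A \<omega>"
    and nonvanishing: "nowhere_vanishing A \<omega>"
    and form_measure: "form_measure A \<omega> H \<mu>"
    and s_gt_1: "s > 1"
begin

section \<open>Charts\<close>

lemma is_chart: "c \<in> A \<Longrightarrow> is_chart c"
  using atlas by (simp add: analytic_atlas_def)

lemma chart_open: "c \<in> A \<Longrightarrow> open (fst c)" "c \<in> A \<Longrightarrow> open (snd c ` fst c)"
  using is_chart by (auto simp: is_chart_def)

lemma chart_continuous:
  "c \<in> A \<Longrightarrow> continuous_on (fst c) (snd c)"
  "c \<in> A \<Longrightarrow> continuous_on (snd c ` fst c) (chart_inv c)"
  using is_chart by (auto simp: is_chart_def homeomorphism_def)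

lemma chart_inv_left: "c \<in> A \<Longrightarrow> x \<in> fst c \<Longrightarrow> chart_inv c (snd c x) = x"
  using is_chart by (auto simp: is_chart_def homeomorphism_def)

lemma chart_inj: "c \<in> A \<Longrightarrow> inj_on (snd c) (fst c)"
  by (rule inj_on_inverseI[of _ "chart_inv c"]) (rule chart_inv_left)

lemma chart_cover: "\<exists>c\<in>A. x \<in> fst c"
  using atlas unfolding analytic_atlas_def by blast

lemma chart_closed: "c \<in> A \<Longrightarrow> closed (fst c)"
  using compact_charts compact_imp_closed by blast

lemma chart_image_compact: "c \<in> A \<Longrightarrow> compact (snd c ` fst c)"
  using compact_charts chart_continuous by (blast intro: compact_continuous_image)

lemma chart_image_eq_vimage:
  assumes "c \<in> A" "V \<subseteq> fst c"
  shows "snd c ` V = chart_inv c -` V \<inter> snd c ` fst c"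
  using assms chart_inv_left by (auto simp: subset_iff)

lemma chart_image_open:
  assumes "c \<in> A" "V \<subseteq> fst c" "open V"
  shows "open (snd c ` V)"
  unfolding chart_image_eq_vimage[OF assms(1,2)]
  using continuous_open_preimage[OF chart_continuous(2) chart_open(2)] assms
  by (simp add: Int_commute)

lemma chart_image_borel:
  assumes "c \<in> A" "V \<subseteq> fst c" "V \<in> sets borel"
  shows "snd c ` V \<in> sets borel"
proof -
  have "chart_inv c \<in> borel_measurable (restrict_space borel (snd c ` fst c))"
    using chart_continuous(2)[OF assms(1)] by (rule borel_measurable_continuous_on_restrict)
  then have "chart_inv c -` V \<inter> space (restrict_space borel (snd c ` fst c)) \<in>
      sets (restrict_space borel (snd c ` fst c))"
    using assms(3) by (rule measurable_sets)
  then show ?thesis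
    unfolding chart_image_eq_vimage[OF assms(1,2)]
    using chart_open(2)[OF assms(1)]
    by (simp add: sets_restrict_space_iff space_restrict_space borel_open)
qed

lemma chart_vimage_open:
  assumes "c \<in> A" "open T"
  shows "open {x \<in> fst c. snd c x \<in> T}"
  using continuous_open_preimage[OF chart_continuous(1) chart_open(1)] assms
  by (simp add: Int_def vimage_def)


section \<open>The scale below which the manifold looks homogeneous\<close>

lemma overlap_locally_constant:
  assumes "c \<in> A" "d \<in> A" "z \<in> snd c ` fst c"
  shows "\<exists>m. \<forall>w\<in>pball m z. w \<in> overlap c d \<longleftrightarrow> z \<in> overlap c d"
proof (cases "z \<in> overlap c d")
  case True
  have "open (overlap c d)"
    unfolding overlap_def using assms chart_open by (intro chart_image_open open_Int) blast+
  then show ?thesis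
    using True pball_basis[of "overlap c d" z] by (metis subsetD)
next
  case False
  have "open (snd c ` (fst c - fst d))"
    using assms chart_open chart_closed by (intro chart_image_open open_Diff) auto
  moreover have z: "z \<in> snd c ` (fst c - fst d)"
    using False assms(3) by (auto simp: overlap_def)
  ultimately obtain m where m: "pball m z \<subseteq> snd c ` (fst c - fst d)"
    using pball_basis by blast
  have "overlap c d \<inter> snd c ` (fst c - fst d) = {}"
    using chart_inj[OF assms(1)] by (auto simp: overlap_def inj_on_def)
  then show ?thesis
    using m False by blast
qed

lemma density_locally_constant:
  assumes "c \<in> A" "z \<in> snd c ` fst c"
  shows "\<exists>m. \<forall>w\<in>pball m z. kabs (\<omega> c w) = kabs (\<omega> c z)"
proof (rule analytic_kabs_locally_constant)
  show "kanalytic_on (\<omega> c) (snd c ` fst c)"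
    using form assms by (simp add: analytic_top_form_def)
  show "\<omega> c z \<noteq> 0"
    using nonvanishing assms unfolding nowhere_vanishing_def by blast
qed (use assms chart_open in blast)+

text \<open>
  The overlaps are open and closed because chart domains are compact, and the density has locally
  constant absolute value because it does not vanish; compactness of the chart image makes the
  radius of constancy uniform.
\<close>

lemma chart_data_uniform:
  assumes "c \<in> A"
  shows "\<exists>M. \<forall>l z w. M \<le> l \<longrightarrow> z \<in> snd c ` fst c \<longrightarrow> w \<in> pball l z \<longrightarrow>
      (\<forall>d\<in>A. w \<in> overlap c d \<longleftrightarrow> z \<in> overlap c d) \<and> kabs (\<omega> c w) = kabs (\<omega> c z)"
    and "finite ((\<lambda>z. kabs (\<omega> c z)) ` snd c ` fst c)"
proof -
  define g where "g z = ({d \<in> A. z \<in> overlap c d}, kabs (\<omega> c z))" for z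
  have g: "\<exists>m. \<forall>w\<in>pball m z. g w = g z" if z: "z \<in> snd c ` fst c" for z
  proof -
    obtain m where m: "\<And>d w. d \<in> A \<Longrightarrow> w \<in> pball (m d) z \<Longrightarrow> w \<in> overlap c d \<longleftrightarrow> z \<in> overlap c d"
      using overlap_locally_constant[OF assms _ z] by metis
    obtain m' where m': "\<And>w. w \<in> pball m' z \<Longrightarrow> kabs (\<omega> c w) = kabs (\<omega> c z)"
      using density_locally_constant[OF assms z] by blast
    define M where "M = Max (insert m' (m ` A))"
    have "pball M z \<subseteq> pball m' z" and "d \<in> A \<Longrightarrow> pball M z \<subseteq> pball (m d) z" for d
      using finite_atlas by (auto simp: M_def intro!: pball_mono)
    then have "\<forall>w\<in>pball M z. g w = g z"
      using m m' unfolding g_def by blast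
    then show ?thesis ..
  qed
  obtain M where M: "\<And>l z w. M \<le> l \<Longrightarrow> z \<in> snd c ` fst c \<Longrightarrow> w \<in> pball l z \<Longrightarrow> g w = g z"
    and fin: "finite (g ` snd c ` fst c)"
    using locally_constant_on_compact[OF chart_image_compact[OF assms], of g] g by metis
  show "\<exists>M. \<forall>l z w. M \<le> l \<longrightarrow> z \<in> snd c ` fst c \<longrightarrow> w \<in> pball l z \<longrightarrow>
      (\<forall>d\<in>A. w \<in> overlap c d \<longleftrightarrow> z \<in> overlap c d) \<and> kabs (\<omega> c w) = kabs (\<omega> c z)"
  proof (intro exI[of _ M] allI impI)
    fix l z w assume "M \<le> l" "z \<in> snd c ` fst c" "w \<in> pball l z"
    then have "g w = g z"
      by (rule M)
    then show "(\<forall>d\<in>A. w \<in> overlap c d \<longleftrightarrow> z \<in> overlap c d) \<and> kabs (\<omega> c w) = kabs (\<omega> c z)"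
      unfolding g_def by blast
  qed
  have "(\<lambda>z. kabs (\<omega> c z)) ` snd c ` fst c = snd ` g ` snd c ` fst c"
    by (simp add: image_image g_def)
  then show "finite ((\<lambda>z. kabs (\<omega> c z)) ` snd c ` fst c)"
    using fin by simp
qed

text \<open>The value 1 guarantees that the minimum and the maximum below range over a non-empty set.\<close>

definition densities :: "real set" where
  "densities = insert 1 (\<Union>c\<in>A. (\<lambda>z. kabs (\<omega> c z)) ` snd c ` fst c)"

definition density_min :: real where "density_min = Min densities"
definition density_max :: real where "density_max = Max densities"

text \<open>
  Such an exponent exists for each chart by compactness, and the atlas is finite.
\<close>

definition homogeneous_scale :: int where
  "homogeneous_scale = (SOME M. \<forall>c\<in>A. \<forall>l z w. M \<le> l \<longrightarrow> z \<in> snd c ` fst c \<longrightarrow> w \<in> pball l z \<longrightarrow>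
      (\<forall>d\<in>A. w \<in> overlap c d \<longleftrightarrow> z \<in> overlap c d) \<and> kabs (\<omega> c w) = kabs (\<omega> c z))"

lemma density_bounds:
  "0 < density_min" "0 < density_max"
  "c \<in> A \<Longrightarrow> z \<in> snd c ` fst c \<Longrightarrow> density_min \<le> kabs (\<omega> c z)"
  "c \<in> A \<Longrightarrow> z \<in> snd c ` fst c \<Longrightarrow> kabs (\<omega> c z) \<le> density_max"
proof -
  have fin: "finite densities"
    unfolding densities_def using finite_atlas chart_data_uniform(2) by auto
  have pos: "0 < w" if "w \<in> densities" for w
    using that nonvanishing by (auto simp: densities_def nowhere_vanishing_def)
  have 1: "1 \<in> densities"
    by (simp add: densities_def)
  show "0 < density_min"
    unfolding density_min_def using pos Min_in[OF fin] 1 by blast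
  show "0 < density_max"
    unfolding density_max_def using pos Max_in[OF fin] 1 by blast
  assume "c \<in> A" "z \<in> snd c ` fst c"
  then have "kabs (\<omega> c z) \<in> densities"
    by (auto simp: densities_def)
  then show "density_min \<le> kabs (\<omega> c z)" "kabs (\<omega> c z) \<le> density_max"
    unfolding density_min_def density_max_def using fin by auto
qed

lemma homogeneous:
  assumes "c \<in> A" "homogeneous_scale \<le> l" "z \<in> snd c ` fst c" "w \<in> pball l z"
  shows "d \<in> A \<Longrightarrow> w \<in> overlap c d \<longleftrightarrow> z \<in> overlap c d" "kabs (\<omega> c w) = kabs (\<omega> c z)"
proof -
  obtain m where m: "\<And>c l z w. c \<in> A \<Longrightarrow> m c \<le> l \<Longrightarrow> z \<in> snd c ` fst c \<Longrightarrow> w \<in> pball l z \<Longrightarrow>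
      (\<forall>d\<in>A. w \<in> overlap c d \<longleftrightarrow> z \<in> overlap c d) \<and> kabs (\<omega> c w) = kabs (\<omega> c z)"
    using chart_data_uniform(1) by metis
  have "m c \<le> Max (m ` A)" if "c \<in> A" for c
    using finite_atlas that by simp
  then have "\<forall>c\<in>A. \<forall>l z w. Max (m ` A) \<le> l \<longrightarrow> z \<in> snd c ` fst c \<longrightarrow> w \<in> pball l z \<longrightarrow>
      (\<forall>d\<in>A. w \<in> overlap c d \<longleftrightarrow> z \<in> overlap c d) \<and> kabs (\<omega> c w) = kabs (\<omega> c z)"
    using m order_trans by meson
  then have "\<forall>c\<in>A. \<forall>l z w. homogeneous_scale \<le> l \<longrightarrow> z \<in> snd c ` fst c \<longrightarrow> w \<in> pball l z \<longrightarrow>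
      (\<forall>d\<in>A. w \<in> overlap c d \<longleftrightarrow> z \<in> overlap c d) \<and> kabs (\<omega> c w) = kabs (\<omega> c z)"
    unfolding homogeneous_scale_def by (rule someI)
  then show "d \<in> A \<Longrightarrow> w \<in> overlap c d \<longleftrightarrow> z \<in> overlap c d" "kabs (\<omega> c w) = kabs (\<omega> c z)"
    using assms by blast+
qed


section \<open>The measure of balls on the manifold\<close>

lemma sets_\<mu> [measurable_cong, simp]: "sets \<mu> = sets borel"
  using form_measure by (simp add: form_measure_def)

lemma space_\<mu> [simp]: "space \<mu> = UNIV"
  using sets_eq_imp_space_eq[OF sets_\<mu>] by simp

lemma emeasure_chart:
  "c \<in> A \<Longrightarrow> E \<in> sets borel \<Longrightarrow> E \<subseteq> fst c \<Longrightarrow>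
    emeasure \<mu> E = (\<integral>\<^sup>+ z\<in>snd c ` E. ennreal (kabs (\<omega> c z)) \<partial>H)"
  using form_measure by (simp add: form_measure_def)

lemma emeasure_const_density:
  assumes "c \<in> A" "E \<in> sets borel" "E \<subseteq> fst c" "\<And>x. x \<in> E \<Longrightarrow> kabs (\<omega> c (snd c x)) = w"
  shows "emeasure \<mu> E = ennreal w * emeasure H (snd c ` E)"
proof -
  have "emeasure \<mu> E = (\<integral>\<^sup>+ z. ennreal w * indicator (snd c ` E) z \<partial>H)"
    unfolding emeasure_chart[OF assms(1-3)] using assms(4)
    by (intro nn_integral_cong) (auto split: split_indicator)
  also have "\<dots> = ennreal w * emeasure H (snd c ` E)"
    using chart_image_borel[OF assms(1,3,2)] by (intro nn_integral_cmult_indicator) simp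
  finally show ?thesis .
qed

lemma emeasure_chart_bounds:
  assumes "c \<in> A" "E \<in> sets borel" "E \<subseteq> fst c"
  shows "ennreal density_min * emeasure H (snd c ` E) \<le> emeasure \<mu> E"
    and "emeasure \<mu> E \<le> ennreal density_max * emeasure H (snd c ` E)"
proof -
  have E: "snd c ` E \<in> sets H"
    using chart_image_borel[OF assms(1,3,2)] by simp
  have sub: "snd c ` E \<subseteq> snd c ` fst c"
    using assms(3) by blast
  have "ennreal density_min * emeasure H (snd c ` E) =
      (\<integral>\<^sup>+ z. ennreal density_min * indicator (snd c ` E) z \<partial>H)"
    by (rule nn_integral_cmult_indicator[OF E, symmetric])
  also have "\<dots> \<le> emeasure \<mu> E"
    unfolding emeasure_chart[OF assms] using density_bounds(3)[OF assms(1)] sub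
    by (intro nn_integral_mono) (auto intro!: ennreal_leI split: split_indicator)
  finally show "ennreal density_min * emeasure H (snd c ` E) \<le> emeasure \<mu> E" .
  have "emeasure \<mu> E \<le> (\<integral>\<^sup>+ z. ennreal density_max * indicator (snd c ` E) z \<partial>H)"
    unfolding emeasure_chart[OF assms] using density_bounds(4)[OF assms(1)] sub
    by (intro nn_integral_mono) (auto intro!: ennreal_leI split: split_indicator)
  also have "\<dots> = ennreal density_max * emeasure H (snd c ` E)"
    by (rule nn_integral_cmult_indicator[OF E])
  finally show "emeasure \<mu> E \<le> ennreal density_max * emeasure H (snd c ` E)" .
qed

lemma finite_measure_\<mu>: "finite_measure \<mu>"
proof (rule finite_measureI)
  have "emeasure \<mu> (fst c) < \<infinity>" if c: "c \<in> A" for c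
  proof -
    have "emeasure \<mu> (fst c) \<le> ennreal density_max * emeasure H (snd c ` fst c)"
      using borel_open[OF chart_open(1)[OF c]] by (intro emeasure_chart_bounds c order_refl)
    also have "\<dots> < \<infinity>"
      using emeasure_compact_finite[OF chart_image_compact[OF c]] by (simp add: ennreal_mult_less_top)
    finally show ?thesis .
  qed
  then have "(\<Sum>c\<in>A. emeasure \<mu> (fst c)) < \<infinity>"
    using finite_atlas by (simp add: ennreal_sum_less_top)
  moreover have "emeasure \<mu> (\<Union>c\<in>A. fst c) \<le> (\<Sum>c\<in>A. emeasure \<mu> (fst c))"
    using finite_atlas borel_open[OF chart_open(1)] by (intro emeasure_subadditive_finite) force+
  moreover have "(\<Union>c\<in>A. fst c) = space \<mu>"
    unfolding space_\<mu> using chart_cover by blast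
  ultimately show "emeasure \<mu> (space \<mu>) \<noteq> \<infinity>"
    by auto
qed

sublocale finite_measure \<mu>
  by (rule finite_measure_\<mu>)

lemma mball_chart: "mball A B \<Longrightarrow> \<exists>c\<in>A. B \<subseteq> fst c"
  by (simp add: mball_def)

lemma mball_image:
  assumes "mball A B" "c \<in> A" "B \<subseteq> fst c"
  obtains m a where "snd c ` B = pball m a"
proof -
  have "\<forall>c\<in>A. B \<subseteq> fst c \<longrightarrow> (\<exists>a r. r > 0 \<and> snd c ` B = kball a r)"
    using assms(1) unfolding mball_def by (elim conjE)
  then obtain a r where r: "r > 0" "snd c ` B = kball a r"
    using assms(2,3) by meson
  obtain m where "kball a r = pball m a"
    using kball_eq_pball[OF r(1)] by blast
  then show thesis
    using r(2) that by simp
qed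

lemma eq_vimage_of_image:
  assumes "c \<in> A" "B \<subseteq> fst c" "snd c ` B = T"
  shows "B = {x \<in> fst c. snd c x \<in> T}"
  using assms inj_on_image_mem_iff[OF chart_inj[OF assms(1)]] by blast

lemma mball_open:
  assumes "mball A B"
  shows "open B"
proof -
  obtain c where c: "c \<in> A" "B \<subseteq> fst c"
    using mball_chart[OF assms] by blast
  obtain m a where "snd c ` B = pball m a"
    using mball_image[OF assms c] by blast
  then have "B = {x \<in> fst c. snd c x \<in> pball m a}"
    by (rule eq_vimage_of_image[OF c])
  then show ?thesis
    using chart_vimage_open[OF c(1) open_pball] by metis
qed

lemma mball_borel [simp]: "mball A B \<Longrightarrow> B \<in> sets borel"
  using mball_open borel_open by blast

lemma measure_ball_bounds:
  assumes "mball A B" "c \<in> A" "B \<subseteq> fst c" "snd c ` B = pball m a"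
  shows "density_min * vol m \<le> measure \<mu> B" "measure \<mu> B \<le> density_max * vol m"
  using emeasure_chart_bounds[OF assms(2) mball_borel[OF assms(1)] assms(3)] density_bounds(1,2)
  by (simp_all add: assms(4) emeasure_pball_vol emeasure_eq_measure ennreal_mult'[symmetric]
      less_imp_le)

lemma mball_measure_pos:
  assumes "mball A B"
  shows "0 < measure \<mu> B"
proof -
  obtain c where c: "c \<in> A" "B \<subseteq> fst c"
    using mball_chart[OF assms] by blast
  obtain m a where m: "snd c ` B = pball m a"
    using mball_image[OF assms c] by blast
  have "0 < density_min * vol m"
    using density_bounds(1) by simp
  then show ?thesis
    using measure_ball_bounds(1)[OF assms c m] by linarith
qed

lemma mball_nonempty: "mball A B \<Longrightarrow> B \<noteq> {}"
  using mball_measure_pos by fastforce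

text \<open>
  The two properties on which the eigenfunction argument rests: the first makes the ball comparable
  with every other ball of the manifold, the second turns \<open>\<mu>\<close> on the ball into a multiple of Haar
  measure. Balls of small measure have both.
\<close>

definition fine_ball :: "'x set \<Rightarrow> bool" where
  "fine_ball B \<longleftrightarrow> mball A B \<and> (\<forall>d\<in>A. B \<inter> fst d \<noteq> {} \<longrightarrow> B \<subseteq> fst d) \<and>
     (\<forall>c\<in>A. B \<subseteq> fst c \<longrightarrow> (\<forall>x\<in>B. \<forall>y\<in>B. kabs (\<omega> c (snd c x)) = kabs (\<omega> c (snd c y))))"

text \<open>
  A ball of radius larger than the homogeneous scale has at least twice this measure, because the
  volume at least doubles with each step of the radius.
\<close>

definition fine_measure :: real where
  "fine_measure = density_min * vol homogeneous_scale"

lemma fine_measure_pos: "0 < fine_measure"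
  using density_bounds(1) by (simp add: fine_measure_def)

text \<open>The measure of a ball controls its radius in every chart that contains it.\<close>

lemma fine_if_small:
  assumes B: "mball A B" and small: "measure \<mu> B \<le> fine_measure"
  shows "fine_ball B"
proof -
  have scale: "homogeneous_scale \<le> m"
    if "c \<in> A" "B \<subseteq> fst c" "snd c ` B = pball m a" for c m a
  proof (rule ccontr)
    assume "\<not> homogeneous_scale \<le> m"
    then have "2 * vol homogeneous_scale \<le> vol m"
      using vol_antimono[of "m + 1" homogeneous_scale] vol_half[of m] by linarith
    then have "2 * fine_measure \<le> density_min * vol m"
      using density_bounds(1) by (simp add: fine_measure_def)
    also have "\<dots> \<le> measure \<mu> B"
      by (rule measure_ball_bounds(1)[OF B that])
    finally show False
      using small fine_measure_pos by linarith
  qed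
  obtain c where c: "c \<in> A" "B \<subseteq> fst c"
    using mball_chart[OF B] by blast
  obtain m a where m: "snd c ` B = pball m a"
    using mball_image[OF B c] by blast
  have "B \<subseteq> fst d" if d: "d \<in> A" and x: "x \<in> B" "x \<in> fst d" for d x
  proof
    fix y assume y: "y \<in> B"
    have "snd c ` B = pball m (snd c x)"
      using m x pball_recentre[of "snd c x" m a] by blast
    then have "snd c y \<in> pball m (snd c x)"
      using y by blast
    moreover have "snd c x \<in> overlap c d"
      using x c by (auto simp: overlap_def)
    ultimately have "snd c y \<in> overlap c d"
      using homogeneous(1)[OF c(1) scale[OF c m], of "snd c x" "snd c y" d] x c d by auto
    then show "y \<in> fst d"
      using y c chart_inj[OF c(1)] by (auto simp: overlap_def inj_on_def)
  qed
  moreover have "kabs (\<omega> d (snd d x)) = kabs (\<omega> d (snd d y))"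
    if d: "d \<in> A" "B \<subseteq> fst d" and xy: "x \<in> B" "y \<in> B" for d x y
  proof -
    obtain l b where l: "snd d ` B = pball l b"
      using mball_image[OF B d] by blast
    have "snd d x \<in> pball l b" "snd d y \<in> pball l b"
      using l xy by blast+
    then have "snd d x \<in> pball l (snd d y)"
      using pball_recentre by blast
    then show ?thesis
      using homogeneous(2)[OF d(1) scale[OF d l], of "snd d y" "snd d x"] xy d by auto
  qed
  ultimately show ?thesis
    unfolding fine_ball_def using B by blast
qed

lemma fine_mball: "fine_ball B \<Longrightarrow> mball A B"
  by (simp add: fine_ball_def)

lemma fine_subset_chart: "fine_ball B \<Longrightarrow> d \<in> A \<Longrightarrow> x \<in> B \<Longrightarrow> x \<in> fst d \<Longrightarrow> B \<subseteq> fst d"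
  unfolding fine_ball_def by blast

lemma nested_in_chart:
  assumes "mball A B" "mball A D" "c \<in> A" "B \<subseteq> fst c" "D \<subseteq> fst c"
  shows "B \<inter> D = {} \<or> B \<subseteq> D \<or> D \<subseteq> B"
proof -
  obtain m a where "snd c ` B = pball m a"
    using mball_image[OF assms(1,3,4)] by blast
  then have B: "B = {x \<in> fst c. snd c x \<in> pball m a}"
    by (rule eq_vimage_of_image[OF assms(3,4)])
  obtain l b where "snd c ` D = pball l b"
    using mball_image[OF assms(2,3,5)] by blast
  then have D: "D = {x \<in> fst c. snd c x \<in> pball l b}"
    by (rule eq_vimage_of_image[OF assms(3,5)])
  show ?thesis
    unfolding B D using pball_disjoint_or_nested[of m a l b] by blast
qed

text \<open>A chart containing any ball \<open>D\<close> that meets the fine ball \<open>B\<close> contains \<open>B\<close> as well, so the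
  two can be compared inside one chart.\<close>

lemma fine_nested:
  assumes "fine_ball B" "mball A D"
  shows "B \<inter> D = {} \<or> B \<subseteq> D \<or> D \<subseteq> B"
proof (cases "B \<inter> D = {}")
  case False
  then obtain x where x: "x \<in> B" "x \<in> D" by blast
  obtain c where c: "c \<in> A" "D \<subseteq> fst c"
    using mball_chart[OF assms(2)] by blast
  have "B \<subseteq> fst c"
    using fine_subset_chart[OF assms(1) c(1) x(1)] x c by blast
  then show ?thesis
    using nested_in_chart[OF fine_mball[OF assms(1)] assms(2)] c by blast
qed simp


section \<open>The geodetic distance from a fine ball\<close>

text \<open>
  The distance sees a point only through the balls and the charts containing it: the former
  determine the join, the latter the simplex at which the paths in the nerve end.
\<close>

lemma geo_dist_cong_right:
  assumes "\<And>D. mball A D \<Longrightarrow> x \<in> D \<Longrightarrow> y \<in> D \<longleftrightarrow> y' \<in> D"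
    and "\<And>c. c \<in> A \<Longrightarrow> y \<in> fst c \<longleftrightarrow> y' \<in> fst c"
  shows "geo_dist A \<mu> x y = geo_dist A \<mu> x y'"
proof -
  have "has_join A x y = has_join A x y'" "mjoin A x y = mjoin A x y'"
    unfolding has_join_def mjoin_def using assms(1) by (metis, intro arg_cong[where f = Inter]) blast
  moreover have "(\<lambda>J. J \<in> nerve A \<and> y \<in> simplex_set J) = (\<lambda>J. J \<in> nerve A \<and> y' \<in> simplex_set J)"
    using assms(2) by (auto simp: fun_eq_iff nerve_def simplex_set_def)
  then have "top_simplex A y = top_simplex A y'"
    by (simp add: top_simplex_def)
  ultimately show ?thesis
    by (simp add: geo_dist_def)
qed

lemma geo_dist_cong_left:
  assumes "\<And>D. mball A D \<Longrightarrow> y \<in> D \<Longrightarrow> x \<in> D \<longleftrightarrow> x' \<in> D"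
    and "\<And>c. c \<in> A \<Longrightarrow> x \<in> fst c \<longleftrightarrow> x' \<in> fst c"
  shows "geo_dist A \<mu> x y = geo_dist A \<mu> x' y"
proof -
  have "has_join A x y = has_join A x' y" "mjoin A x y = mjoin A x' y"
    unfolding has_join_def mjoin_def using assms(1) by (metis, intro arg_cong[where f = Inter]) blast
  moreover have "(\<lambda>J. J \<in> nerve A \<and> x \<in> simplex_set J) = (\<lambda>J. J \<in> nerve A \<and> x' \<in> simplex_set J)"
    using assms(2) by (auto simp: fun_eq_iff nerve_def simplex_set_def)
  then have "top_simplex A x = top_simplex A x'"
    by (simp add: top_simplex_def)
  ultimately show ?thesis
    by (simp add: geo_dist_def)
qed

lemma fine_contained:
  assumes "fine_ball B" "x \<in> B" "y \<notin> B" "mball A D" "x \<in> D" "y \<in> D"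
  shows "B \<subseteq> D"
  using fine_nested[OF assms(1,4)] assms by blast

lemma geo_dist_from_fine:
  assumes "fine_ball B" "x \<in> B" "x' \<in> B" "y \<notin> B"
  shows "geo_dist A \<mu> x y = geo_dist A \<mu> x' y"
proof (rule geo_dist_cong_left)
  show "x \<in> D \<longleftrightarrow> x' \<in> D" if "mball A D" "y \<in> D" for D
    using fine_contained[OF assms(1,2,4) that(1)] fine_contained[OF assms(1,3,4) that(1)] assms that
    by blast
  show "x \<in> fst c \<longleftrightarrow> x' \<in> fst c" if "c \<in> A" for c
    using fine_subset_chart[OF assms(1) that] assms by blast
qed

lemma geo_dist_to_fine:
  assumes "fine_ball B" "x \<in> B" "x' \<in> B" "y \<notin> B"
  shows "geo_dist A \<mu> y x = geo_dist A \<mu> y x'"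
proof (rule geo_dist_cong_right)
  show "x \<in> D \<longleftrightarrow> x' \<in> D" if "mball A D" "y \<in> D" for D
    using fine_contained[OF assms(1,2,4) that(1)] fine_contained[OF assms(1,3,4) that(1)] assms that
    by blast
  show "x \<in> fst c \<longleftrightarrow> x' \<in> fst c" if "c \<in> A" for c
    using fine_subset_chart[OF assms(1) that] assms by blast
qed

text \<open>
  In each of the finitely many charts a larger ball is determined by its radius, whose exponent is
  confined by the measures of the given ball and of the manifold.
\<close>

lemma finite_larger_balls:
  assumes B: "mball A B"
  shows "finite {D. mball A D \<and> B \<subseteq> D}"
proof -
  obtain x where x: "x \<in> B"
    using mball_nonempty[OF B] by blast
  define L where "L = {m. measure \<mu> B / density_max \<le> vol m \<and> vol m \<le> measure \<mu> UNIV / density_min}"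
  have "finite L"
    unfolding L_def using mball_measure_pos[OF B] density_bounds(2)
    by (intro finite_vol_levels) simp
  then have "finite ((\<lambda>(c, m). {y \<in> fst c. snd c y \<in> pball m (snd c x)}) ` (A \<times> L))"
    using finite_atlas by blast
  moreover have "D \<in> (\<lambda>(c, m). {y \<in> fst c. snd c y \<in> pball m (snd c x)}) ` (A \<times> L)"
    if D: "mball A D" "B \<subseteq> D" for D
  proof -
    obtain c where c: "c \<in> A" "D \<subseteq> fst c"
      using mball_chart[OF D(1)] by blast
    obtain m a where m: "snd c ` D = pball m a"
      using mball_image[OF D(1) c] by blast
    moreover have "snd c x \<in> pball m a"
      using m x D(2) by blast
    ultimately have m': "snd c ` D = pball m (snd c x)"
      using pball_recentre by metis
    have "measure \<mu> B \<le> measure \<mu> D" "measure \<mu> D \<le> measure \<mu> UNIV"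
      using D B by (auto intro!: finite_measure_mono)
    then have "m \<in> L"
      using measure_ball_bounds[OF D(1) c m] density_bounds(1,2)
      by (simp add: L_def field_simps)
    then show ?thesis
      using eq_vimage_of_image[OF c m'] c(1) by (intro image_eqI[of _ _ "(c, m)"]) auto
  qed
  ultimately show ?thesis
    by (metis (no_types, lifting) finite_subset mem_Collect_eq subsetI)
qed

text \<open>
  Seen from a fine ball \<open>B\<close>, the distance to a point outside depends only on which balls around
  \<open>B\<close> and which charts contain the point; hence it takes finitely many values.
\<close>

lemma geo_dist_outside_simple:
  assumes B: "fine_ball B" and x: "x \<in> B"
  shows "simple_function \<mu> (\<lambda>y. indicator (- B) y * geo_dist A \<mu> x y powr (- s))"
proof (rule simple_function_of_membership)
  let ?F = "insert B (fst ` A) \<union> {D. mball A D \<and> B \<subseteq> D}"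
  show "finite ?F"
    using finite_atlas finite_larger_balls[OF fine_mball[OF B]] by simp
  show "?F \<subseteq> sets \<mu>"
    using fine_mball[OF B] borel_open[OF chart_open(1)] by force
  fix y y' assume same: "\<And>F. F \<in> ?F \<Longrightarrow> y \<in> F \<longleftrightarrow> y' \<in> F"
  have B_iff: "y \<in> B \<longleftrightarrow> y' \<in> B"
    by (rule same) simp
  show "indicator (- B) y * geo_dist A \<mu> x y powr (- s) =
      indicator (- B) y' * geo_dist A \<mu> x y' powr (- s)"
  proof (cases "y \<in> B")
    case False
    have "geo_dist A \<mu> x y = geo_dist A \<mu> x y'"
    proof (rule geo_dist_cong_right)
      show "y \<in> D \<longleftrightarrow> y' \<in> D" if D: "mball A D" "x \<in> D" for D
      proof (cases "B \<subseteq> D")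
        case True
        then show ?thesis
          using D by (intro same) blast
      next
        case False
        then have "D \<subseteq> B"
          using fine_nested[OF B D(1)] x D by blast
        then show ?thesis
          using \<open>y \<notin> B\<close> B_iff by blast
      qed
      show "y \<in> fst c \<longleftrightarrow> y' \<in> fst c" if "c \<in> A" for c
        using that by (intro same) blast
    qed
    then show ?thesis
      using B_iff by (simp add: indicator_def)
  qed (use B_iff in simp)
qed

lemma geo_dist_outside_integrable:
  assumes "fine_ball B" "x \<in> B"
  shows "integrable \<mu> (\<lambda>y. indicator (- B) y * geo_dist A \<mu> x y powr (- s))"
proof -
  note simple = geo_dist_outside_simple[OF assms]
  let ?h = "\<lambda>y. indicator (- B) y * geo_dist A \<mu> x y powr (- s)"
  have "finite (?h ` UNIV)"
    using simple by (simp add: simple_function_def)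
  then obtain b where "\<And>y. norm (?h y) \<le> b"
    using finite_imp_bounded[of "range ?h"] unfolding bounded_iff by blast
  then show ?thesis
    using borel_measurable_simple_function[OF simple] by (intro integrable_const_bound[of _ b]) auto
qed

end


lemma (in uniformised) continuous_translate:
  fixes t :: "'k ^ 'n::finite"
  shows "continuous_on S (\<lambda>z. z + t)"
proof -
  have "open ((\<lambda>z. z + t) -` T \<inter> UNIV)" if T: "open T" for T
  proof (subst open_subopen, intro ballI)
    fix z assume "z \<in> (\<lambda>z. z + t) -` T \<inter> UNIV"
    then obtain l where l: "pball l (z + t) \<subseteq> T"
      using pball_basis[OF T, of "z + t"] by auto
    have "pball l z \<subseteq> (\<lambda>z. z + t) -` T \<inter> UNIV"
    proof
      fix w assume "w \<in> pball l z"
      then have "w + t \<in> pball l (z + t)"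
        by (simp add: pball_def)
      then show "w \<in> (\<lambda>z. z + t) -` T \<inter> UNIV"
        using l by blast
    qed
    then show "\<exists>V. open V \<and> z \<in> V \<and> V \<subseteq> (\<lambda>z. z + t) -` T \<inter> UNIV"
      by (intro exI[of _ "pball l z"]) simp
  qed
  then have "continuous_on UNIV (\<lambda>z. z + t)"
    using continuous_on_open_vimage[OF open_UNIV] by blast
  then show ?thesis
    by (rule continuous_on_subset) simp
qed

context wavelet_manifold
begin

section \<open>Wavelets\<close>

lemma character_add: "\<xi> (x + y) = \<xi> x * \<xi> y"
  using character by (simp add: additive_character_def)

lemma character_norm [simp]: "cmod (\<xi> x) = 1"
  using character by (simp add: additive_character_def)

lemma character_integer: "kabs x \<le> 1 \<Longrightarrow> \<xi> x = 1"
  using character by (simp add: additive_character_def OK_def)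

lemma character_nontrivial: "\<exists>x. kabs x \<le> 1 \<and> \<xi> (inverse \<pi> * x) \<noteq> 1"
  using character by (auto simp: additive_character_def OK_def)

lemma character_eq: "kabs (x - y) \<le> 1 \<Longrightarrow> \<xi> x = \<xi> y"
  using character_add[of "x - y" y] character_integer[of "x - y"] by simp

definition pairing :: "'k ^ 'n \<Rightarrow> 'k ^ 'n \<Rightarrow> 'k" where
  "pairing \<eta> z = (\<Sum>i\<in>UNIV. \<eta> $ i * z $ i)"

lemma pairing_add: "pairing \<eta> (z + w) = pairing \<eta> z + pairing \<eta> w"
  by (simp add: pairing_def sum.distrib distrib_left)

lemma pairing_axis: "pairing \<eta> (axis i a) = \<eta> $ i * a"
  by (simp add: pairing_def axis_def if_distrib cong: if_cong)

lemma kabs_pairing_diff_le: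
  assumes "\<And>i. kabs (\<eta> $ i - \<eta>' $ i) \<le> r" "\<And>i. kabs (z $ i) \<le> r'"
  shows "kabs (pairing \<eta> z - pairing \<eta>' z) \<le> r * r'"
proof -
  have nonneg: "0 \<le> r" "0 \<le> r'"
    using order_trans[OF kabs_nonneg assms(1)] order_trans[OF kabs_nonneg assms(2)] by auto
  then have "kabs (\<eta> $ i * z $ i - \<eta>' $ i * z $ i) \<le> r * r'" for i
    unfolding left_diff_distrib[symmetric] kabs_mult using assms by (intro mult_mono) auto
  moreover have "0 \<le> r * r'"
    using nonneg by simp
  ultimately show ?thesis
    unfolding pairing_def sum_subtractf[symmetric] by (intro kabs_sum_leI)
qed

text \<open>
  A Kozyrev wavelet in chart coordinates. Some coordinate of \<open>\<eta>\<close> having absolute value 1 is the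
  condition that \<open>\<eta>\<close> is non-zero modulo \<open>\<pi>\<close>.
\<close>

definition wave_form ::
    "('x, 'k, 'n) chart \<Rightarrow> 'x set \<Rightarrow> ('x \<Rightarrow> complex) \<Rightarrow> int \<Rightarrow> 'k ^ 'n \<Rightarrow> complex \<Rightarrow> bool" where
  "wave_form c B \<psi> m \<eta> C \<longleftrightarrow> (\<exists>b. snd c ` B = pball m b) \<and>
     (\<forall>i. kabs (\<eta> $ i) \<le> 1) \<and> (\<exists>i. kabs (\<eta> $ i) = 1) \<and>
     (\<forall>x\<in>B. \<psi> x = C * \<xi> (\<pi> powi (- m - 1) * pairing \<eta> (snd c x)))"

lemma wavelet_on_form:
  assumes "wavelet_on A \<pi> \<xi> B \<psi>" "c \<in> A" "B \<subseteq> fst c"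
  obtains m \<eta> C where "wave_form c B \<psi> m \<eta> C"
proof -
  have "\<forall>c\<in>A. B \<subseteq> fst c \<longrightarrow> kozyrev_wavelet \<pi> \<xi> (snd c ` B)
          (\<lambda>z. if z \<in> snd c ` fst c then \<psi> (chart_inv c z) else 0)"
    using assms(1) unfolding wavelet_on_def by (elim conjE)
  then have "kozyrev_wavelet \<pi> \<xi> (snd c ` B)
          (\<lambda>z. if z \<in> snd c ` fst c then \<psi> (chart_inv c z) else 0)"
    using assms by blast
  then obtain b m \<eta> C where S: "snd c ` B = (\<lambda>w. b + (\<pi> powi m) *s w) ` OKn"
    and \<eta>: "\<eta> \<in> OKn" "\<not> (\<forall>i. \<eta> $ i \<in> (\<lambda>a. \<pi> * a) ` OK)"
    and eq: "(\<lambda>z. if z \<in> snd c ` fst c then \<psi> (chart_inv c z) else 0) =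
      (\<lambda>z. C * \<xi> (\<pi> powi (- m - 1) * (\<Sum>i\<in>UNIV. \<eta> $ i * z $ i)) * indicator (snd c ` B) z)"
    unfolding kozyrev_wavelet_def by blast
  have le: "\<forall>i. kabs (\<eta> $ i) \<le> 1"
    using \<eta>(1) by (simp add: OKn_def OK_def)
  obtain i where "\<not> kabs (\<eta> $ i) \<le> kabs \<pi>"
    using \<eta>(2) by (auto simp only: in_pi_OK_iff)
  then have "kabs (\<eta> $ i) = 1"
    using le kabs_less_1_iff[of "\<eta> $ i"] by (meson less_eq_real_def)
  moreover have "\<psi> x = C * \<xi> (\<pi> powi (- m - 1) * pairing \<eta> (snd c x))" if "x \<in> B" for x
    using fun_cong[OF eq, of "snd c x"] that assms chart_inv_left[OF assms(2), of x]
    by (auto simp: pairing_def)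
  ultimately have "wave_form c B \<psi> m \<eta> C"
    using le S unfolding wave_form_def kozyrev_set_eq_pball by blast
  then show thesis
    by (rule that)
qed

lemma wavelet_supp:
  assumes "\<psi> \<in> wavelets A \<mu> \<pi> \<xi>"
  shows "wavelet_on A \<pi> \<xi> (supp \<psi>) \<psi>"
proof -
  obtain B where B: "wavelet_on A \<pi> \<xi> B \<psi>" and norm: "l2_inner \<mu> \<psi> \<psi> = 1"
    using assms by (auto simp: wavelets_def)
  have mball: "mball A B" and zero: "\<And>x. x \<notin> B \<Longrightarrow> \<psi> x = 0"
    using B by (auto simp: wavelet_on_def)
  obtain c where c: "c \<in> A" "B \<subseteq> fst c"
    using mball_chart[OF mball] by blast
  obtain m \<eta> C where form: "wave_form c B \<psi> m \<eta> C"
    using wavelet_on_form[OF B c] by blast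
  have "C \<noteq> 0"
  proof
    assume "C = 0"
    then have "\<psi> x = 0" for x
      using form zero by (cases "x \<in> B") (auto simp: wave_form_def)
    then show False
      using norm by (simp add: l2_inner_def)
  qed
  moreover have "\<xi> x \<noteq> 0" for x
    using character_norm[of x] by fastforce
  ultimately have "supp \<psi> = B"
    using form zero by (auto simp: supp_def wave_form_def)
  then show ?thesis
    using B by simp
qed

lemma wavelet_mball: "\<psi> \<in> wavelets A \<mu> \<pi> \<xi> \<Longrightarrow> mball A (supp \<psi>)"
  using wavelet_supp by (auto simp: wavelet_on_def)

lemma wavelet_form:
  assumes "\<psi> \<in> wavelets A \<mu> \<pi> \<xi>" "c \<in> A" "supp \<psi> \<subseteq> fst c"
  obtains m \<eta> C where "wave_form c (supp \<psi>) \<psi> m \<eta> C"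
  using wavelet_on_form[OF wavelet_supp[OF assms(1)] assms(2,3)] by blast

lemma wave_form_image:
  assumes "wave_form c B \<psi> m \<eta> C" "x \<in> B"
  shows "snd c ` B = pball m (snd c x)"
proof -
  obtain b where b: "snd c ` B = pball m b"
    using assms by (auto simp: wave_form_def)
  then show ?thesis
    using assms(2) pball_recentre[of "snd c x" m b] by blast
qed

text \<open>
  Moving within a ball of the next smaller radius changes the argument of the character by an
  element of the ring of integers.
\<close>

lemma wave_form_const:
  assumes form: "wave_form c B \<psi> m \<eta> C" and "x \<in> B" "y \<in> B" "snd c y \<in> pball (m + 1) (snd c x)"
  shows "\<psi> x = \<psi> y"
proof -
  let ?u = "\<pi> powi (- m - 1)"
  define d where "d = snd c y - snd c x"
  have d: "kabs (d $ i) \<le> kabs \<pi> powi (m + 1)" for i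
    using assms(4) by (simp add: d_def pball_def)
  have "pairing \<eta> (snd c y) = pairing \<eta> (snd c x) + pairing \<eta> d"
    by (simp add: d_def pairing_add[symmetric])
  then have "kabs (?u * pairing \<eta> (snd c y) - ?u * pairing \<eta> (snd c x)) = kabs ?u * kabs (pairing \<eta> d)"
    by (simp add: kabs_mult[symmetric] algebra_simps)
  also have "kabs (pairing \<eta> d) \<le> 1 * kabs \<pi> powi (m + 1)"
    using kabs_pairing_diff_le[of \<eta> 0 1 d, OF _ d] form by (simp add: wave_form_def pairing_def)
  also have "kabs ?u * (1 * kabs \<pi> powi (m + 1)) = 1"
  proof -
    have "kabs \<pi> powi (- m - 1) * kabs \<pi> powi (m + 1) = kabs \<pi> powi ((- m - 1) + (m + 1))"
      by (intro power_int_add[symmetric]) auto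
    then show ?thesis
      by (simp add: kabs_power_int)
  qed
  finally have "\<xi> (?u * pairing \<eta> (snd c y)) = \<xi> (?u * pairing \<eta> (snd c x))"
    by (intro character_eq) (simp add: mult_left_mono)
  then show ?thesis
    using form assms by (simp add: wave_form_def)
qed

lemma wavelet_measurable:
  assumes "\<psi> \<in> wavelets A \<mu> \<pi> \<xi>"
  shows "\<psi> \<in> borel_measurable borel"
proof -
  let ?B = "supp \<psi>"
  have B: "mball A ?B"
    by (rule wavelet_mball[OF assms])
  obtain c where c: "c \<in> A" "?B \<subseteq> fst c"
    using mball_chart[OF B] by blast
  obtain m \<eta> C where form: "wave_form c ?B \<psi> m \<eta> C"
    using wavelet_form[OF assms c] by blast
  have "open (\<psi> -` T \<inter> ?B)" for T
  proof (subst open_subopen, intro ballI)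
    fix x assume x: "x \<in> \<psi> -` T \<inter> ?B"
    let ?V = "?B \<inter> {y \<in> fst c. snd c y \<in> pball (m + 1) (snd c x)}"
    have "open ?V"
      using mball_open[OF B] chart_vimage_open[OF c(1) open_pball] by (intro open_Int)
    moreover have "x \<in> ?V"
      using x c by auto
    moreover have "\<psi> y = \<psi> x" if "y \<in> ?V" for y
      using wave_form_const[OF form, of x y] that x by simp
    then have "?V \<subseteq> \<psi> -` T \<inter> ?B"
      using x by auto
    ultimately show "\<exists>V. open V \<and> x \<in> V \<and> V \<subseteq> \<psi> -` T \<inter> ?B"
      by blast
  qed
  then have "continuous_on ?B \<psi>"
    using continuous_on_open_vimage[OF mball_open[OF B]] by blast
  then have "(\<lambda>x. if x \<in> ?B then \<psi> x else 0) \<in> borel_measurable borel"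
    using mball_borel[OF B] by (intro borel_measurable_continuous_on_if) auto
  moreover have "(\<lambda>x. if x \<in> ?B then \<psi> x else 0) = \<psi>"
    by (auto simp: supp_def)
  ultimately show ?thesis
    by simp
qed

lemma wavelet_cnj_measurable:
  "\<psi> \<in> wavelets A \<mu> \<pi> \<xi> \<Longrightarrow> (\<lambda>x. cnj (\<psi> x)) \<in> borel_measurable borel"
  by (rule measurable_compose[OF wavelet_measurable borel_measurable_continuous_onI])
    (auto intro: continuous_intros)

lemma borel_measurable_\<mu> [simp]: "borel_measurable \<mu> = borel_measurable borel"
  by (intro measurable_cong_sets) auto

text \<open>The character has absolute value 1, so the normalisation fixes the absolute value on the support.\<close>

lemma wavelet_norm:
  assumes "\<psi> \<in> wavelets A \<mu> \<pi> \<xi>"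
  shows "(cmod (\<psi> x))\<^sup>2 = indicator (supp \<psi>) x / measure \<mu> (supp \<psi>)"
proof -
  let ?B = "supp \<psi>"
  have B: "mball A ?B"
    by (rule wavelet_mball[OF assms])
  obtain c where c: "c \<in> A" "?B \<subseteq> fst c"
    using mball_chart[OF B] by blast
  obtain m \<eta> C where form: "wave_form c ?B \<psi> m \<eta> C"
    using wavelet_form[OF assms c] by blast
  have sq: "(cmod (\<psi> x))\<^sup>2 = (cmod C)\<^sup>2 * indicator ?B x" for x
    using form by (cases "x \<in> ?B") (auto simp: wave_form_def norm_mult supp_def)
  have "l2_inner \<mu> \<psi> \<psi> = (LINT x|\<mu>. complex_of_real ((cmod C)\<^sup>2 * indicator ?B x))"
    unfolding l2_inner_def sq[symmetric] complex_norm_square ..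
  also have "\<dots> = complex_of_real ((cmod C)\<^sup>2 * measure \<mu> ?B)"
    by simp
  finally have "complex_of_real ((cmod C)\<^sup>2 * measure \<mu> ?B) = 1"
    using assms by (simp add: wavelets_def)
  then have "(cmod C)\<^sup>2 * measure \<mu> ?B = 1"
    using of_real_eq_1_iff by blast
  then show ?thesis
    using sq[of x] mball_measure_pos[OF B] by (simp add: field_simps)
qed

lemma wavelet_bounded:
  assumes "\<psi> \<in> wavelets A \<mu> \<pi> \<xi>"
  shows "cmod (\<psi> x) \<le> sqrt (1 / measure \<mu> (supp \<psi>))"
proof (rule real_le_rsqrt)
  show "(cmod (\<psi> x))\<^sup>2 \<le> 1 / measure \<mu> (supp \<psi>)"
    unfolding wavelet_norm[OF assms] by (simp add: indicator_def)
qed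

lemma wavelet_integrable:
  assumes "\<psi> \<in> wavelets A \<mu> \<pi> \<xi>"
  shows "integrable \<mu> \<psi>"
  using wavelet_measurable[OF assms] wavelet_bounded[OF assms]
  by (intro integrable_const_bound[of _ "sqrt (1 / measure \<mu> (supp \<psi>))"]) auto

text \<open>
  In the chart the wavelet is a non-trivial character, so some translation \<open>t\<close> of the ball multiplies
  it by \<open>\<zeta> \<noteq> 1\<close>. As the density is constant on a fine ball, the translation transported to the
  manifold preserves \<open>\<mu>\<close>, and the integral equals \<open>\<zeta>\<close> times itself.
\<close>

lemma wavelet_mean_zero:
  assumes \<psi>: "\<psi> \<in> wavelets A \<mu> \<pi> \<xi>" and fine: "fine_ball (supp \<psi>)"
  shows "(LINT x|\<mu>. \<psi> x) = 0"
proof -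
  let ?B = "supp \<psi>"
  have B: "mball A ?B"
    by (rule wavelet_mball[OF \<psi>])
  obtain c where c: "c \<in> A" "?B \<subseteq> fst c"
    using mball_chart[OF B] by blast
  obtain m \<eta> C where form: "wave_form c ?B \<psi> m \<eta> C"
    using wavelet_form[OF \<psi> c] by blast
  obtain b where b: "snd c ` ?B = pball m b"
    using form by (auto simp: wave_form_def)
  obtain i where i: "kabs (\<eta> $ i) = 1"
    using form by (auto simp: wave_form_def)
  obtain x0 where x0: "kabs x0 \<le> 1" "\<xi> (inverse \<pi> * x0) \<noteq> 1"
    using character_nontrivial by blast
  define \<zeta> where "\<zeta> = \<xi> (inverse \<pi> * x0)"
  define t :: "'k ^ 'n" where "t = axis i (\<pi> powi m * x0 / \<eta> $ i)"
  have t_small: "kabs (t $ j) \<le> kabs \<pi> powi m" for j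
    using x0 i by (auto simp: t_def axis_def kabs_mult kabs_divide kabs_power_int mult_left_le)
  have "\<eta> $ i \<noteq> 0"
    using i by auto
  then have phase: "\<pi> powi (- m - 1) * pairing \<eta> t = inverse \<pi> * x0"
    using power_int_add[of \<pi> "- m - 1" m]
    by (simp add: t_def pairing_axis power_int_minus mult.assoc[symmetric])
  have shift: "z + t \<in> pball m b \<longleftrightarrow> z \<in> pball m b" for z
  proof -
    have "z \<in> pball m (z + t)" "z + t \<in> pball m z"
      using t_small by (auto simp: pball_def)
    then show ?thesis
      using pball_recentre by metis
  qed
  define T where "T x = (if x \<in> ?B then chart_inv c (snd c x + t) else x)" for x
  have T_B: "T x \<in> ?B" "snd c (T x) = snd c x + t" if "x \<in> ?B" for x
  proof -
    have "snd c x + t \<in> snd c ` ?B"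
      using that shift b by blast
    then obtain y where "y \<in> ?B" "snd c x + t = snd c y"
      by blast
    then show "T x \<in> ?B" "snd c (T x) = snd c x + t"
      using chart_inv_left[OF c(1), of y] c that by (auto simp: T_def)
  qed
  have T_measurable: "T \<in> measurable borel borel"
  proof -
    have "continuous_on ?B (\<lambda>x. chart_inv c (snd c x + t))"
    proof (rule continuous_on_compose2[OF chart_continuous(2)[OF c(1)]])
      show "continuous_on ?B (\<lambda>x. snd c x + t)"
        by (rule continuous_on_compose2[OF continuous_translate[of UNIV t]
              continuous_on_subset[OF chart_continuous(1)[OF c(1)] c(2)] subset_UNIV])
      show "(\<lambda>x. snd c x + t) ` ?B \<subseteq> snd c ` fst c"
        proof (rule image_subsetI)
        fix x assume "x \<in> ?B"
        then have "snd c x + t \<in> snd c ` ?B"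
          using shift b by blast
        then show "snd c x + t \<in> snd c ` fst c"
          using c(2) by blast
      qed
    qed
    then show ?thesis
      unfolding T_def using mball_borel[OF B]
      by (intro borel_measurable_continuous_on_if) (auto intro: continuous_on_id)
  qed
  obtain x1 where x1: "x1 \<in> ?B"
    using mball_nonempty[OF B] by blast
  have density: "emeasure \<mu> E = ennreal (kabs (\<omega> c (snd c x1))) * emeasure H (snd c ` E)"
    if "E \<in> sets borel" "E \<subseteq> ?B" for E
  proof (rule emeasure_const_density[OF c(1) that(1)])
    show "E \<subseteq> fst c"
      using that(2) c(2) by (rule subset_trans)
    have "\<forall>c\<in>A. ?B \<subseteq> fst c \<longrightarrow>
        (\<forall>x\<in>?B. \<forall>y\<in>?B. kabs (\<omega> c (snd c x)) = kabs (\<omega> c (snd c y)))"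
      using fine unfolding fine_ball_def by (elim conjE)
    then show "kabs (\<omega> c (snd c x)) = kabs (\<omega> c (snd c x1))" if "x \<in> E" for x
      using c x1 \<open>E \<subseteq> ?B\<close> that by (meson subsetD)
  qed
  have preserve: "distr \<mu> borel T = \<mu>"
  proof (rule measure_eqI)
    fix E assume "E \<in> sets (distr \<mu> borel T)"
    then have E: "E \<in> sets borel" by simp
    have pre: "T -` E \<in> sets borel"
      using measurable_sets[OF T_measurable E] by simp
    have img: "snd c ` (E \<inter> ?B) = (\<lambda>z. t + z) ` snd c ` (T -` E \<inter> ?B)"
    proof (intro equalityI subsetI)
      fix z assume "z \<in> snd c ` (E \<inter> ?B)"
      then obtain y where y: "y \<in> E" "y \<in> ?B" "z = snd c y" by blast
      then have "(z - t) + t \<in> pball m b"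
        using b by (simp add: image_iff) blast
      then have "z - t \<in> snd c ` ?B"
        using shift b by blast
      then obtain x where x: "x \<in> ?B" "snd c x = z - t"
        by auto
      then have "snd c (T x) = snd c y"
        using T_B(2) y by simp
      then have "T x = y"
        using chart_inj[OF c(1)] T_B(1)[OF x(1)] y c(2) by (meson inj_onD subsetD)
      then have "x \<in> T -` E \<inter> ?B"
        using x y by simp
      moreover have "z = t + snd c x"
        using x by simp
      ultimately show "z \<in> (\<lambda>z. t + z) ` snd c ` (T -` E \<inter> ?B)"
        by blast
    next
      fix z assume "z \<in> (\<lambda>z. t + z) ` snd c ` (T -` E \<inter> ?B)"
      then obtain x where "T x \<in> E" "x \<in> ?B" "z = t + snd c x"
        by blast
      then show "z \<in> snd c ` (E \<inter> ?B)"
        using T_B[of x] by (intro image_eqI[of _ _ "T x"]) (auto simp: add.commute)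
    qed
    have "snd c ` (T -` E \<inter> ?B) \<in> sets borel"
      using pre mball_borel[OF B] c by (intro chart_image_borel) auto
    then have "emeasure \<mu> (E \<inter> ?B) = emeasure \<mu> (T -` E \<inter> ?B)"
      using density[of "E \<inter> ?B"] density[of "T -` E \<inter> ?B"] E pre mball_borel[OF B]
      by (simp add: img emeasure_translate)
    moreover have "T -` E - ?B = E - ?B"
      by (auto simp: T_def)
    moreover have "emeasure \<mu> F = emeasure \<mu> (F \<inter> ?B) + emeasure \<mu> (F - ?B)" if "F \<in> sets borel" for F
    proof -
      have "(F \<inter> ?B) \<union> (F - ?B) = F" "(F \<inter> ?B) \<inter> (F - ?B) = {}" by blast+
      then show ?thesis
        using plus_emeasure[of "F \<inter> ?B" \<mu> "F - ?B"] that mball_borel[OF B] by auto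
    qed
    ultimately have "emeasure \<mu> (T -` E) = emeasure \<mu> E"
      using E pre by metis
    then show "emeasure (distr \<mu> borel T) E = emeasure \<mu> E"
      using T_measurable E by (subst emeasure_distr) auto
  qed simp
  have "\<psi> (T x) = \<zeta> * \<psi> x" for x
  proof (cases "x \<in> ?B")
    case True
    have "\<psi> (T x) = C * \<xi> (\<pi> powi (- m - 1) * pairing \<eta> (snd c x) + inverse \<pi> * x0)"
      using form T_B[OF True] phase by (simp add: wave_form_def pairing_add distrib_left)
    also have "\<dots> = \<zeta> * \<psi> x"
      using form True by (simp add: character_add \<zeta>_def wave_form_def)
    finally show ?thesis .
  next
    case False
    then show ?thesis
      by (simp add: T_def supp_def)
  qed
  then have "(LINT x|\<mu>. \<psi> (T x)) = \<zeta> * (LINT x|\<mu>. \<psi> x)"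
    by simp
  moreover have "(LINT x|\<mu>. \<psi> (T x)) = (LINT x|\<mu>. \<psi> x)"
    using integral_distr[of T \<mu> borel \<psi>] T_measurable wavelet_measurable[OF \<psi>] preserve by simp
  ultimately have "(\<zeta> - 1) * (LINT x|\<mu>. \<psi> x) = 0"
    by (simp add: algebra_simps)
  then show ?thesis
    using x0 by (simp add: \<zeta>_def)
qed


section \<open>Small wavelets are eigenfunctions\<close>

text \<open>
  Points of the support at which the wavelet differs lie in different maximal subballs; no smaller
  ball contains both, so their join is the whole support.
\<close>

lemma geo_dist_inside:
  assumes \<psi>: "\<psi> \<in> wavelets A \<mu> \<pi> \<xi>" and fine: "fine_ball (supp \<psi>)"
    and xy: "x \<in> supp \<psi>" "y \<in> supp \<psi>" "\<psi> x \<noteq> \<psi> y"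
  shows "geo_dist A \<mu> x y = measure \<mu> (supp \<psi>)"
proof -
  have B: "mball A (supp \<psi>)"
    by (rule wavelet_mball[OF \<psi>])
  have contains: "supp \<psi> \<subseteq> D" if D: "mball A D" "x \<in> D" "y \<in> D" for D
  proof -
    obtain c where c: "c \<in> A" "D \<subseteq> fst c"
      using mball_chart[OF D(1)] by blast
    have sub: "supp \<psi> \<subseteq> fst c"
      using fine_subset_chart[OF fine c(1) xy(1)] D c by blast
    obtain m \<eta> C where form: "wave_form c (supp \<psi>) \<psi> m \<eta> C"
      using wavelet_form[OF \<psi> c(1) sub] by blast
    obtain l a where "snd c ` D = pball l a"
      using mball_image[OF D(1) c] by blast
    then have l: "snd c ` D = pball l (snd c x)"
      using D(2) pball_recentre[of "snd c x" l a] by blast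
    have "snd c y \<notin> pball (m + 1) (snd c x)"
      using wave_form_const[OF form xy(1,2)] xy(3) by blast
    moreover have "snd c y \<in> pball l (snd c x)"
      using l D(3) by blast
    ultimately have "l \<le> m"
      using pball_mono[of "m + 1" l "snd c x"] by force
    then have "snd c ` supp \<psi> \<subseteq> snd c ` D"
      using wave_form_image[OF form xy(1)] l pball_mono by metis
    then show ?thesis
      using inj_on_image_subset_iff[OF chart_inj[OF c(1)] sub c(2)] by blast
  qed
  have "has_join A x y"
    unfolding has_join_def using B xy by blast
  moreover have "mjoin A x y = supp \<psi>"
    unfolding mjoin_def using B xy contains by (intro antisym Inter_lower Inter_greatest) auto
  ultimately show ?thesis
    by (simp add: geo_dist_def)
qed

lemma eigenvalue_at_const:
  assumes "\<psi> \<in> wavelets A \<mu> \<pi> \<xi>" "fine_ball (supp \<psi>)" "x \<in> supp \<psi>"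
  shows "eigenvalue A \<mu> s \<psi> = eigenvalue_at A \<mu> s \<psi> x"
proof -
  define x' where "x' = (SOME x. x \<in> supp \<psi>)"
  have x': "x' \<in> supp \<psi>"
    unfolding x'_def using assms(3) by (rule someI)
  have "(\<lambda>y. indicator (- supp \<psi>) y *\<^sub>R geo_dist A \<mu> x' y powr (- s)) =
      (\<lambda>y. indicator (- supp \<psi>) y *\<^sub>R geo_dist A \<mu> x y powr (- s))"
  proof
    fix y
    show "indicator (- supp \<psi>) y *\<^sub>R geo_dist A \<mu> x' y powr (- s) =
        indicator (- supp \<psi>) y *\<^sub>R geo_dist A \<mu> x y powr (- s)"
      using geo_dist_from_fine[OF assms(2) x' assms(3), of y] by (cases "y \<in> supp \<psi>") simp_all
  qed
  then show ?thesis
    unfolding eigenvalue_def eigenvalue_at_def set_lebesgue_integral_def x'_def[symmetric] by metis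
qed

text \<open>
  For \<open>x\<close> in the support \<open>B\<close>, the integrand over \<open>- B\<close> gives the integral in the eigenvalue. On \<open>B\<close> the
  kernel may be replaced by the constant \<open>\<mu>(B) powr (- s)\<close>, since it differs from it only where
  \<open>\<psi> x = \<psi> y\<close>; the mean of \<open>\<psi>\<close> being zero, this part contributes \<open>\<mu>(B) powr (1 - s) * \<psi> x\<close>. For \<open>x\<close>
  outside, the kernel is constant on \<open>B\<close> and the integral vanishes for the same reason.
\<close>

lemma laplacian_wavelet:
  assumes \<psi>: "\<psi> \<in> wavelets A \<mu> \<pi> \<xi>" and fine: "fine_ball (supp \<psi>)"
  shows "laplacian A \<mu> s \<psi> x = complex_of_real (eigenvalue A \<mu> s \<psi>) * \<psi> x"
proof (cases "x \<in> supp \<psi>")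
  case True
  let ?B = "supp \<psi>"
  let ?v = "measure \<mu> ?B"
  define g where "g y = indicator (- ?B) y * geo_dist A \<mu> x y powr (- s)" for y
  have B: "mball A ?B"
    by (rule wavelet_mball[OF \<psi>])
  have g: "integrable \<mu> g"
    unfolding g_def by (rule geo_dist_outside_integrable[OF fine True])
  have eq: "complex_of_real (geo_dist A \<mu> x y powr (- s)) * (\<psi> x - \<psi> y) =
      complex_of_real (g y) * \<psi> x +
      complex_of_real (?v powr (- s)) * (complex_of_real (indicator ?B y) * \<psi> x - \<psi> y)" for y
  proof (cases "y \<in> ?B")
    case y: True
    show ?thesis
    proof (cases "\<psi> x = \<psi> y")
      case False
      then show ?thesis
        using geo_dist_inside[OF \<psi> fine True y] y by (simp add: g_def)
    qed (use y in \<open>simp add: g_def\<close>)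
  qed (simp add: g_def supp_def)
  have ind: "integrable \<mu> (\<lambda>y. complex_of_real (indicator ?B y) * \<psi> x)"
    using mball_borel[OF B]
    by (intro integrable_mult_left integrable_of_real integrable_real_indicator)
      (auto simp: emeasure_eq_measure)
  have "laplacian A \<mu> s \<psi> x = complex_of_real (integral\<^sup>L \<mu> g) * \<psi> x +
      complex_of_real (?v powr (- s)) * (complex_of_real ?v * \<psi> x - (LINT y|\<mu>. \<psi> y))"
    unfolding laplacian_def eq using g ind wavelet_integrable[OF \<psi>] by simp
  also have "\<dots> = complex_of_real (integral\<^sup>L \<mu> g + ?v powr (- s) * ?v) * \<psi> x"
    by (simp add: wavelet_mean_zero[OF \<psi> fine] algebra_simps)
  also have "?v powr (- s) * ?v = ?v powr (1 - s)"
    using mball_measure_pos[OF B] powr_add[of ?v "- s" 1] by simp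
  also have "integral\<^sup>L \<mu> g + ?v powr (1 - s) = eigenvalue A \<mu> s \<psi>"
    unfolding eigenvalue_at_const[OF \<psi> fine True] eigenvalue_at_def set_lebesgue_integral_def g_def
    by simp
  finally show ?thesis .
next
  case False
  define x' where "x' = (SOME x. x \<in> supp \<psi>)"
  have x': "x' \<in> supp \<psi>"
    unfolding x'_def using mball_nonempty[OF wavelet_mball[OF \<psi>]] by (simp add: some_in_eq)
  have "complex_of_real (geo_dist A \<mu> x y powr (- s)) * (\<psi> x - \<psi> y) =
      - complex_of_real (geo_dist A \<mu> x x' powr (- s)) * \<psi> y" for y
    using False geo_dist_to_fine[OF fine x' _ False, of y]
    by (cases "y \<in> supp \<psi>") (auto simp: supp_def)
  then have "laplacian A \<mu> s \<psi> x = 0"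
    unfolding laplacian_def by (simp add: wavelet_mean_zero[OF \<psi> fine])
  then show ?thesis
    using False by (simp add: supp_def)
qed


section \<open>Basis wavelets are small\<close>

text \<open>A wavelet is constant on the smaller support of a small wavelet, which has mean zero.\<close>

lemma small_wavelet_orthogonal:
  assumes \<phi>: "\<phi> \<in> wavelets A \<mu> \<pi> \<xi>" and fine: "fine_ball (supp \<phi>)"
    and \<psi>: "\<psi> \<in> wavelets A \<mu> \<pi> \<xi>" and less: "measure \<mu> (supp \<phi>) < measure \<mu> (supp \<psi>)"
  shows "(LINT x|\<mu>. \<phi> x * cnj (\<psi> x)) = 0"
proof -
  have mb: "mball A (supp \<phi>)" "mball A (supp \<psi>)"
    using wavelet_mball \<phi> \<psi> by auto
  have not_sub: "\<not> supp \<psi> \<subseteq> supp \<phi>"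
    using finite_measure_mono[of "supp \<psi>" "supp \<phi>"] less mb by auto
  have "\<exists>k. \<forall>x. \<phi> x * cnj (\<psi> x) = \<phi> x * k"
  proof (cases "supp \<phi> \<inter> supp \<psi> = {}")
    case True
    then have "\<phi> x * cnj (\<psi> x) = \<phi> x * 0" for x
      by (auto simp: supp_def)
    then show ?thesis by blast
  next
    case False
    then have sub: "supp \<phi> \<subseteq> supp \<psi>"
      using fine_nested[OF fine mb(2)] not_sub by blast
    obtain c where c: "c \<in> A" "supp \<psi> \<subseteq> fst c"
      using mball_chart[OF mb(2)] by blast
    obtain m \<eta> C where form: "wave_form c (supp \<psi>) \<psi> m \<eta> C"
      using wavelet_form[OF \<psi> c] by blast
    obtain x where x: "x \<in> supp \<phi>" "x \<in> supp \<psi>"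
      using False by blast
    have sub': "supp \<phi> \<subseteq> fst c"
      using sub c by blast
    obtain l a where "snd c ` supp \<phi> = pball l a"
      using mball_image[OF mb(1) c(1) sub'] by blast
    then have l: "snd c ` supp \<phi> = pball l (snd c x)"
      using x(1) pball_recentre[of "snd c x" l a] by blast
    have "m < l"
    proof (rule ccontr)
      assume "\<not> m < l"
      then have "snd c ` supp \<psi> \<subseteq> snd c ` supp \<phi>"
        using wave_form_image[OF form x(2)] l pball_mono[of l m "snd c x"] by simp
      then show False
        using inj_on_image_subset_iff[OF chart_inj[OF c(1)] c(2) sub'] not_sub by blast
    qed
    then have "\<psi> x = \<psi> y" if "y \<in> supp \<phi>" for y
      using wave_form_const[OF form x(2), of y] that sub l pball_mono[of "m + 1" l "snd c x"] by force
    then have "\<phi> y * cnj (\<psi> y) = \<phi> y * cnj (\<psi> x)" for y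
      by (cases "y \<in> supp \<phi>") (auto simp: supp_def)
    then show ?thesis by blast
  qed
  then obtain k where "(\<lambda>x. \<phi> x * cnj (\<psi> x)) = (\<lambda>x. \<phi> x * k)"
    by blast
  then show ?thesis
    using wavelet_mean_zero[OF \<phi> fine] by (simp only:) simp
qed

text \<open>
  A wavelet whose support is not small is orthogonal to all small ones, hence at distance at least
  \<open>1\<close> from their span, and so not in its closure.
\<close>

lemma L2w_wavelet_small:
  assumes "\<epsilon> \<le> fine_measure" "\<psi> \<in> wavelets A \<mu> \<pi> \<xi>" "\<psi> \<in> L2w A \<mu> \<pi> \<xi> \<epsilon>"
  shows "measure \<mu> (supp \<psi>) \<le> \<epsilon>"
proof (rule ccontr)
  assume large: "\<not> measure \<mu> (supp \<psi>) \<le> \<epsilon>"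
  note \<psi> = assms(2)
  obtain g where "g \<in> complex_span (small_wavelets A \<mu> \<pi> \<xi> \<epsilon>)"
    and close: "sqrt (LINT x|\<mu>. (cmod (\<psi> x - g x))\<^sup>2) < 1"
    using assms(3) zero_less_one unfolding L2w_def l2_closure_def by blast
  then obtain F k where F: "finite F" "F \<subseteq> small_wavelets A \<mu> \<pi> \<xi> \<epsilon>"
    and g: "g = (\<lambda>x. \<Sum>\<phi>\<in>F. k \<phi> * \<phi> x)"
    by (auto simp: complex_span_def)
  have F_wavelet: "\<phi> \<in> wavelets A \<mu> \<pi> \<xi>" if "\<phi> \<in> F" for \<phi>
    using that F(2) by (auto simp: small_wavelets_def)
  have orth: "(LINT x|\<mu>. \<phi> x * cnj (\<psi> x)) = 0" if "\<phi> \<in> F" for \<phi>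
  proof (rule small_wavelet_orthogonal[OF F_wavelet[OF that] _ \<psi>])
    have "measure \<mu> (supp \<phi>) \<le> \<epsilon>"
      using that F(2) by (auto simp: small_wavelets_def)
    then show "fine_ball (supp \<phi>)" "measure \<mu> (supp \<phi>) < measure \<mu> (supp \<psi>)"
      using fine_if_small[OF wavelet_mball[OF F_wavelet[OF that]]] assms(1) large by auto
  qed
  have [measurable]: "\<psi> \<in> borel_measurable borel"
    by (rule wavelet_measurable[OF \<psi>])
  have [measurable]: "g \<in> borel_measurable borel"
    unfolding g using wavelet_measurable F_wavelet by (intro borel_measurable_sum) auto
  have bound_prod: "integrable \<mu> (\<lambda>x. \<phi> x * cnj (\<psi> x))" if "\<phi> \<in> F" for \<phi>
    using wavelet_measurable[OF F_wavelet[OF that]] wavelet_bounded[OF F_wavelet[OF that]]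
      wavelet_bounded[OF \<psi>]
    by (intro integrable_const_bound[of _ "sqrt (1 / measure \<mu> (supp \<phi>)) * sqrt (1 / measure \<mu> (supp \<psi>))"])
      (auto simp: norm_mult simp del: real_sqrt_divide
        intro!: mult_mono AE_I2 borel_measurable_times wavelet_cnj_measurable[OF \<psi>])
  have int_gp: "integrable \<mu> (\<lambda>x. g x * cnj (\<psi> x))"
    unfolding g sum_distrib_right mult.assoc using bound_prod by (intro Bochner_Integration.integrable_sum) auto
  have zero: "(LINT x|\<mu>. g x * cnj (\<psi> x)) = 0"
    unfolding g sum_distrib_right mult.assoc using bound_prod orth by (subst Bochner_Integration.integral_sum) auto
  define b where "b = (\<Sum>\<phi>\<in>F. cmod (k \<phi>) * sqrt (1 / measure \<mu> (supp \<phi>)))"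
  have g_bound: "cmod (g x) \<le> b" for x
    unfolding g b_def using wavelet_bounded[OF F_wavelet]
    by (intro order_trans[OF norm_sum] sum_mono) (simp add: norm_mult mult_left_mono del: real_sqrt_divide)
  have int_g: "integrable \<mu> (\<lambda>x. (cmod (g x))\<^sup>2)"
    using g_bound by (intro integrable_const_bound[of _ "b\<^sup>2"]) (auto intro!: power_mono)
  have int_\<psi>: "integrable \<mu> (\<lambda>x. (cmod (\<psi> x))\<^sup>2)" "(LINT x|\<mu>. (cmod (\<psi> x))\<^sup>2) = 1"
    using wavelet_norm[OF \<psi>] mball_measure_pos[OF wavelet_mball[OF \<psi>]] mball_borel[OF wavelet_mball[OF \<psi>]]
    by (auto intro!: integrable_divide_zero integrable_real_indicator simp: emeasure_eq_measure)
  define P where "P x = Re (g x * cnj (\<psi> x))" for x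
  have P: "integrable \<mu> P" "integral\<^sup>L \<mu> P = 0"
    unfolding P_def using integrable_Re[OF int_gp] integral_Re[OF int_gp] zero by simp_all
  have expand: "(cmod (\<psi> x - g x))\<^sup>2 = (cmod (\<psi> x))\<^sup>2 + (cmod (g x))\<^sup>2 - 2 * P x" for x
    unfolding P_def by (simp only: cmod_power2) (simp add: power2_eq_square algebra_simps)
  have "(LINT x|\<mu>. (cmod (\<psi> x - g x))\<^sup>2) = 1 + (LINT x|\<mu>. (cmod (g x))\<^sup>2)"
    unfolding expand using int_\<psi> int_g P by simp
  moreover have "0 \<le> (LINT x|\<mu>. (cmod (g x))\<^sup>2)"
    by simp
  ultimately have "1 \<le> sqrt (LINT x|\<mu>. (cmod (\<psi> x - g x))\<^sup>2)"
    by simp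
  then show False
    using close by simp
qed

lemma small_wavelets_non_overlapping:
  assumes "\<epsilon> \<le> fine_measure"
  shows "non_overlapping (small_wavelets A \<mu> \<pi> \<xi> \<epsilon>)"
  unfolding non_overlapping_def
proof (intro ballI)
  fix \<psi> \<psi>' assume "\<psi> \<in> small_wavelets A \<mu> \<pi> \<xi> \<epsilon>" "\<psi>' \<in> small_wavelets A \<mu> \<pi> \<xi> \<epsilon>"
  then have "mball A (supp \<psi>)" "measure \<mu> (supp \<psi>) \<le> \<epsilon>" "mball A (supp \<psi>')"
    using wavelet_mball by (auto simp: small_wavelets_def)
  then show "supp \<psi> \<inter> supp \<psi>' = {} \<or> supp \<psi> \<subseteq> supp \<psi>' \<or> supp \<psi>' \<subseteq> supp \<psi>"
    using fine_nested fine_if_small assms by (meson order_trans)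
qed

lemma basis_wavelet_fine:
  assumes "\<epsilon> \<le> fine_measure" "wavelet_basis A \<mu> \<pi> \<xi> \<epsilon> \<Psi>" "\<psi> \<in> \<Psi>"
  shows "\<psi> \<in> wavelets A \<mu> \<pi> \<xi>" "fine_ball (supp \<psi>)"
proof -
  have "\<psi> \<in> L2w A \<mu> \<pi> \<xi> \<epsilon>"
    using assms(2,3) by (auto simp: wavelet_basis_def orthonormal_basis_def)
  moreover show \<psi>: "\<psi> \<in> wavelets A \<mu> \<pi> \<xi>"
    using assms(2,3) by (auto simp: wavelet_basis_def)
  ultimately have "measure \<mu> (supp \<psi>) \<le> \<epsilon>"
    by (intro L2w_wavelet_small[OF assms(1)])
  then show "fine_ball (supp \<psi>)"
    using fine_if_small[OF wavelet_mball[OF \<psi>]] assms(1) by simp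
qed

end


section \<open>Integrals of infinite sums and of exponentials\<close>

lemma nn_integral_infsum:
  fixes f :: "'a \<Rightarrow> 'b \<Rightarrow> ennreal"
  assumes "countable S" and meas: "\<And>a. a \<in> S \<Longrightarrow> f a \<in> borel_measurable M"
  shows "(\<integral>\<^sup>+ t. (\<Sum>\<^sub>\<infinity>a\<in>S. f a t) \<partial>M) = (\<Sum>\<^sub>\<infinity>a\<in>S. \<integral>\<^sup>+ t. f a t \<partial>M)"
    and "(\<lambda>t. \<Sum>\<^sub>\<infinity>a\<in>S. f a t) \<in> borel_measurable M"
proof -
  have "(\<integral>\<^sup>+ t. (\<Sum>\<^sub>\<infinity>a\<in>S. f a t) \<partial>M) = (\<Sum>\<^sub>\<infinity>a\<in>S. \<integral>\<^sup>+ t. f a t \<partial>M) \<and>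
      (\<lambda>t. \<Sum>\<^sub>\<infinity>a\<in>S. f a t) \<in> borel_measurable M"
  proof (cases "finite S")
    case True
    then show ?thesis
      using meas by (simp add: nn_integral_sum borel_measurable_sum)
  next
    case False
    let ?e = "from_nat_into S"
    have e: "bij_betw ?e UNIV S"
      using assms(1) False by (rule bij_betw_from_nat_into)
    have sums: "infsum g S = (\<Sum>n. g (?e n))" for g :: "'a \<Rightarrow> ennreal"
    proof -
      have "infsum g S = (\<Sum>\<^sub>\<infinity>n. g (?e n))"
        using infsum_reindex_bij_betw[OF e, of g] by simp
      also have "\<dots> = (\<Sum>n. g (?e n))"
      proof (rule sums_unique)
        show "(\<lambda>n. g (?e n)) sums (\<Sum>\<^sub>\<infinity>n. g (?e n))"
          by (intro has_sum_imp_sums has_sum_infsum nonneg_summable_on_complete) simp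
      qed
      finally show ?thesis .
    qed
    have [measurable]: "f (?e n) \<in> borel_measurable M" for n
      using meas e by (simp add: bij_betw_apply)
    show ?thesis
      unfolding sums by (auto intro: nn_integral_suminf)
  qed
  then show "(\<integral>\<^sup>+ t. (\<Sum>\<^sub>\<infinity>a\<in>S. f a t) \<partial>M) = (\<Sum>\<^sub>\<infinity>a\<in>S. \<integral>\<^sup>+ t. f a t \<partial>M)"
    "(\<lambda>t. \<Sum>\<^sub>\<infinity>a\<in>S. f a t) \<in> borel_measurable M"
    by auto
qed

lemma ennreal_infsum:
  fixes f :: "'a \<Rightarrow> real"
  assumes "f summable_on S" "\<And>a. a \<in> S \<Longrightarrow> 0 \<le> f a"
  shows "ennreal (infsum f S) = (\<Sum>\<^sub>\<infinity>a\<in>S. ennreal (f a))"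
proof -
  have "sum (\<lambda>a. ennreal (f a)) F = ennreal (sum f F)" if "F \<subseteq> S" for F
    using assms(2) that by (intro sum_ennreal) blast
  then have "(SUP F\<in>{F. finite F \<and> F \<subseteq> S}. sum (\<lambda>a. ennreal (f a)) F) =
      (SUP F\<in>{F. finite F \<and> F \<subseteq> S}. ennreal (sum f F))"
    by (intro SUP_cong refl) simp
  moreover have "(\<Sum>\<^sub>\<infinity>a\<in>S. ennreal (f a)) =
      (SUP F\<in>{F. finite F \<and> F \<subseteq> S}. sum (\<lambda>a. ennreal (f a)) F)"
    by (rule nonneg_infsum_complete) simp
  ultimately show ?thesis
    using infsum_nonneg_is_SUPREMUM_ennreal[OF assms] by simp
qed

lemma has_bochner_integral_exp:
  fixes l :: real
  assumes "0 < l"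
  shows "has_bochner_integral lborel (\<lambda>t. indicator {0<..} t * exp (- t * l)) (inverse l)"
proof (rule has_bochner_integral_nn_integral)
  have "(\<integral>\<^sup>+ t. ennreal (indicator {0<..} t * exp (- t * l)) \<partial>lborel) =
      (\<integral>\<^sup>+ t. ennreal (exp (- t * l)) * indicator {0..} t \<partial>lborel)"
  proof (rule nn_integral_cong_AE)
    have "AE t in lborel. t \<noteq> (0 :: real)"
      by (rule AE_lborel_singleton)
    then show "AE t in lborel. ennreal (indicator {0<..} t * exp (- t * l)) =
        ennreal (exp (- t * l)) * indicator {0..} t"
      by eventually_elim (auto split: split_indicator)
  qed
  also have "\<dots> = ennreal (0 - (- exp (- 0 * l) / l))"
  proof (rule nn_integral_FTC_atLeast)
    show "((\<lambda>t. - exp (- t * l) / l) has_field_derivative exp (- t * l)) (at t)" for t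
      using assms by (auto intro!: derivative_eq_intros)
    have "filterlim (\<lambda>t. l * t) at_top at_top"
      using assms by (intro filterlim_tendsto_pos_mult_at_top[OF tendsto_const _ filterlim_ident])
    then have "filterlim (\<lambda>t. - t * l) at_bot at_top"
      by (simp add: filterlim_uminus_at_bot mult.commute)
    then have "((\<lambda>t. exp (- t * l)) \<longlongrightarrow> 0) at_top"
      by (rule filterlim_compose[OF exp_at_bot])
    then have "((\<lambda>t. - exp (- t * l) / l) \<longlongrightarrow> - 0 / l) at_top"
      using assms by (intro tendsto_intros) auto
    then show "((\<lambda>t. - exp (- t * l) / l) \<longlongrightarrow> 0) at_top"
      by simp
  qed auto
  finally show "(\<integral>\<^sup>+ t. ennreal (indicator {0<..} t * exp (- t * l)) \<partial>lborel) = ennreal (inverse l)"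
    using assms by (simp add: divide_simps)
qed (use assms in auto)

text \<open>
  The heat factor is smaller than any power of the volume \<open>v\<close>. The second power suffices: one factor
  cancels the square of the wavelet, the other one makes the sum over shrinking balls converge.
\<close>

lemma exp_powr_bound:
  fixes s t v :: real
  assumes "1 < s" "0 < t" "0 < v"
  shows "exp (- t * v powr (1 - s)) / v \<le> (t * (s - 1) / 2) powr (- 2 / (s - 1)) * v"
proof -
  define a where "a = 2 / (s - 1)"
  define X where "X = t * v powr (1 - s)"
  have pos: "0 < a" "0 < X"
    using assms by (auto simp: a_def X_def)
  have "X / a \<le> exp (X / a)"
    using exp_ge_add_one_self[of "X / a"] by linarith
  then have "(X / a) powr a \<le> exp (X / a) powr a"
    using pos by (intro powr_mono2) auto
  also have "\<dots> = exp X"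
    using pos by (simp add: exp_powr_real)
  finally have "exp (- X) \<le> (X / a) powr (- a)"
    using pos by (simp add: exp_minus powr_minus le_imp_inverse_le)
  also have "\<dots> = (t / a) powr (- a) * (v powr (1 - s)) powr (- a)"
    using assms pos by (simp add: X_def powr_mult[symmetric])
  also have "(v powr (1 - s)) powr (- a) = v ^ 2"
  proof -
    have "(1 - s) * (- a) = 2"
      using assms by (simp add: a_def field_simps)
    then show ?thesis
      using assms by (simp add: powr_powr powr_numeral)
  qed
  finally have "exp (- X) \<le> (t * (s - 1) / 2) powr (- 2 / (s - 1)) * v ^ 2"
    by (simp add: a_def)
  then show ?thesis
    using assms by (simp add: X_def field_simps power2_eq_square)
qed

lemma (in uniformised) pball_separates:
  fixes a b :: "'k ^ 'n::finite"
  assumes "a \<noteq> b"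
  obtains k where "b \<notin> pball k a"
proof -
  obtain i where "b $ i \<noteq> a $ i"
    using assms by (metis vec_eq_iff)
  then obtain k where "kabs \<pi> powi int k < kabs (b $ i - a $ i)"
    using powi_small[of "kabs (b $ i - a $ i)"] by auto
  then have "b \<notin> pball (int k) a"
    by (auto simp: pball_def not_le)
  then show thesis
    by (rule that)
qed


section \<open>Orthonormal wavelets around a point\<close>

locale orthonormal_wavelets = wavelet_manifold \<pi> H A \<omega> \<mu> \<xi> s
  for \<pi> :: "'k::nonarch_local_field" and H :: "('k ^ 'n::finite) measure"
    and A :: "('x::t2_space, 'k, 'n) chart set" and \<omega> \<mu> \<xi> s +
  fixes \<Psi> :: "('x \<Rightarrow> complex) set"
  assumes wavelets: "\<Psi> \<subseteq> wavelets A \<mu> \<pi> \<xi>"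
    and orthonormal: "\<And>f g. f \<in> \<Psi> \<Longrightarrow> g \<in> \<Psi> \<Longrightarrow> l2_inner \<mu> f g = (if f = g then 1 else 0)"
begin

abbreviation volume :: "('x \<Rightarrow> complex) \<Rightarrow> real" where
  "volume \<psi> \<equiv> measure \<mu> (supp \<psi>)"

abbreviation around :: "'x \<Rightarrow> ('x \<Rightarrow> complex) set" where
  "around x \<equiv> {\<psi> \<in> \<Psi>. x \<in> supp \<psi>}"

lemma \<Psi>_wavelet: "\<psi> \<in> \<Psi> \<Longrightarrow> \<psi> \<in> wavelets A \<mu> \<pi> \<xi>"
  using wavelets by blast

lemma volume_pos: "\<psi> \<in> \<Psi> \<Longrightarrow> 0 < volume \<psi>"
  using mball_measure_pos[OF wavelet_mball[OF \<Psi>_wavelet]] .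

text \<open>Proportional functions of norm 1 have an inner product of absolute value 1.\<close>

lemma proportional_imp_eq:
  assumes "\<psi> \<in> \<Psi>" "\<psi>' \<in> \<Psi>" "\<psi> x \<noteq> 0" "\<psi>' x \<noteq> 0" and ratio: "\<And>y. \<psi>' x * \<psi> y = \<psi> x * \<psi>' y"
  shows "\<psi> = \<psi>'"
proof (rule ccontr)
  assume "\<psi> \<noteq> \<psi>'"
  then have 0: "l2_inner \<mu> \<psi> \<psi>' = 0"
    using orthonormal assms by simp
  have "cnj (\<psi> x) * l2_inner \<mu> \<psi> \<psi>' = (LINT y|\<mu>. cnj (\<psi> x) * (\<psi> y * cnj (\<psi>' y)))"
    by (simp add: l2_inner_def)
  also have "\<dots> = (LINT y|\<mu>. cnj (\<psi>' x) * (\<psi> y * cnj (\<psi> y)))"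
  proof (rule Bochner_Integration.integral_cong[OF refl])
    fix y
    have "cnj (\<psi> x) * cnj (\<psi>' y) = cnj (\<psi>' x) * cnj (\<psi> y)"
      using arg_cong[OF ratio[of y], of cnj] by simp
    then show "cnj (\<psi> x) * (\<psi> y * cnj (\<psi>' y)) = cnj (\<psi>' x) * (\<psi> y * cnj (\<psi> y))"
      by (metis mult.left_commute)
  qed
  also have "\<dots> = cnj (\<psi>' x) * l2_inner \<mu> \<psi> \<psi>"
    by (simp add: l2_inner_def)
  also have "\<dots> = cnj (\<psi>' x)"
    using orthonormal[OF assms(1,1)] by simp
  finally show False
    using 0 assms(4) by simp
qed

text \<open>
  Two wavelets around \<open>x\<close> with the same radius in the same chart have the same support; if moreover
  their frequencies agree modulo \<open>\<pi>\<close>, they are proportional.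
\<close>

lemma wavelet_eqI:
  assumes \<psi>: "\<psi> \<in> \<Psi>" "x \<in> supp \<psi>" "supp \<psi> \<subseteq> fst c" "wave_form c (supp \<psi>) \<psi> m \<eta> C"
    and \<psi>': "\<psi>' \<in> \<Psi>" "x \<in> supp \<psi>'" "supp \<psi>' \<subseteq> fst c" "wave_form c (supp \<psi>') \<psi>' m \<eta>' C'"
    and c: "c \<in> A" and freq: "\<And>i. residue_class (\<eta> $ i) = residue_class (\<eta>' $ i)"
  shows "\<psi> = \<psi>'"
proof -
  let ?u = "\<pi> powi (- m - 1)"
  have "supp \<psi> = supp \<psi>'"
    using eq_vimage_of_image[OF c \<psi>(3) wave_form_image[OF \<psi>(4,2)]]
      eq_vimage_of_image[OF c \<psi>'(3) wave_form_image[OF \<psi>'(4,2)]] by simp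
  have "\<psi>' x * \<psi> y = \<psi> x * \<psi>' y" for y
  proof (cases "y \<in> supp \<psi>")
    case True
    define z where "z = snd c y - snd c x"
    have z: "kabs (z $ i) \<le> kabs \<pi> powi m" for i
    proof -
      have "snd c y \<in> pball m (snd c x)"
        using wave_form_image[OF \<psi>(4,2)] True by blast
      then show ?thesis
        by (simp add: pball_def z_def)
    qed
    have y: "snd c y = snd c x + z"
      by (simp add: z_def)
    have "kabs (pairing \<eta> z - pairing \<eta>' z) \<le> kabs \<pi> * kabs \<pi> powi m"
      using freq z by (intro kabs_pairing_diff_le) (simp_all add: residue_class_eq_iff kabs_less_1_iff)
    also have "\<dots> = kabs \<pi> powi (m + 1)"
      by (simp add: power_int_add)
    finally have "kabs (?u * pairing \<eta> z - ?u * pairing \<eta>' z) \<le> kabs \<pi> powi (- m - 1) * kabs \<pi> powi (m + 1)"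
      by (simp add: right_diff_distrib[symmetric] kabs_mult kabs_power_int mult_left_mono del: power_int_add)
    also have "\<dots> = kabs \<pi> powi ((- m - 1) + (m + 1))"
      by (intro power_int_add[symmetric]) auto
    finally have "\<xi> (?u * pairing \<eta> z) = \<xi> (?u * pairing \<eta>' z)"
      by (intro character_eq) simp
    moreover have "\<psi> y = \<psi> x * \<xi> (?u * pairing \<eta> z)"
      using \<psi>(2,4) True
      by (simp add: wave_form_def y pairing_add distrib_left character_add)
    moreover have "\<psi>' y = \<psi>' x * \<xi> (?u * pairing \<eta>' z)"
      using \<psi>'(2,4) True \<open>supp \<psi> = supp \<psi>'\<close>
      by (simp add: wave_form_def y pairing_add distrib_left character_add)
    ultimately show ?thesis
      by simp
  next
    case False
    then have "\<psi> y = 0" "\<psi>' y = 0"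
      using \<open>supp \<psi> = supp \<psi>'\<close> unfolding supp_def by blast+
    then show ?thesis
      by simp
  qed
  then show ?thesis
    using proportional_imp_eq[of \<psi> \<psi>' x] \<psi>(1,2) \<psi>'(1,2) by (simp add: supp_def)
qed

text \<open>
  The exponent \<open>m\<close> is that of the radius, and the label \<open>q\<close> consists of a chart and a frequency modulo
  \<open>\<pi>\<close>; the atlas and the residue field being finite, there are finitely many labels.
\<close>

lemma around_coordinates:
  obtains m :: "('x \<Rightarrow> complex) \<Rightarrow> int" and q :: "('x \<Rightarrow> complex) \<Rightarrow> ('x, 'k, 'n) chart \<times> ('n \<Rightarrow> 'k set)"
  where "inj_on (\<lambda>\<psi>. (m \<psi>, q \<psi>)) (around x)" "finite (q ` around x)"
    "\<And>\<psi>. \<psi> \<in> around x \<Longrightarrow> density_min * vol (m \<psi>) \<le> volume \<psi>"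
    "\<And>\<psi>. \<psi> \<in> around x \<Longrightarrow> volume \<psi> \<le> density_max * vol (m \<psi>)"
proof -
  define data where "data \<psi> r = (case r of (c, m, \<eta>, C) \<Rightarrow>
    c \<in> A \<and> supp \<psi> \<subseteq> fst c \<and> wave_form c (supp \<psi>) \<psi> m \<eta> C)" for \<psi> r
  have "\<forall>\<psi>\<in>around x. \<exists>r. data \<psi> r"
  proof
    fix \<psi> assume "\<psi> \<in> around x"
    then have \<psi>: "\<psi> \<in> wavelets A \<mu> \<pi> \<xi>"
      using \<Psi>_wavelet by blast
    obtain c where c: "c \<in> A" "supp \<psi> \<subseteq> fst c"
      using mball_chart[OF wavelet_mball[OF \<psi>]] by blast
    obtain m \<eta> C where "wave_form c (supp \<psi>) \<psi> m \<eta> C"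
      using wavelet_form[OF \<psi> c] by blast
    then show "\<exists>r. data \<psi> r"
      using c by (intro exI[of _ "(c, m, \<eta>, C)"]) (simp add: data_def)
  qed
  then obtain r where r: "\<forall>\<psi>\<in>around x. data \<psi> (r \<psi>)"
    using bchoice[of "around x" data] by auto
  define c where "c \<psi> = fst (r \<psi>)" for \<psi>
  define m where "m \<psi> = fst (snd (r \<psi>))" for \<psi>
  define \<eta> where "\<eta> \<psi> = fst (snd (snd (r \<psi>)))" for \<psi>
  define C where "C \<psi> = snd (snd (snd (r \<psi>)))" for \<psi>
  have coords: "c \<psi> \<in> A" "supp \<psi> \<subseteq> fst (c \<psi>)"
    "wave_form (c \<psi>) (supp \<psi>) \<psi> (m \<psi>) (\<eta> \<psi>) (C \<psi>)" if "\<psi> \<in> around x" for \<psi>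
    using bspec[OF r that] by (simp_all add: data_def c_def m_def \<eta>_def C_def split: prod.splits)
  define q where "q \<psi> = (c \<psi>, \<lambda>i. residue_class (\<eta> \<psi> $ i))" for \<psi>
  show thesis
  proof
    show "inj_on (\<lambda>\<psi>. (m \<psi>, q \<psi>)) (around x)"
    proof (rule inj_onI)
      fix \<psi> \<psi>' assume *: "\<psi> \<in> around x" "\<psi>' \<in> around x" "(m \<psi>, q \<psi>) = (m \<psi>', q \<psi>')"
      then have q: "q \<psi>' = q \<psi>" and m: "m \<psi>' = m \<psi>"
        by simp_all
      from q have c: "c \<psi>' = c \<psi>"
        and freq: "(\<lambda>i. residue_class (\<eta> \<psi>' $ i)) = (\<lambda>i. residue_class (\<eta> \<psi> $ i))"
        by (simp_all add: q_def)
      have form': "wave_form (c \<psi>) (supp \<psi>') \<psi>' (m \<psi>) (\<eta> \<psi>') (C \<psi>')"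
        using coords(3)[OF *(2)] unfolding c m .
      have sub': "supp \<psi>' \<subseteq> fst (c \<psi>)"
        using coords(2)[OF *(2)] unfolding c .
      show "\<psi> = \<psi>'"
        by (rule wavelet_eqI[where x = x, OF _ _ coords(2)[OF *(1)] coords(3)[OF *(1)] _ _ sub' form' coords(1)[OF *(1)]])
          (use * fun_cong[OF freq] in simp_all)
    qed
    have "q ` around x \<subseteq> A \<times> PiE UNIV (\<lambda>_. residue_class ` OK)"
      using coords(1,3) by (fastforce simp: q_def wave_form_def OK_def)
    moreover have "finite (A \<times> PiE UNIV (\<lambda>_ :: 'n. residue_class ` (OK :: 'k set)))"
      using finite_atlas finite_residue_classes by (intro finite_cartesian_product finite_PiE) auto
    ultimately show "finite (q ` around x)"
      using finite_subset by blast
    fix \<psi> assume \<psi>: "\<psi> \<in> around x"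
    then have img: "snd (c \<psi>) ` supp \<psi> = pball (m \<psi>) (snd (c \<psi>) x)"
      using wave_form_image[OF coords(3)[OF \<psi>]] by simp
    have ball: "mball A (supp \<psi>)"
      using \<psi> by (intro wavelet_mball \<Psi>_wavelet) simp
    show "density_min * vol (m \<psi>) \<le> volume \<psi>" "volume \<psi> \<le> density_max * vol (m \<psi>)"
      using measure_ball_bounds[OF ball coords(1,2)[OF \<psi>] img] by simp_all
  qed
qed

lemma countable_around: "countable (around x)"
proof -
  obtain m and q :: "('x \<Rightarrow> complex) \<Rightarrow> ('x, 'k, 'n) chart \<times> ('n \<Rightarrow> 'k set)"
    where mq: "inj_on (\<lambda>\<psi>. (m \<psi>, q \<psi>)) (around x)" "finite (q ` around x)"
      "\<And>\<psi>. \<psi> \<in> around x \<Longrightarrow> density_min * vol (m \<psi>) \<le> volume \<psi>"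
      "\<And>\<psi>. \<psi> \<in> around x \<Longrightarrow> volume \<psi> \<le> density_max * vol (m \<psi>)"
    by (rule around_coordinates[of x], rule that) assumption+
  have "(\<lambda>\<psi>. (m \<psi>, q \<psi>)) ` around x \<subseteq> UNIV \<times> q ` around x"
    by blast
  moreover have "countable (UNIV \<times> q ` around x :: (int \<times> _) set)"
    using mq(2) by (intro countable_SIGMA) (auto intro: countable_finite)
  ultimately show ?thesis
    using countable_image_inj_on[OF countable_subset mq(1)] by blast
qed

text \<open>Each radius occurs boundedly often around \<open>x\<close>, and volumes decay geometrically.\<close>

lemma summable_volume_powr:
  assumes "0 < \<theta>"
  shows "(\<lambda>\<psi>. volume \<psi> powr \<theta>) summable_on around x"
proof -
  obtain m and q :: "('x \<Rightarrow> complex) \<Rightarrow> ('x, 'k, 'n) chart \<times> ('n \<Rightarrow> 'k set)"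
    where inj: "inj_on (\<lambda>\<psi>. (m \<psi>, q \<psi>)) (around x)" and fin: "finite (q ` around x)"
    and lower: "\<And>\<psi>. \<psi> \<in> around x \<Longrightarrow> density_min * vol (m \<psi>) \<le> volume \<psi>"
    and upper: "\<And>\<psi>. \<psi> \<in> around x \<Longrightarrow> volume \<psi> \<le> density_max * vol (m \<psi>)"
    by (rule around_coordinates[of x], rule that) assumption+
  obtain m0 where m0: "\<And>l. vol l \<le> measure \<mu> UNIV / density_min \<Longrightarrow> m0 \<le> l"
    using vol_bounded_above by blast
  have m_ge: "m0 \<le> m \<psi>" if "\<psi> \<in> around x" for \<psi>
  proof (rule m0)
    have "density_min * vol (m \<psi>) \<le> measure \<mu> UNIV"
      using lower[OF that] bounded_measure[of "supp \<psi>"] by simp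
    then show "vol (m \<psi>) \<le> measure \<mu> UNIV / density_min"
      using density_bounds(1) by (simp add: field_simps)
  qed
  define g where "g = (\<lambda>(l, _ :: ('x, 'k, 'n) chart \<times> ('n \<Rightarrow> 'k set)). (density_max * vol l) powr \<theta>)"
  have "g summable_on ({m0..} \<times> q ` around x)"
  proof (rule summable_on_SigmaI)
    show "((\<lambda>r. g (l, r)) has_sum real (card (q ` around x)) * (density_max powr \<theta> * vol l powr \<theta>)) (q ` around x)" for l
      using fin density_bounds(2) by (intro has_sum_finiteI) (auto simp: g_def powr_mult less_imp_le)
    show "(\<lambda>l. real (card (q ` around x)) * (density_max powr \<theta> * vol l powr \<theta>)) summable_on {m0..}"
      by (intro summable_on_cmult_right summable_vol_powr assms)
  qed (simp add: g_def)
  then have "g summable_on ((\<lambda>\<psi>. (m \<psi>, q \<psi>)) ` around x)"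
    by (rule summable_on_subset_banach) (use m_ge in auto)
  then have "(\<lambda>\<psi>. (density_max * vol (m \<psi>)) powr \<theta>) summable_on around x"
    using summable_on_reindex[OF inj, of g] by (simp add: g_def o_def)
  then show ?thesis
  proof (rule summable_on_comparison_test)
    show "volume \<psi> powr \<theta> \<le> (density_max * vol (m \<psi>)) powr \<theta>" if "\<psi> \<in> around x" for \<psi>
      using upper[OF that] assms by (intro powr_mono2) auto
  qed simp
qed

lemma finite_around_large:
  assumes "0 < \<delta>"
  shows "finite {\<psi> \<in> around x. \<delta> \<le> volume \<psi>}"
proof -
  obtain m and q :: "('x \<Rightarrow> complex) \<Rightarrow> ('x, 'k, 'n) chart \<times> ('n \<Rightarrow> 'k set)"
    where inj: "inj_on (\<lambda>\<psi>. (m \<psi>, q \<psi>)) (around x)" and fin: "finite (q ` around x)"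
    and lower: "\<And>\<psi>. \<psi> \<in> around x \<Longrightarrow> density_min * vol (m \<psi>) \<le> volume \<psi>"
    and upper: "\<And>\<psi>. \<psi> \<in> around x \<Longrightarrow> volume \<psi> \<le> density_max * vol (m \<psi>)"
    by (rule around_coordinates[of x], rule that) assumption+
  define L where "L = {l. \<delta> / density_max \<le> vol l \<and> vol l \<le> measure \<mu> UNIV / density_min}"
  have "finite L"
    unfolding L_def using assms density_bounds(2) by (intro finite_vol_levels) simp
  moreover have "m \<psi> \<in> L" if "\<psi> \<in> around x" "\<delta> \<le> volume \<psi>" for \<psi>
    using lower[OF that(1)] upper[OF that(1)] that(2) bounded_measure[of "supp \<psi>"] density_bounds(1,2)
    by (simp add: L_def field_simps)
  then have "(\<lambda>\<psi>. (m \<psi>, q \<psi>)) ` {\<psi> \<in> around x. \<delta> \<le> volume \<psi>} \<subseteq> L \<times> q ` around x"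
    by blast
  ultimately have "finite ((\<lambda>\<psi>. (m \<psi>, q \<psi>)) ` {\<psi> \<in> around x. \<delta> \<le> volume \<psi>})"
    using fin finite_subset by blast
  moreover have "inj_on (\<lambda>\<psi>. (m \<psi>, q \<psi>)) {\<psi> \<in> around x. \<delta> \<le> volume \<psi>}"
    using inj by (rule inj_on_subset) blast
  ultimately show ?thesis
    using finite_imageD by blast
qed

text \<open>A ball containing two distinct points cannot be too small, since charts separate them.\<close>

lemma finite_around_both:
  assumes "x \<noteq> y"
  shows "finite (around x \<inter> around y)"
proof -
  have "\<exists>k. c \<in> A \<longrightarrow> x \<in> fst c \<longrightarrow> y \<in> fst c \<longrightarrow> snd c y \<notin> pball k (snd c x)" for c
    using pball_separates[of "snd c x" "snd c y"] chart_inj[of c] assms by (metis inj_onD)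
  then obtain k where k: "\<And>c. c \<in> A \<Longrightarrow> x \<in> fst c \<Longrightarrow> y \<in> fst c \<Longrightarrow> snd c y \<notin> pball (k c) (snd c x)"
    by metis
  define K where "K = Max (k ` A)"
  have "around x \<inter> around y \<subseteq> {\<psi> \<in> around x. density_min * vol K \<le> volume \<psi>}"
  proof
    fix \<psi> assume \<psi>: "\<psi> \<in> around x \<inter> around y"
    then have w: "\<psi> \<in> wavelets A \<mu> \<pi> \<xi>" and xy: "x \<in> supp \<psi>" "y \<in> supp \<psi>"
      using \<Psi>_wavelet by auto
    obtain c where c: "c \<in> A" "supp \<psi> \<subseteq> fst c"
      using mball_chart[OF wavelet_mball[OF w]] by blast
    obtain m \<eta> C where form: "wave_form c (supp \<psi>) \<psi> m \<eta> C"
      using wavelet_form[OF w c] by blast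
    have img: "snd c ` supp \<psi> = pball m (snd c x)"
      by (rule wave_form_image[OF form xy(1)])
    then have "snd c y \<in> pball m (snd c x)"
      using xy(2) by blast
    moreover have "snd c y \<notin> pball (k c) (snd c x)"
      using k[OF c(1)] c(2) xy by blast
    ultimately have "m \<le> k c"
      using pball_mono[of "k c" m "snd c x"] by force
    also have "k c \<le> K"
      unfolding K_def using finite_atlas c(1) by simp
    finally have "vol K \<le> vol m"
      by (rule vol_antimono)
    then have "density_min * vol K \<le> density_min * vol m"
      using density_bounds(1) by (simp add: mult_left_mono less_imp_le)
    also have "\<dots> \<le> volume \<psi>"
      by (rule measure_ball_bounds(1)[OF wavelet_mball[OF w] c img])
    finally show "\<psi> \<in> {\<psi> \<in> around x. density_min * vol K \<le> volume \<psi>}"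
      using \<psi> by blast
  qed
  moreover have "finite {\<psi> \<in> around x. density_min * vol K \<le> volume \<psi>}"
    using density_bounds(1) by (intro finite_around_large) simp
  ultimately show ?thesis
    by (rule finite_subset)
qed


section \<open>The Green function\<close>

abbreviation lam :: "('x \<Rightarrow> complex) \<Rightarrow> real" where
  "lam \<psi> \<equiv> eigenvalue A \<mu> s \<psi>"

lemma eigenvalue_ge: "volume \<psi> powr (1 - s) \<le> lam \<psi>"
  unfolding eigenvalue_def eigenvalue_at_def set_lebesgue_integral_def by simp

lemma eigenvalue_pos: "\<psi> \<in> \<Psi> \<Longrightarrow> 0 < lam \<psi>"
  using eigenvalue_ge[of \<psi>] volume_pos[of \<psi>] by (metis less_le_trans powr_gt_zero less_irrefl)

lemma norm_wavelet_prod_le: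
  assumes "\<psi> \<in> \<Psi>"
  shows "cmod (\<psi> x) * cmod (\<psi> y) \<le> 1 / volume \<psi>"
proof -
  have "cmod (\<psi> x) * cmod (\<psi> y) \<le> sqrt (1 / volume \<psi>) * sqrt (1 / volume \<psi>)"
    using wavelet_bounded[OF \<Psi>_wavelet[OF assms]] by (intro mult_mono) auto
  then show ?thesis
    using volume_pos[OF assms] by simp
qed

lemma norm_heat_term_le:
  assumes "\<psi> \<in> \<Psi>" "0 < t"
  shows "norm (heat_term A \<mu> s t x y \<psi>) \<le> (t * (s - 1) / 2) powr (- 2 / (s - 1)) * volume \<psi>"
proof -
  have "norm (heat_term A \<mu> s t x y \<psi>) = exp (- t * lam \<psi>) * (cmod (\<psi> x) * cmod (\<psi> y))"
    by (simp add: heat_term_def norm_mult)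
  also have "\<dots> \<le> exp (- t * volume \<psi> powr (1 - s)) * (1 / volume \<psi>)"
    using eigenvalue_ge[of \<psi>] norm_wavelet_prod_le[OF assms(1)] assms(2)
    by (intro mult_mono) (auto simp: mult_left_mono)
  also have "\<dots> \<le> (t * (s - 1) / 2) powr (- 2 / (s - 1)) * volume \<psi>"
    using exp_powr_bound[OF s_gt_1 assms(2) volume_pos[OF assms(1)]] by simp
  finally show ?thesis .
qed

lemma summable_heat_term:
  assumes "0 < t"
  shows "heat_term A \<mu> s t x y summable_on \<Psi>"
proof -
  have "(\<lambda>\<psi>. (t * (s - 1) / 2) powr (- 2 / (s - 1)) * volume \<psi>) summable_on around x"
    using summable_volume_powr[of 1 x] by (intro summable_on_cmult_right) simp
  then have "(\<lambda>\<psi>. norm (heat_term A \<mu> s t x y \<psi>)) summable_on around x"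
    by (rule summable_on_comparison_test) (use norm_heat_term_le assms in auto)
  then have "heat_term A \<mu> s t x y summable_on around x"
    by (rule abs_summable_summable)
  also have "?this \<longleftrightarrow> heat_term A \<mu> s t x y summable_on \<Psi>"
    by (intro summable_on_cong_neutral) (auto simp: heat_term_def supp_def)
  finally show ?thesis .
qed

lemma heat_term_integral:
  assumes "\<psi> \<in> \<Psi>"
  shows "has_bochner_integral lborel (\<lambda>t. indicator {0<..} t *\<^sub>R heat_term A \<mu> s t x y \<psi>)
    (green_term A \<mu> s x y \<psi>)"
proof -
  have "has_bochner_integral lborel (\<lambda>t. complex_of_real (indicator {0<..} t * exp (- t * lam \<psi>)))
      (complex_of_real (inverse (lam \<psi>)))"
    using eigenvalue_pos[OF assms] by (intro has_bochner_integral_of_real has_bochner_integral_exp)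
  then have "has_bochner_integral lborel
      (\<lambda>t. complex_of_real (indicator {0<..} t * exp (- t * lam \<psi>)) * (\<psi> x * cnj (\<psi> y)))
      (complex_of_real (inverse (lam \<psi>)) * (\<psi> x * cnj (\<psi> y)))"
    by (intro has_bochner_integral_mult_left) auto
  then show ?thesis
    by (simp add: heat_term_def green_term_def scaleR_conv_of_real mult.assoc)
qed

lemma green_off_diagonal:
  assumes "x \<noteq> y"
  shows "set_integrable lborel {0<..} (\<lambda>t. heat_kernel A \<mu> s \<Psi> t x y)"
    and "(green_term A \<mu> s x y has_sum green A \<mu> s \<Psi> x y) \<Psi>"
proof -
  let ?S = "around x \<inter> around y"
  have fin: "finite ?S"
    by (rule finite_around_both[OF assms])
  have kernel: "heat_kernel A \<mu> s \<Psi> t x y = (\<Sum>\<psi>\<in>?S. heat_term A \<mu> s t x y \<psi>)" for t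
  proof -
    have "heat_kernel A \<mu> s \<Psi> t x y = infsum (heat_term A \<mu> s t x y) ?S"
      unfolding heat_kernel_def by (intro infsum_cong_neutral) (auto simp: heat_term_def supp_def)
    then show ?thesis
      using fin by simp
  qed
  have "has_bochner_integral lborel (\<lambda>t. \<Sum>\<psi>\<in>?S. indicator {0<..} t *\<^sub>R heat_term A \<mu> s t x y \<psi>)
      (\<Sum>\<psi>\<in>?S. green_term A \<mu> s x y \<psi>)"
    by (intro has_bochner_integral_sum heat_term_integral) auto
  then have int: "has_bochner_integral lborel (\<lambda>t. indicator {0<..} t *\<^sub>R heat_kernel A \<mu> s \<Psi> t x y)
      (\<Sum>\<psi>\<in>?S. green_term A \<mu> s x y \<psi>)"
    by (simp add: kernel scaleR_sum_right)
  then show "set_integrable lborel {0<..} (\<lambda>t. heat_kernel A \<mu> s \<Psi> t x y)"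
    unfolding set_integrable_def by (rule integrable.intros)
  have "green A \<mu> s \<Psi> x y = (\<Sum>\<psi>\<in>?S. green_term A \<mu> s x y \<psi>)"
    unfolding green_def set_lebesgue_integral_def by (rule has_bochner_integral_integral_eq[OF int])
  then have "(green_term A \<mu> s x y has_sum green A \<mu> s \<Psi> x y) ?S"
    using fin by (intro has_sum_finiteI)
  also have "?this \<longleftrightarrow> (green_term A \<mu> s x y has_sum green A \<mu> s \<Psi> x y) \<Psi>"
    by (intro has_sum_cong_neutral) (auto simp: green_term_def supp_def)
  finally show "(green_term A \<mu> s x y has_sum green A \<mu> s \<Psi> x y) \<Psi>" .
qed

text \<open>On the diagonal all terms are non-negative reals and monotone convergence applies.\<close>

lemma diagonal_terms:
  "heat_term A \<mu> s t x x \<psi> = complex_of_real (exp (- t * lam \<psi>) * (cmod (\<psi> x))\<^sup>2)"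
  "green_term A \<mu> s x x \<psi> = complex_of_real (inverse (lam \<psi>) * (cmod (\<psi> x))\<^sup>2)"
  by (simp_all only: heat_term_def green_term_def of_real_mult complex_norm_square mult.assoc)

lemma diagonal_kernel:
  assumes "0 < t"
  shows "heat_kernel A \<mu> s \<Psi> t x x = complex_of_real (Re (heat_kernel A \<mu> s \<Psi> t x x))"
    and "0 \<le> Re (heat_kernel A \<mu> s \<Psi> t x x)"
    and "ennreal (Re (heat_kernel A \<mu> s \<Psi> t x x)) =
      (\<Sum>\<^sub>\<infinity>\<psi>\<in>around x. ennreal (exp (- t * lam \<psi>) * (cmod (\<psi> x))\<^sup>2))"
proof -
  let ?h = "\<lambda>\<psi>. exp (- t * lam \<psi>) * (cmod (\<psi> x))\<^sup>2"
  have heat: "heat_term A \<mu> s t x x = (\<lambda>\<psi>. complex_of_real (?h \<psi>))"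
    by (rule ext) (rule diagonal_terms(1))
  have "(\<lambda>\<psi>. complex_of_real (?h \<psi>)) summable_on \<Psi>"
    unfolding heat[symmetric] by (rule summable_heat_term[OF assms])
  then have "(\<lambda>\<psi>. Re (complex_of_real (?h \<psi>))) summable_on \<Psi>"
    by (rule summable_on_Re)
  then have summable: "?h summable_on \<Psi>"
    by simp
  then have "((\<lambda>\<psi>. complex_of_real (?h \<psi>)) has_sum complex_of_real (infsum ?h \<Psi>)) \<Psi>"
    by (intro has_sum_of_real has_sum_infsum)
  then have kernel: "heat_kernel A \<mu> s \<Psi> t x x = complex_of_real (infsum ?h \<Psi>)"
    unfolding heat_kernel_def heat by (rule infsumI)
  then show "heat_kernel A \<mu> s \<Psi> t x x = complex_of_real (Re (heat_kernel A \<mu> s \<Psi> t x x))"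
    by simp
  show "0 \<le> Re (heat_kernel A \<mu> s \<Psi> t x x)"
    unfolding kernel by (simp add: infsum_nonneg)
  have "ennreal (Re (heat_kernel A \<mu> s \<Psi> t x x)) = (\<Sum>\<^sub>\<infinity>\<psi>\<in>\<Psi>. ennreal (?h \<psi>))"
    unfolding kernel Re_complex_of_real by (rule ennreal_infsum[OF summable]) simp
  also have "\<dots> = (\<Sum>\<^sub>\<infinity>\<psi>\<in>around x. ennreal (?h \<psi>))"
    by (intro infsum_cong_neutral) (auto simp: supp_def)
  finally show "ennreal (Re (heat_kernel A \<mu> s \<Psi> t x x)) = (\<Sum>\<^sub>\<infinity>\<psi>\<in>around x. ennreal (?h \<psi>))" .
qed

lemma green_diagonal:
  "(\<integral>\<^sup>+ t\<in>{0<..}. ennreal (Re (heat_kernel A \<mu> s \<Psi> t x x)) \<partial>lborel) =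
    (\<Sum>\<^sub>\<infinity>\<psi>\<in>\<Psi>. ennreal (Re (green_term A \<mu> s x x \<psi>)))"
  "(\<lambda>t. ennreal (Re (heat_kernel A \<mu> s \<Psi> t x x)) * indicator {0<..} t) \<in> borel_measurable lborel"
proof -
  define f where "f \<psi> t = ennreal (indicator {0<..} t * exp (- t * lam \<psi>)) * ennreal ((cmod (\<psi> x))\<^sup>2)" for \<psi> t
  have eq: "ennreal (Re (heat_kernel A \<mu> s \<Psi> t x x)) * indicator {0<..} t = (\<Sum>\<^sub>\<infinity>\<psi>\<in>around x. f \<psi> t)" for t
  proof (cases "0 < t")
    case True
    then show ?thesis
      using diagonal_kernel(3)[OF True] by (simp add: f_def ennreal_mult)
  next
    case False
    then show ?thesis
      by (simp add: f_def)
  qed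
  have f_meas: "f \<psi> \<in> borel_measurable lborel" for \<psi>
    unfolding f_def by measurable
  show "(\<lambda>t. ennreal (Re (heat_kernel A \<mu> s \<Psi> t x x)) * indicator {0<..} t) \<in> borel_measurable lborel"
    unfolding eq by (rule nn_integral_infsum(2)[OF countable_around f_meas])
  have f_int: "(\<integral>\<^sup>+ t. f \<psi> t \<partial>lborel) = ennreal (Re (green_term A \<mu> s x x \<psi>))" if "\<psi> \<in> around x" for \<psi>
  proof -
    have pos: "0 < lam \<psi>"
      using that eigenvalue_pos by blast
    have "(\<integral>\<^sup>+ t. ennreal (indicator {0<..} t * exp (- t * lam \<psi>)) \<partial>lborel) = ennreal (inverse (lam \<psi>))"
      using has_bochner_integral_exp[OF pos] nn_integral_eq_integral[of lborel "\<lambda>t. indicator {0<..} t * exp (- t * lam \<psi>)"]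
      by (simp add: has_bochner_integral_iff)
    then have "(\<integral>\<^sup>+ t. f \<psi> t \<partial>lborel) = ennreal (inverse (lam \<psi>)) * ennreal ((cmod (\<psi> x))\<^sup>2)"
      unfolding f_def by (subst nn_integral_multc) auto
    also have "\<dots> = ennreal (inverse (lam \<psi>) * (cmod (\<psi> x))\<^sup>2)"
      using pos by (intro ennreal_mult[symmetric]) auto
    finally show ?thesis
      by (simp only: diagonal_terms(2) Re_complex_of_real)
  qed
  have "(\<integral>\<^sup>+ t\<in>{0<..}. ennreal (Re (heat_kernel A \<mu> s \<Psi> t x x)) \<partial>lborel) =
      (\<Sum>\<^sub>\<infinity>\<psi>\<in>around x. \<integral>\<^sup>+ t. f \<psi> t \<partial>lborel)"
    unfolding eq by (rule nn_integral_infsum(1)[OF countable_around f_meas])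
  also have "\<dots> = (\<Sum>\<^sub>\<infinity>\<psi>\<in>\<Psi>. ennreal (Re (green_term A \<mu> s x x \<psi>)))"
    by (intro infsum_cong_neutral) (auto simp: f_int green_term_def supp_def)
  finally show "(\<integral>\<^sup>+ t\<in>{0<..}. ennreal (Re (heat_kernel A \<mu> s \<Psi> t x x)) \<partial>lborel) =
    (\<Sum>\<^sub>\<infinity>\<psi>\<in>\<Psi>. ennreal (Re (green_term A \<mu> s x x \<psi>)))" .
qed

lemma green_diagonal_finite:
  assumes "2 < s"
  shows "set_integrable lborel {0<..} (\<lambda>t. heat_kernel A \<mu> s \<Psi> t x x)"
    and "(green_term A \<mu> s x x has_sum green A \<mu> s \<Psi> x x) \<Psi>"
proof -
  define a where "a \<psi> = inverse (lam \<psi>) * (cmod (\<psi> x))\<^sup>2" for \<psi>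
  have a_nonneg: "0 \<le> a \<psi>" if "\<psi> \<in> \<Psi>" for \<psi>
    using eigenvalue_pos[OF that] by (simp add: a_def)
  have "a summable_on around x"
  proof (rule summable_on_comparison_test[OF summable_volume_powr[of "s - 2"]])
    fix \<psi> assume \<psi>: "\<psi> \<in> around x"
    then have v: "0 < volume \<psi>"
      using volume_pos by blast
    have "inverse (lam \<psi>) \<le> inverse (volume \<psi> powr (1 - s))"
      using eigenvalue_ge v by (intro le_imp_inverse_le) auto
    then have "a \<psi> \<le> inverse (volume \<psi> powr (1 - s)) * (1 / volume \<psi>)"
      unfolding a_def using \<psi> by (intro mult_mono) (auto simp: wavelet_norm[OF \<Psi>_wavelet])
    also have "\<dots> = volume \<psi> powr (s - 1) * volume \<psi> powr (- 1)"
      using v by (simp add: powr_minus[symmetric] powr_minus_divide)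
    also have "\<dots> = volume \<psi> powr (s - 2)"
      using powr_add[of "volume \<psi>" "s - 1" "- 1"] by simp
    finally show "a \<psi> \<le> volume \<psi> powr (s - 2)" .
    show "0 \<le> a \<psi>"
      using a_nonneg \<psi> by blast
  qed (use assms in simp)
  also have "a summable_on around x \<longleftrightarrow> a summable_on \<Psi>"
    by (intro summable_on_cong_neutral) (auto simp: a_def supp_def)
  finally have summable: "a summable_on \<Psi>" .
  let ?r = "\<lambda>t. indicator {0<..} t * Re (heat_kernel A \<mu> s \<Psi> t x x)"
  have r_ennreal: "ennreal (?r t) = ennreal (Re (heat_kernel A \<mu> s \<Psi> t x x)) * indicator {0<..} t" for t
    by (simp split: split_indicator)
  have r_nonneg: "0 \<le> ?r t" for t
    using diagonal_kernel(2)[of t x] by (simp split: split_indicator)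
  have "has_bochner_integral lborel ?r (infsum a \<Psi>)"
  proof (rule has_bochner_integral_nn_integral)
    have "(\<lambda>t. enn2real (ennreal (?r t))) \<in> borel_measurable lborel"
      unfolding r_ennreal using green_diagonal(2) by measurable
    then show "?r \<in> borel_measurable lborel"
      using r_nonneg by simp
    have "(\<integral>\<^sup>+ t. ennreal (?r t) \<partial>lborel) = (\<Sum>\<^sub>\<infinity>\<psi>\<in>\<Psi>. ennreal (a \<psi>))"
      unfolding r_ennreal green_diagonal(1)
      by (simp only: diagonal_terms(2) Re_complex_of_real a_def)
    then show "(\<integral>\<^sup>+ t. ennreal (?r t) \<partial>lborel) = ennreal (infsum a \<Psi>)"
      using ennreal_infsum[OF summable a_nonneg] by simp
  qed (use r_nonneg a_nonneg in \<open>auto intro: infsum_nonneg\<close>)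
  then have "has_bochner_integral lborel (\<lambda>t. complex_of_real (?r t)) (complex_of_real (infsum a \<Psi>))"
    by (rule has_bochner_integral_of_real)
  moreover have "complex_of_real (?r t) = indicator {0<..} t *\<^sub>R heat_kernel A \<mu> s \<Psi> t x x" for t
    using diagonal_kernel(1)[of t x] by (simp split: split_indicator)
  ultimately have int: "has_bochner_integral lborel (\<lambda>t. indicator {0<..} t *\<^sub>R heat_kernel A \<mu> s \<Psi> t x x)
      (complex_of_real (infsum a \<Psi>))"
    by simp
  then show "set_integrable lborel {0<..} (\<lambda>t. heat_kernel A \<mu> s \<Psi> t x x)"
    unfolding set_integrable_def by (rule integrable.intros)
  have green: "green A \<mu> s \<Psi> x x = complex_of_real (infsum a \<Psi>)"
    unfolding green_def set_lebesgue_integral_def by (rule has_bochner_integral_integral_eq[OF int])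
  have "green_term A \<mu> s x x = (\<lambda>\<psi>. complex_of_real (a \<psi>))"
    by (simp add: fun_eq_iff diagonal_terms(2) a_def)
  then show "(green_term A \<mu> s x x has_sum green A \<mu> s \<Psi> x x) \<Psi>"
    unfolding green using has_sum_of_real[OF has_sum_infsum[OF summable]] by simp
qed

lemma green_formula: "green_function_formula A \<mu> s \<Psi>"
proof -
  have "set_integrable lborel {0<..} (\<lambda>t. heat_kernel A \<mu> s \<Psi> t x y) \<and>
      (green_term A \<mu> s x y has_sum green A \<mu> s \<Psi> x y) \<Psi>" if "x \<noteq> y \<or> 2 < s" for x y
    using green_off_diagonal[of x y] green_diagonal_finite[of x] that by (cases "x = y") auto
  then show ?thesis
    unfolding green_function_formula_def using summable_heat_term green_diagonal(1) by simp
qed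

end


section \<open>The spectral and the Green function statement\<close>

theorem corollary3p14:
  fixes A :: "('x::t2_space, 'k::nonarch_local_field, 'n::finite) chart set"
    and \<omega> :: "('x, 'k, 'n) chart \<Rightarrow> 'k ^ 'n \<Rightarrow> 'k"
    and H :: "('k ^ 'n) measure"
    and \<mu> :: "'x measure"
    and \<pi> :: 'k
    and \<xi> :: "'k \<Rightarrow> complex"
    and p :: nat
    and s :: real
  assumes "residue_characteristic TYPE('k) p"
    and "uniformiser \<pi>"
    and "additive_character \<pi> \<xi>"
    and "haar_measure H"
    and "compact (UNIV :: 'x set)"
    and "analytic_atlas A"
    and "finite A"
    and "equalising p A"
    and "nerve_graph_connected A"
    and "\<forall>c\<in>A. compact (fst c)"
    and "analytic_top_form A \<omega>"
    and "nowhere_vanishing A \<omega>"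
    and "form_measure A \<omega> H \<mu>"
    and "s > 1"
  shows "(\<exists>\<epsilon>\<^sub>0>0. \<forall>\<epsilon>. 0 < \<epsilon> \<and> \<epsilon> \<le> \<epsilon>\<^sub>0 \<longrightarrow>
            non_overlapping (small_wavelets A \<mu> \<pi> \<xi> \<epsilon>) \<and>
            (\<forall>\<Psi>. wavelet_basis A \<mu> \<pi> \<xi> \<epsilon> \<Psi> \<longrightarrow>
               (\<forall>\<psi>\<in>\<Psi>.
                  (\<forall>x\<in>supp \<psi>. eigenvalue A \<mu> s \<psi> = eigenvalue_at A \<mu> s \<psi> x) \<and>
                  (\<forall>x. laplacian A \<mu> s \<psi> x = complex_of_real (eigenvalue A \<mu> s \<psi>) * \<psi> x))))
       \<and> (\<forall>\<epsilon> \<Psi>. 0 < \<epsilon> \<and> non_overlapping (small_wavelets A \<mu> \<pi> \<xi> \<epsilon>) \<and>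
            wavelet_basis A \<mu> \<pi> \<xi> \<epsilon> \<Psi> \<longrightarrow>
            green_function_formula A \<mu> s \<Psi>)"
proof -
  interpret wavelet_manifold \<pi> H A \<omega> \<mu> \<xi> s
    by unfold_locales (use assms in simp_all)
  show ?thesis
  proof (rule conjI)
    have small: "non_overlapping (small_wavelets A \<mu> \<pi> \<xi> \<epsilon>) \<and>
        (\<forall>\<Psi>. wavelet_basis A \<mu> \<pi> \<xi> \<epsilon> \<Psi> \<longrightarrow>
           (\<forall>\<psi>\<in>\<Psi>.
              (\<forall>x\<in>supp \<psi>. eigenvalue A \<mu> s \<psi> = eigenvalue_at A \<mu> s \<psi> x) \<and>
              (\<forall>x. laplacian A \<mu> s \<psi> x = complex_of_real (eigenvalue A \<mu> s \<psi>) * \<psi> x)))"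
      if \<epsilon>: "0 < \<epsilon> \<and> \<epsilon> \<le> fine_measure" for \<epsilon>
    proof (intro conjI allI impI ballI)
      show "non_overlapping (small_wavelets A \<mu> \<pi> \<xi> \<epsilon>)"
        using \<epsilon> by (intro small_wavelets_non_overlapping) simp
    next
      fix \<Psi> \<psi> x assume basis: "wavelet_basis A \<mu> \<pi> \<xi> \<epsilon> \<Psi>" "\<psi> \<in> \<Psi>"
      note fine = basis_wavelet_fine[OF conjunct2[OF \<epsilon>] basis]
      show "eigenvalue A \<mu> s \<psi> = eigenvalue_at A \<mu> s \<psi> x" if "x \<in> supp \<psi>"
        by (rule eigenvalue_at_const[OF fine that])
      show "laplacian A \<mu> s \<psi> x = complex_of_real (eigenvalue A \<mu> s \<psi>) * \<psi> x"
        by (rule laplacian_wavelet[OF fine])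
    qed
    show "\<exists>\<epsilon>\<^sub>0>0. \<forall>\<epsilon>. 0 < \<epsilon> \<and> \<epsilon> \<le> \<epsilon>\<^sub>0 \<longrightarrow>
        non_overlapping (small_wavelets A \<mu> \<pi> \<xi> \<epsilon>) \<and>
        (\<forall>\<Psi>. wavelet_basis A \<mu> \<pi> \<xi> \<epsilon> \<Psi> \<longrightarrow>
           (\<forall>\<psi>\<in>\<Psi>.
              (\<forall>x\<in>supp \<psi>. eigenvalue A \<mu> s \<psi> = eigenvalue_at A \<mu> s \<psi> x) \<and>
              (\<forall>x. laplacian A \<mu> s \<psi> x = complex_of_real (eigenvalue A \<mu> s \<psi>) * \<psi> x)))"
      by (intro exI[of _ fine_measure] conjI[OF fine_measure_pos] allI impI) (rule small)
  next
    show "\<forall>\<epsilon> \<Psi>. 0 < \<epsilon> \<and> non_overlapping (small_wavelets A \<mu> \<pi> \<xi> \<epsilon>) \<and>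
        wavelet_basis A \<mu> \<pi> \<xi> \<epsilon> \<Psi> \<longrightarrow> green_function_formula A \<mu> s \<Psi>"
    proof (intro allI impI, elim conjE)
      fix \<epsilon> \<Psi> assume "wavelet_basis A \<mu> \<pi> \<xi> \<epsilon> \<Psi>"
      then interpret orthonormal_wavelets \<pi> H A \<omega> \<mu> \<xi> s \<Psi>
        by unfold_locales (simp_all add: wavelet_basis_def orthonormal_basis_def)
      show "green_function_formula A \<mu> s \<Psi>"
        by (rule green_formula)
    qed
  qed
qed

end
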